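(* Let $(M,\omega)$ be a compact connected quantizable Kähler manifold with very ample quantum line bundle $(L,h)$, let $i:M\to\mathbb{P}^N(\mathbb{C})$ be the coherent state embedding, and let $m\in\mathbb{N}$, $m\geq2$. Let $\Psi_M^{(m)}$ and $\Psi_{\mathbb{P}^N(\mathbb{C})}^{(m)}$ be the cyclic $m$-point functions of $M$ and of projective space, and let $\widehat{i(x)}\in\mathbb{C}^{N+1}$ denote an arbitrary (fixed) homogeneous representative of the point $i(x)$. Then for all $x^{(1)},\dots,x^{(m)}\in M$ $$\Psi_M^{(m)}(x^{(1)},\dots,x^{(m)})=i^*(\Psi_{\mathbb{P}^N(\mathbb{C})}^{(m)})(x^{(1)},\dots,x^{(m)})=\Psi_{\mathbb{P}^N(\mathbb{C})}^{(m)}(i(x^{(1)}),\dots,i(x^{(m)}))$$ $$=\frac{\langle\widehat{i(x^{(2)})},\widehat{i(x^{(1)})}\rangle\,\langle\widehat{i(x^{(3)})},\widehat{i(x^{(2)})}\rangle\cdots\langle\widehat{i(x^{(1)})},\widehat{i(x^{(m)})}\rangle}{\|\widehat{i(x^{(1)})}\|^2\,\|\widehat{i(x^{(2)})}\|^2\cdots\|\widehat{i(x^{(m)})}\|^2}.$$ The function $\Psi_M^{(m)}$ is invariant under cyclic permutations of its arguments.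
   Context: Quantum line bundle: a holomorphic line bundle $\pi:L\to M$ over the Kähler manifold $(M,\omega)$ with hermitian metric $h$ whose Chern connection has curvature $-\mathrm{i}\,\omega$; locally $\omega=-\mathrm{i}\,\partial\bar\partial\log\hat h$. $M$ is quantizable if such a bundle exists. $L$ very ample means that a basis of global holomorphic sections of $L$ defines a holomorphic embedding of $M$ into projective space. All hermitian metrics and scalar products are conjugate linear in the first argument; on $\mathbb{C}^{N+1}$, $\langle u,v\rangle=\sum_j\bar u_jv_j$. Scalar product on the space $\Gamma_{hol}(M,L)$ of global holomorphic sections: $\langle\varphi,\psi\rangle=\int_M h(\varphi,\psi)\,\Omega$, where $\Omega=\frac{1}{n!}\omega^n$, $n=\dim_{\mathbb{C}}M$, is the (positive) Liouville volume form. Coherent vectors: let $L_0$ be the total space of $L$ minus the zero section. For $q\in L_0$ define a linear form $\hat q$ on $\Gamma_{hol}(M,L)$ by $s(\pi(q))=\hat q(s)\,q$. The coherent vector $e_q\in\Gamma_{hol}(M,L)$ is the unique section with $\langle e_q,s\rangle=\hat q(s)$ for all $s$; $e_{cq}=\bar c^{-1}e_q$ for $c\in\mathbb{C}^*$. Cyclic $m$-point function: $\Psi_M^{(m)}(x^{(1)},\dots,x^{(m)})=\dfrac{\langle e_{q^{(1)}},e_{q^{(2)}}\rangle\langle e_{q^{(2)}},e_{q^{(3)}}\rangle\cdots\langle e_{q^{(m)}},e_{q^{(1)}}\rangle}{\|e_{q^{(1)}}\|^2\|e_{q^{(2)}}\|^2\cdots\|e_{q^{(m)}}\|^2}$ with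 any $q^{(k)}\in L_0$, $\pi(q^{(k)})=x^{(k)}$ (independent of the choice). Coherent state embedding: fix an orthonormal basis $s_0,\dots,s_N$ of $\Gamma_{hol}(M,L)$; $i(x)=(s_0(x):\cdots:s_N(x))$. Projective space: $\mathbb{P}^N(\mathbb{C})$ carries the Fubini-Study form $\omega_{FS}=\mathrm{i}\,\partial\bar\partial\log(1+\|w\|^2)$ (affine coordinates $w_j=z_j/z_0$), with quantum line bundle the hyperplane bundle $H$ (dual of the tautological bundle) whose metric in the affine chart $z_0\neq0$, in the frame given by the section corresponding to the linear form $Z_0$, is $1/(1+\|w\|^2)$. Coherent vectors and the $m$-point function for $(\mathbb{P}^N(\mathbb{C}),\omega_{FS},H)$ are defined by the same recipe as for $(M,\omega,L)$. *)

theory Defs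
  imports "HOL-Analysis.Analysis" "HOL-Combinatorics.Permutations"
begin

section \<open>Several complex variables\<close>

text \<open>
  Dimensions occur as natural numbers (also \<open>0\<close>), so \<open>\<complex>\<^sup>n\<close> is a set of sequences rather than a type;
  as in \<^term>\<open>Euclidean_space n\<close>, the coordinates from \<open>n\<close> on are zero. Its topology is induced from the
  product topology of \<^typ>\<open>nat \<Rightarrow> complex\<close>.
\<close>

type_synonym cvec = "nat \<Rightarrow> complex"

definition cspace :: "nat \<Rightarrow> cvec set" where
  "cspace n = {w. \<forall>j\<ge>n. w j = 0}"

definition cinner :: "nat \<Rightarrow> cvec \<Rightarrow> cvec \<Rightarrow> complex" where
  "cinner n u v = (\<Sum>j<n. cnj (u j) * v j)"

definition cnorm2 :: "nat \<Rightarrow> cvec \<Rightarrow> real" where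
  "cnorm2 n w = (\<Sum>j<n. (cmod (w j))\<^sup>2)"

definition cscale :: "complex \<Rightarrow> cvec \<Rightarrow> cvec" where
  "cscale c u = (\<lambda>j. c * u j)"

definition cadd :: "cvec \<Rightarrow> cvec \<Rightarrow> cvec" where
  "cadd u v = (\<lambda>j. u j + v j)"

definition axis_vec :: "nat \<Rightarrow> complex \<Rightarrow> cvec" where
  "axis_vec j c = (\<lambda>k. if k = j then c else 0)"

definition clebesgue :: "nat \<Rightarrow> cvec measure" where
  "clebesgue n = distr (Pi\<^sub>M {..<n} (\<lambda>_. lborel)) borel (\<lambda>w j. if j < n then w j else 0)"

definition dir_deriv :: "cvec \<Rightarrow> (cvec \<Rightarrow> 'a::real_normed_vector) \<Rightarrow> cvec \<Rightarrow> 'a" where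
  "dir_deriv u f w = vector_derivative (\<lambda>t::real. f (cadd w (cscale (of_real t) u))) (at 0)"

primrec Ck_on :: "nat \<Rightarrow> nat \<Rightarrow> cvec set \<Rightarrow> (cvec \<Rightarrow> 'a::real_normed_vector) \<Rightarrow> bool" where
  "Ck_on n 0 U f = continuous_on U f"
| "Ck_on n (Suc k) U f = (continuous_on U f \<and>
     (\<forall>u\<in>cspace n.
        (\<forall>w\<in>U. (\<lambda>t::real. f (cadd w (cscale (of_real t) u))) differentiable (at 0)) \<and>
        Ck_on n k U (dir_deriv u f)))"

definition smooth_on :: "nat \<Rightarrow> cvec set \<Rightarrow> (cvec \<Rightarrow> 'a::real_normed_vector) \<Rightarrow> bool" where
  "smooth_on n U f \<longleftrightarrow> (\<forall>k. Ck_on n k U f)"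

definition mv_holomorphic_on :: "nat \<Rightarrow> cvec set \<Rightarrow> (cvec \<Rightarrow> complex) \<Rightarrow> bool" where
  "mv_holomorphic_on n U f \<longleftrightarrow> continuous_on U f \<and>
     (\<forall>w\<in>U. \<forall>j<n. (\<lambda>z. f (w(j := z))) field_differentiable (at (w j)))"

text \<open>The Wirtinger derivatives \<open>\<partial>/\<partial>w\<^sub>j\<close> and their conjugates.\<close>

definition wirt :: "nat \<Rightarrow> (cvec \<Rightarrow> complex) \<Rightarrow> cvec \<Rightarrow> complex" where
  "wirt j f w = (dir_deriv (axis_vec j 1) f w - \<i> * dir_deriv (axis_vec j \<i>) f w) / 2"

definition wirt_bar :: "nat \<Rightarrow> (cvec \<Rightarrow> complex) \<Rightarrow> cvec \<Rightarrow> complex" where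
  "wirt_bar j f w = (dir_deriv (axis_vec j 1) f w + \<i> * dir_deriv (axis_vec j \<i>) f w) / 2"

text \<open>
  Tangent vectors of \<open>\<complex>\<^sup>n\<close> are elements of \<^term>\<open>cspace n\<close>, on which \<open>dw\<^sub>j\<close> is the \<open>j\<close>-th coordinate;
  forms are evaluated with the convention \<open>(\<alpha> \<and> \<beta>)(u,v) = \<alpha>(u) \<beta>(v) - \<alpha>(v) \<beta>(u)\<close>.
  \<open>deriv_form n f\<close> is the one-form \<open>\<partial>f\<close> and \<open>ddbar n f\<close> the two-form \<open>\<partial>\<partial>\<close>-bar of \<open>f\<close>.
\<close>

definition deriv_form :: "nat \<Rightarrow> (cvec \<Rightarrow> complex) \<Rightarrow> cvec \<Rightarrow> cvec \<Rightarrow> complex" where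
  "deriv_form n f w u = (\<Sum>j<n. wirt j f w * u j)"

definition ddbar :: "nat \<Rightarrow> (cvec \<Rightarrow> complex) \<Rightarrow> cvec \<Rightarrow> cvec \<Rightarrow> cvec \<Rightarrow> complex" where
  "ddbar n f w u v =
     (\<Sum>j<n. \<Sum>k<n. wirt j (wirt_bar k f) w * (u j * cnj (v k) - v j * cnj (u k)))"

definition ext_deriv1 :: "(cvec \<Rightarrow> cvec \<Rightarrow> complex) \<Rightarrow> cvec \<Rightarrow> cvec \<Rightarrow> cvec \<Rightarrow> complex" where
  "ext_deriv1 \<theta> w u v = dir_deriv u (\<lambda>w. \<theta> w v) w - dir_deriv v (\<lambda>w. \<theta> w u) w"

definition ext_deriv2 ::
    "(cvec \<Rightarrow> cvec \<Rightarrow> cvec \<Rightarrow> real) \<Rightarrow> cvec \<Rightarrow> cvec \<Rightarrow> cvec \<Rightarrow> cvec \<Rightarrow> real" where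
  "ext_deriv2 \<alpha> w u v t = dir_deriv u (\<lambda>w. \<alpha> w v t) w + dir_deriv v (\<lambda>w. \<alpha> w t u) w
     + dir_deriv t (\<lambda>w. \<alpha> w u v) w"

text \<open>The \<open>n\<close>-fold exterior power of a two-form, evaluated on \<open>v\<^sub>0, \<dots>, v\<^bsub>2n-1\<^esub>\<close>.\<close>

definition wedge_power :: "nat \<Rightarrow> (cvec \<Rightarrow> cvec \<Rightarrow> real) \<Rightarrow> (nat \<Rightarrow> cvec) \<Rightarrow> real" where
  "wedge_power n \<alpha> v = (1 / 2 ^ n) *
     (\<Sum>\<sigma> | \<sigma> permutes {..<2 * n}. of_int (sign \<sigma>) * (\<Prod>k<n. \<alpha> (v (\<sigma> (2 * k))) (v (\<sigma> (2 * k + 1)))))"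

text \<open>
  The value of \<open>\<alpha>\<^sup>n/n!\<close> on the real basis \<open>(e\<^sub>0, \<i> e\<^sub>0, e\<^sub>1, \<i> e\<^sub>1, \<dots>)\<close>, that is, the coefficient of
  \<open>\<alpha>\<^sup>n/n!\<close> with respect to \<open>dx\<^sub>0 \<and> dy\<^sub>0 \<and> dx\<^sub>1 \<and> dy\<^sub>1 \<and> \<dots>\<close> (the complex orientation).
\<close>

definition liouville_density :: "nat \<Rightarrow> (cvec \<Rightarrow> cvec \<Rightarrow> real) \<Rightarrow> real" where
  "liouville_density n \<alpha> =
     wedge_power n \<alpha> (\<lambda>k. axis_vec (k div 2) (if even k then 1 else \<i>)) / fact n"


section \<open>Complex manifolds\<close>

type_synonym 'p chart = "'p set \<times> ('p \<Rightarrow> cvec)"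

record 'p cx_manifold =
  mtop :: "'p topology"
  cdim :: nat
  charts :: "'p chart set"

definition chart_inv :: "'p chart \<Rightarrow> cvec \<Rightarrow> 'p" where
  "chart_inv c = inv_into (fst c) (snd c)"

definition transition :: "'p chart \<Rightarrow> 'p chart \<Rightarrow> cvec \<Rightarrow> cvec" where
  "transition c c' w = snd c' (chart_inv c w)"

definition complex_manifold :: "('p, 'z) cx_manifold_scheme \<Rightarrow> bool" where
  "complex_manifold X \<longleftrightarrow>
     Hausdorff_space (mtop X) \<and> second_countable (mtop X) \<and>
     \<Union> (fst ` charts X) = topspace (mtop X) \<and>
     (\<forall>(U, \<phi>) \<in> charts X.
        openin (mtop X) U \<and> openin (top_of_set (cspace (cdim X))) (\<phi> ` U) \<and>
        homeomorphic_map (subtopology (mtop X) U) (top_of_set (\<phi> ` U)) \<phi>) \<and>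
     (\<forall>c \<in> charts X. \<forall>c' \<in> charts X. \<forall>k < cdim X.
        mv_holomorphic_on (cdim X) (snd c ` (fst c \<inter> fst c')) (\<lambda>w. transition c c' w k))"

definition holomorphic_fun_on ::
    "('p, 'z) cx_manifold_scheme \<Rightarrow> 'p set \<Rightarrow> ('p \<Rightarrow> complex) \<Rightarrow> bool" where
  "holomorphic_fun_on X A f \<longleftrightarrow>
     (\<forall>c \<in> charts X. mv_holomorphic_on (cdim X) (snd c ` (fst c \<inter> A)) (\<lambda>w. f (chart_inv c w)))"

text \<open>The differential of a map in charts is injective on real, equivalently complex, tangent vectors.\<close>

definition holomorphic_embedding ::
    "('p, 'y) cx_manifold_scheme \<Rightarrow> ('q, 'z) cx_manifold_scheme \<Rightarrow> ('p \<Rightarrow> 'q) \<Rightarrow> bool" where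
  "holomorphic_embedding X Y f \<longleftrightarrow>
     embedding_map (mtop X) (mtop Y) f \<and>
     (\<forall>c \<in> charts X. \<forall>c' \<in> charts Y.
        let D = snd c ` {x \<in> fst c. f x \<in> fst c'};
            F = (\<lambda>w. snd c' (f (chart_inv c w)))
        in (\<forall>k < cdim Y. mv_holomorphic_on (cdim X) D (\<lambda>w. F w k)) \<and>
           (\<forall>w\<in>D. \<forall>u \<in> cspace (cdim X) - {\<lambda>_. 0}. \<exists>k < cdim Y. dir_deriv u (\<lambda>w. F w k) w \<noteq> 0))"

text \<open>
  A real two-form is given by its coordinate representation in every chart; \<open>\<omega> c w u v\<close> is the value at
  the point with coordinates \<open>w\<close> in the chart \<open>c\<close>, on the vectors with components \<open>u\<close> and \<open>v\<close> there.
\<close>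

type_synonym 'p two_form = "'p chart \<Rightarrow> cvec \<Rightarrow> cvec \<Rightarrow> cvec \<Rightarrow> real"

definition two_form_on :: "('p, 'z) cx_manifold_scheme \<Rightarrow> 'p two_form \<Rightarrow> bool" where
  "two_form_on X \<omega> \<longleftrightarrow>
     (\<forall>c \<in> charts X. \<forall>u \<in> cspace (cdim X). \<forall>v \<in> cspace (cdim X).
        smooth_on (cdim X) (snd c ` fst c) (\<lambda>w. \<omega> c w u v) \<and>
        (\<forall>w \<in> snd c ` fst c. \<omega> c w u v = - \<omega> c w v u \<and>
           (\<forall>v' \<in> cspace (cdim X). \<forall>a::real.
              \<omega> c w u (cadd (cscale (of_real a) v) v') = a * \<omega> c w u v + \<omega> c w u v'))) \<and>
     (\<forall>c \<in> charts X. \<forall>c' \<in> charts X. \<forall>w \<in> snd c ` (fst c \<inter> fst c').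
        \<forall>u \<in> cspace (cdim X). \<forall>v \<in> cspace (cdim X).
        let push = (\<lambda>u k. if k < cdim X then dir_deriv u (\<lambda>w. transition c c' w k) w else 0)
        in \<omega> c w u v = \<omega> c' (transition c c' w) (push u) (push v))"

definition kaehler_form :: "('p, 'z) cx_manifold_scheme \<Rightarrow> 'p two_form \<Rightarrow> bool" where
  "kaehler_form X \<omega> \<longleftrightarrow> two_form_on X \<omega> \<and>
     (\<forall>c \<in> charts X. \<forall>w \<in> snd c ` fst c. \<forall>u \<in> cspace (cdim X). \<forall>v \<in> cspace (cdim X).
        \<omega> c w (cscale \<i> u) (cscale \<i> v) = \<omega> c w u v \<and>
        (u \<noteq> (\<lambda>_. 0) \<longrightarrow> \<omega> c w u (cscale \<i> u) > 0) \<and>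
        (\<forall>t \<in> cspace (cdim X). ext_deriv2 (\<omega> c) w u v t = 0))"

text \<open>
  Integration over a compact complex manifold against the volume form with coefficient \<open>d c\<close> in the
  chart \<open>c\<close>, by a finite partition of unity subordinate to the atlas. For continuous integrands the
  value does not depend on the partition; continuity of its members is all that is needed.
\<close>

definition partition_of_unity ::
    "('p, 'z) cx_manifold_scheme \<Rightarrow> 'p chart set \<Rightarrow> ('p chart \<Rightarrow> 'p \<Rightarrow> real) \<Rightarrow> bool" where
  "partition_of_unity X F \<rho> \<longleftrightarrow> finite F \<and> F \<subseteq> charts X \<and>
     (\<forall>c\<in>F. continuous_map (mtop X) euclideanreal (\<rho> c) \<and>
        (\<forall>x \<in> topspace (mtop X). 0 \<le> \<rho> c x) \<and>
        mtop X closure_of {x \<in> topspace (mtop X). \<rho> c x \<noteq> 0} \<subseteq> fst c) \<and>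
     (\<forall>x \<in> topspace (mtop X). (\<Sum>c\<in>F. \<rho> c x) = 1)"

definition volume_integral ::
    "('p, 'z) cx_manifold_scheme \<Rightarrow> ('p chart \<Rightarrow> cvec \<Rightarrow> real) \<Rightarrow> ('p \<Rightarrow> complex) \<Rightarrow> complex" where
  "volume_integral X d f =
     (let (F, \<rho>) = (SOME (F, \<rho>). partition_of_unity X F \<rho>)
      in \<Sum>c\<in>F. LINT w : snd c ` fst c | clebesgue (cdim X).
           (\<rho> c (chart_inv c w) * d c w) *\<^sub>R f (chart_inv c w))"


section \<open>Quantum line bundles\<close>

text \<open>
  A manifold with a two-form and a hermitian line bundle over it. The bundle is given by its total space
  \<open>ltotal\<close>, projection, fibrewise operations and a set of local trivializations \<open>(U, \<tau>)\<close>, where \<open>\<tau>\<close> is the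
  fibre coordinate over \<open>U\<close>. The topology and complex structure of the total space are those induced by the
  trivializations.
\<close>

record ('p, 'l) quantized = "'p cx_manifold" +
  kform :: "'p two_form"
  ltotal :: "'l set"
  lproj :: "'l \<Rightarrow> 'p"
  lzero :: "'p \<Rightarrow> 'l"
  ladd :: "'l \<Rightarrow> 'l \<Rightarrow> 'l"
  lsmul :: "complex \<Rightarrow> 'l \<Rightarrow> 'l"
  ltriv :: "('p set \<times> ('l \<Rightarrow> complex)) set"
  lmetric :: "'l \<Rightarrow> 'l \<Rightarrow> complex"

abbreviation points :: "('p, 'l) quantized \<Rightarrow> 'p set" where
  "points Q \<equiv> topspace (mtop Q)"

definition fibre :: "('p, 'l) quantized \<Rightarrow> 'p \<Rightarrow> 'l set" where
  "fibre Q x = {q \<in> ltotal Q. lproj Q q = x}"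

definition frame :: "('p, 'l) quantized \<Rightarrow> ('l \<Rightarrow> complex) \<Rightarrow> 'p \<Rightarrow> 'l" where
  "frame Q \<tau> x = inv_into (fibre Q x) \<tau> 1"

definition holomorphic_line_bundle :: "('p, 'l) quantized \<Rightarrow> bool" where
  "holomorphic_line_bundle Q \<longleftrightarrow>
     lproj Q ` ltotal Q \<subseteq> points Q \<and>
     \<Union> (fst ` ltriv Q) = points Q \<and>
     (\<forall>(U, \<tau>) \<in> ltriv Q. openin (mtop Q) U \<and>
        (\<forall>x\<in>U. bij_betw \<tau> (fibre Q x) UNIV \<and>
           lzero Q x \<in> fibre Q x \<and> \<tau> (lzero Q x) = 0 \<and>
           (\<forall>q \<in> fibre Q x. \<forall>r \<in> fibre Q x.
              ladd Q q r \<in> fibre Q x \<and> \<tau> (ladd Q q r) = \<tau> q + \<tau> r) \<and>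
           (\<forall>q \<in> fibre Q x. \<forall>c. lsmul Q c q \<in> fibre Q x \<and> \<tau> (lsmul Q c q) = c * \<tau> q))) \<and>
     (\<forall>(U, \<tau>) \<in> ltriv Q. \<forall>(V, \<sigma>) \<in> ltriv Q.
        holomorphic_fun_on Q (U \<inter> V) (\<lambda>x. \<sigma> (frame Q \<tau> x)))"

text \<open>The local function \<open>h\<close>-hat of the frame belonging to \<open>\<tau>\<close>, in the coordinates of the chart \<open>c\<close>.\<close>

definition local_metric :: "('p, 'l) quantized \<Rightarrow> ('l \<Rightarrow> complex) \<Rightarrow> 'p chart \<Rightarrow> cvec \<Rightarrow> real" where
  "local_metric Q \<tau> c w =
     Re (lmetric Q (frame Q \<tau> (chart_inv c w)) (frame Q \<tau> (chart_inv c w)))"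

definition hermitian_metric :: "('p, 'l) quantized \<Rightarrow> bool" where
  "hermitian_metric Q \<longleftrightarrow>
     (\<forall>x \<in> points Q. \<forall>q \<in> fibre Q x. \<forall>r \<in> fibre Q x.
        lmetric Q r q = cnj (lmetric Q q r) \<and>
        (\<forall>c. lmetric Q q (lsmul Q c r) = c * lmetric Q q r) \<and>
        (\<forall>r' \<in> fibre Q x. lmetric Q q (ladd Q r r') = lmetric Q q r + lmetric Q q r') \<and>
        (q \<noteq> lzero Q x \<longrightarrow> Re (lmetric Q q q) > 0)) \<and>
     (\<forall>(U, \<tau>) \<in> ltriv Q. \<forall>c \<in> charts Q.
        smooth_on (cdim Q) (snd c ` (fst c \<inter> U)) (local_metric Q \<tau> c))"

text \<open>
  In the frame belonging to \<open>\<tau>\<close> the connection form of the Chern connection is \<open>\<partial> log h\<close>-hat, and its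
  curvature is the exterior derivative of this form.
\<close>

definition chern_connection ::
    "('p, 'l) quantized \<Rightarrow> ('l \<Rightarrow> complex) \<Rightarrow> 'p chart \<Rightarrow> cvec \<Rightarrow> cvec \<Rightarrow> complex" where
  "chern_connection Q \<tau> c = deriv_form (cdim Q) (\<lambda>w. of_real (ln (local_metric Q \<tau> c w)))"

definition chern_curvature ::
    "('p, 'l) quantized \<Rightarrow> ('l \<Rightarrow> complex) \<Rightarrow> 'p chart \<Rightarrow> cvec \<Rightarrow> cvec \<Rightarrow> cvec \<Rightarrow> complex" where
  "chern_curvature Q \<tau> c = ext_deriv1 (chern_connection Q \<tau> c)"

definition quantum_line_bundle :: "('p, 'l) quantized \<Rightarrow> bool" where
  "quantum_line_bundle Q \<longleftrightarrow> holomorphic_line_bundle Q \<and> hermitian_metric Q \<and>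
     (\<forall>(U, \<tau>) \<in> ltriv Q. \<forall>c \<in> charts Q. \<forall>w \<in> snd c ` (fst c \<inter> U).
        \<forall>u \<in> cspace (cdim Q). \<forall>v \<in> cspace (cdim Q).
        chern_curvature Q \<tau> c w u v = - \<i> * of_real (kform Q c w u v))"

text \<open>Sections are \<^const>\<open>undefined\<close> outside the manifold, so that they are determined by their values on it.\<close>

definition hol_sections :: "('p, 'l) quantized \<Rightarrow> ('p \<Rightarrow> 'l) set" where
  "hol_sections Q = {s \<in> Pi\<^sub>E (points Q) (fibre Q).
     \<forall>(U, \<tau>) \<in> ltriv Q. holomorphic_fun_on Q U (\<lambda>x. \<tau> (s x))}"

primrec section_comb ::
    "('p, 'l) quantized \<Rightarrow> cvec \<Rightarrow> (nat \<Rightarrow> 'p \<Rightarrow> 'l) \<Rightarrow> nat \<Rightarrow> 'p \<Rightarrow> 'l" where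
  "section_comb Q a b 0 = restrict (lzero Q) (points Q)"
| "section_comb Q a b (Suc k) =
     (\<lambda>x \<in> points Q. ladd Q (section_comb Q a b k x) (lsmul Q (a k) (b k x)))"

definition section_basis :: "('p, 'l) quantized \<Rightarrow> nat \<Rightarrow> (nat \<Rightarrow> 'p \<Rightarrow> 'l) \<Rightarrow> bool" where
  "section_basis Q N b \<longleftrightarrow> (\<forall>j\<le>N. b j \<in> hol_sections Q) \<and>
     (\<forall>s \<in> hol_sections Q. \<exists>!a. a \<in> cspace (Suc N) \<and> s = section_comb Q a b (Suc N))"

definition section_inner :: "('p, 'l) quantized \<Rightarrow> ('p \<Rightarrow> 'l) \<Rightarrow> ('p \<Rightarrow> 'l) \<Rightarrow> complex" where
  "section_inner Q s t =
     volume_integral Q (\<lambda>c w. liouville_density (cdim Q) (kform Q c w)) (\<lambda>x. lmetric Q (s x) (t x))"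

definition orthonormal_section_basis ::
    "('p, 'l) quantized \<Rightarrow> nat \<Rightarrow> (nat \<Rightarrow> 'p \<Rightarrow> 'l) \<Rightarrow> bool" where
  "orthonormal_section_basis Q N s \<longleftrightarrow> section_basis Q N s \<and>
     (\<forall>j\<le>N. \<forall>k\<le>N. section_inner Q (s j) (s k) = (if j = k then 1 else 0))"


section \<open>Coherent vectors and the cyclic \<open>m\<close>-point function\<close>

definition nonzero_vectors :: "('p, 'l) quantized \<Rightarrow> 'l set" where
  "nonzero_vectors Q = {q \<in> ltotal Q. q \<noteq> lzero Q (lproj Q q)}"

definition eval_form :: "('p, 'l) quantized \<Rightarrow> 'l \<Rightarrow> ('p \<Rightarrow> 'l) \<Rightarrow> complex" where
  "eval_form Q q s = (THE c. s (lproj Q q) = lsmul Q c q)"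

definition coherent_vector :: "('p, 'l) quantized \<Rightarrow> 'l \<Rightarrow> 'p \<Rightarrow> 'l" where
  "coherent_vector Q q = (THE e. e \<in> hol_sections Q \<and>
     (\<forall>s \<in> hol_sections Q. section_inner Q e s = eval_form Q q s))"

definition cyclic_quotient :: "('p, 'l) quantized \<Rightarrow> nat \<Rightarrow> (nat \<Rightarrow> 'l) \<Rightarrow> complex" where
  "cyclic_quotient Q m q =
     (\<Prod>k<m. section_inner Q (coherent_vector Q (q k)) (coherent_vector Q (q (Suc k mod m)))) /
     (\<Prod>k<m. section_inner Q (coherent_vector Q (q k)) (coherent_vector Q (q k)))"

text \<open>
  The arguments \<open>x\<^sup>(\<^sup>1\<^sup>), \<dots>, x\<^sup>(\<^sup>m\<^sup>)\<close> are \<open>x 0, \<dots>, x (m - 1)\<close>. The value is the common value of the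
  quotient for all choices of \<open>q k\<close> over \<open>x k\<close>.
\<close>

definition cyclic_fun :: "('p, 'l) quantized \<Rightarrow> nat \<Rightarrow> (nat \<Rightarrow> 'p) \<Rightarrow> complex" where
  "cyclic_fun Q m x = (THE c. \<forall>q. (\<forall>k<m. q k \<in> nonzero_vectors Q \<and> lproj Q (q k) = x k) \<longrightarrow>
     cyclic_quotient Q m q = c)"

definition pullback :: "('p \<Rightarrow> 'q) \<Rightarrow> ((nat \<Rightarrow> 'q) \<Rightarrow> complex) \<Rightarrow> (nat \<Rightarrow> 'p) \<Rightarrow> complex" where
  "pullback i F = (\<lambda>x. F (\<lambda>k. i (x k)))"


section \<open>Projective space with the hyperplane bundle\<close>

text \<open>
  A point of projective space is the set of its homogeneous representatives, i.e. a line through the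
  origin without the origin.
\<close>

type_synonym ppoint = "cvec set"

definition hclass :: "cvec \<Rightarrow> ppoint" where
  "hclass z = {cscale c z |c. c \<noteq> 0}"

definition proj_space :: "nat \<Rightarrow> ppoint set" where
  "proj_space N = hclass ` (cspace (Suc N) - {\<lambda>_. 0})"

definition proj_topology :: "nat \<Rightarrow> ppoint topology" where
  "proj_topology N = topology (\<lambda>U. U \<subseteq> proj_space N \<and>
     openin (top_of_set (cspace (Suc N) - {\<lambda>_. 0})) {z \<in> cspace (Suc N) - {\<lambda>_. 0}. hclass z \<in> U})"

definition affine_part :: "nat \<Rightarrow> nat \<Rightarrow> ppoint set" where
  "affine_part N a = {p \<in> proj_space N. \<forall>z\<in>p. z a \<noteq> 0}"

text \<open>The coordinates \<open>z\<^sub>j/z\<^sub>a\<close>, \<open>j \<noteq> a\<close>, in increasing order of \<open>j\<close>.\<close>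

definition affine_coord :: "nat \<Rightarrow> nat \<Rightarrow> ppoint \<Rightarrow> cvec" where
  "affine_coord N a p = (let z = (SOME z. z \<in> p) in
     (\<lambda>j. if j < N then (if j < a then z j else z (Suc j)) / z a else 0))"

definition fubini_study :: "nat \<Rightarrow> ppoint two_form" where
  "fubini_study N c w u v = Re (\<i> * ddbar N (\<lambda>w. of_real (ln (1 + cnorm2 N w))) w u v)"

text \<open>
  The hyperplane bundle: a vector over \<open>p\<close> is a linear form on the line \<open>insert (\<lambda>_. 0) p\<close>
  (\<^const>\<open>undefined\<close> elsewhere).
\<close>

type_synonym hvector = "ppoint \<times> (cvec \<Rightarrow> complex)"

abbreviation taut_line :: "ppoint \<Rightarrow> cvec set" where
  "taut_line p \<equiv> insert (\<lambda>_. 0) p"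

definition hyperplane_total :: "nat \<Rightarrow> hvector set" where
  "hyperplane_total N = {(p, l). p \<in> proj_space N \<and> l \<in> extensional (taut_line p) \<and>
     (\<forall>z \<in> taut_line p. \<forall>z' \<in> taut_line p. l (cadd z z') = l z + l z') \<and>
     (\<forall>z \<in> taut_line p. \<forall>c. l (cscale c z) = c * l z)}"

text \<open>
  Over \<open>z\<^sub>a \<noteq> 0\<close> the bundle is trivialized by the section given by the linear form \<open>Z\<^sub>a\<close>.
\<close>

definition hyperplane_coord :: "nat \<Rightarrow> hvector \<Rightarrow> complex" where
  "hyperplane_coord a = (\<lambda>(p, l). THE t. \<forall>z\<in>p. l z = t * z a)"

text \<open>
  The metric dual to the standard hermitian form on the tautological bundle; for the section \<open>Z\<^sub>0\<close> over
  \<open>z\<^sub>0 \<noteq> 0\<close> it gives \<open>h(Z\<^sub>0, Z\<^sub>0) = |z\<^sub>0|\<^sup>2 / \<parallel>z\<parallel>\<^sup>2 = 1 / (1 + \<parallel>w\<parallel>\<^sup>2)\<close>.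
\<close>

definition hyperplane_metric :: "nat \<Rightarrow> hvector \<Rightarrow> hvector \<Rightarrow> complex" where
  "hyperplane_metric N = (\<lambda>(p, l) (p', l').
     THE c. \<forall>z\<in>p. c = cnj (l z) * l' z / of_real (cnorm2 (Suc N) z))"

definition projective :: "nat \<Rightarrow> (ppoint, hvector) quantized" where
  "projective N = \<lparr>
     mtop = proj_topology N,
     cdim = N,
     charts = {(affine_part N a, affine_coord N a) |a. a \<le> N},
     kform = fubini_study N,
     ltotal = hyperplane_total N,
     lproj = fst,
     lzero = (\<lambda>p. (p, \<lambda>z \<in> taut_line p. 0)),
     ladd = (\<lambda>(p, l) (p', l'). (p, \<lambda>z \<in> taut_line p. l z + l' z)),
     lsmul = (\<lambda>c (p, l). (p, \<lambda>z \<in> taut_line p. c * l z)),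
     ltriv = {(affine_part N a, hyperplane_coord a) |a. a \<le> N},
     lmetric = hyperplane_metric N\<rparr>"


section \<open>The map to projective space\<close>

text \<open>
  \<open>(s\<^sub>0(x) : \<dots> : s\<^sub>N(x))\<close>: each nonzero \<open>q\<close> over \<open>x\<close> identifies the fibre with \<open>\<complex>\<close> and yields one
  homogeneous representative, and rescaling \<open>q\<close> yields all of them.
\<close>

definition homog_map :: "('p, 'l) quantized \<Rightarrow> nat \<Rightarrow> (nat \<Rightarrow> 'p \<Rightarrow> 'l) \<Rightarrow> 'p \<Rightarrow> ppoint" where
  "homog_map Q N s x =
     {(\<lambda>j. if j \<le> N then eval_form Q q (s j) else 0) |q. q \<in> nonzero_vectors Q \<and> lproj Q q = x}"

definition very_ample :: "('p, 'l) quantized \<Rightarrow> bool" where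
  "very_ample Q \<longleftrightarrow> (\<exists>N b. section_basis Q N b \<and>
     (\<forall>x \<in> points Q. \<exists>j\<le>N. b j x \<noteq> lzero Q x) \<and>
     holomorphic_embedding Q (projective N) (homog_map Q N b))"

end

theory Submission
  imports Defs "HOL-Complex_Analysis.Cauchy_Integral_Formula"
begin

text \<open>
  In an orthonormal basis \<open>s\<^sub>j\<close> the coherent vector \<open>e\<^sub>q\<close> has the coefficients conjugate to the values
  of the form \<open>q\<close>-hat at \<open>s\<^sub>j\<close>. These values are the entries of a homogeneous representative of \<open>i(x)\<close>, so
  \<open>\<langle>e\<^sub>q, e\<^sub>q\<^sub>'\<rangle>\<close> is the scalar product of two such representatives and the cyclic quotient does not depend on
  their scaling. For the hyperplane bundle the same computation applies with the coordinate sections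
  \<open>Z\<^sub>j\<close>, once these are known to span the sections and to be orthogonal of equal length. The first
  follows from Liouville's theorem. For the second, the Fubini-Study volume is, up to a constant, the image of
  Lebesgue measure on the unit ball of \<open>\<complex>\<^bsup>N+1\<^esup>\<close>, which is invariant under sign changes and permutations of
  the coordinates.
\<close>

section \<open>Coherent vectors of an orthogonal basis\<close>

text \<open>\<open>volume_integral\<close> picks its partition of unity by \<open>SOME\<close>. Such
  a partition must be shown to exist, and the argument must work for whichever one is picked. On
  \<open>Q\<close> linearity of the integral suffices, because the Gram matrix of the
  \<open>s j\<close> is given; on projective space the Gram matrix has to be found. A symmetry of
  projective space does not respect the partition, so orthogonality cannot be read off chart by
  chart. The lift to the unit ball puts all charts on one domain with one normalization. There the
  partition adds up to 1, and the symmetries become linear maps of the ball. The normalizing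
  constants (of the Pfaffian sum, the radial integral, the Gram integral) survive only as a common
  squared length \<open>\<kappa>\<close> of the coordinate sections. It occurs \<open>m\<close>
  times in the numerator and \<open>m\<close> times in the denominator of the cyclic quotient, so it
  is enough that it be nonzero. The reversed order of the arguments in the last formula of the
  theorem comes from the conjugated coefficients: \<open>cinner\<close> of two conjugated vectors is
  \<open>cinner\<close> with the arguments exchanged.\<close>

definition fibre_coordinate :: "('p, 'l) quantized \<Rightarrow> ('l \<Rightarrow> complex) \<Rightarrow> 'p \<Rightarrow> bool" where
  "fibre_coordinate Q \<tau> x \<longleftrightarrow> bij_betw \<tau> (fibre Q x) UNIV \<and>
     lzero Q x \<in> fibre Q x \<and> \<tau> (lzero Q x) = 0 \<and>
     (\<forall>q \<in> fibre Q x. \<forall>r \<in> fibre Q x. ladd Q q r \<in> fibre Q x \<and> \<tau> (ladd Q q r) = \<tau> q + \<tau> r) \<and>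
     (\<forall>q \<in> fibre Q x. \<forall>c. lsmul Q c q \<in> fibre Q x \<and> \<tau> (lsmul Q c q) = c * \<tau> q)"

text \<open>The properties of single fibres in \<open>holomorphic_line_bundle\<close>, with openness
  of the trivializing sets. This is the common ground of \<open>Q\<close>, where it follows from the
  assumption, and of \<open>projective N\<close>, where it is checked directly on linear
  forms.\<close>

definition fibrewise_trivialized :: "('p, 'l) quantized \<Rightarrow> bool" where
  "fibrewise_trivialized Q \<longleftrightarrow>
     lproj Q ` ltotal Q \<subseteq> points Q \<and> \<Union> (fst ` ltriv Q) = points Q \<and>
     (\<forall>(U, \<tau>) \<in> ltriv Q. openin (mtop Q) U \<and> (\<forall>x\<in>U. fibre_coordinate Q \<tau> x))"

lemma holomorphic_line_bundle_fibrewise: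
  "holomorphic_line_bundle Q \<Longrightarrow> fibrewise_trivialized Q"
  unfolding holomorphic_line_bundle_def fibrewise_trivialized_def fibre_coordinate_def
  by (elim conjE, intro conjI; assumption)

lemma fibrewise_trivializedD:
  assumes "fibrewise_trivialized Q" "(U, \<tau>) \<in> ltriv Q"
  shows "openin (mtop Q) U" "x \<in> U \<Longrightarrow> fibre_coordinate Q \<tau> x"
  using assms(1)[unfolded fibrewise_trivialized_def, THEN conjunct2, THEN conjunct2, THEN bspec, OF assms(2)]
  by auto

lemma fibre_trivialization:
  assumes "fibrewise_trivialized Q" "(U, \<tau>) \<in> ltriv Q" "x \<in> U"
  shows "inj_on \<tau> (fibre Q x)" "\<tau> ` fibre Q x = UNIV"
    "lzero Q x \<in> fibre Q x" "\<tau> (lzero Q x) = 0"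
    "\<And>q r. q \<in> fibre Q x \<Longrightarrow> r \<in> fibre Q x \<Longrightarrow> ladd Q q r \<in> fibre Q x"
    "\<And>q r. q \<in> fibre Q x \<Longrightarrow> r \<in> fibre Q x \<Longrightarrow> \<tau> (ladd Q q r) = \<tau> q + \<tau> r"
    "\<And>q c. q \<in> fibre Q x \<Longrightarrow> lsmul Q c q \<in> fibre Q x"
    "\<And>q c. q \<in> fibre Q x \<Longrightarrow> \<tau> (lsmul Q c q) = c * \<tau> q"
    "x \<in> points Q"
  using fibrewise_trivializedD(2)[OF assms] openin_subset[OF fibrewise_trivializedD(1)[OF assms(1,2)]] assms(3)
  unfolding fibre_coordinate_def bij_betw_def by auto

lemma trivialization_at:
  assumes "fibrewise_trivialized Q" "x \<in> points Q"
  obtains U \<tau> where "(U, \<tau>) \<in> ltriv Q" "x \<in> U"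
proof -
  have "x \<in> \<Union> (fst ` ltriv Q)"
    using assms unfolding fibrewise_trivialized_def by simp
  then show ?thesis
    using that by auto
qed

lemma nonzero_vectors_iff:
  assumes "fibrewise_trivialized Q" "(U, \<tau>) \<in> ltriv Q" "x \<in> U" "q \<in> fibre Q x"
  shows "q \<in> nonzero_vectors Q \<longleftrightarrow> \<tau> q \<noteq> 0"
proof -
  have "q \<in> nonzero_vectors Q \<longleftrightarrow> q \<noteq> lzero Q x"
    using assms(4) by (auto simp: nonzero_vectors_def fibre_def)
  also have "\<dots> \<longleftrightarrow> \<tau> q \<noteq> 0"
    using fibre_trivialization(1,3,4)[OF assms(1-3)] assms(4) by (metis inj_onD)
  finally show ?thesis .
qed

text \<open>A fibre coordinate is injective and turns \<open>s x = lsmul Q c q\<close> into a scalar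
  equation with exactly one solution, so the \<open>THE\<close> in \<open>eval_form\<close>
  denotes.\<close>

lemma eval_form_trivialization:
  assumes "fibrewise_trivialized Q" "(U, \<tau>) \<in> ltriv Q" "lproj Q q \<in> U" "q \<in> nonzero_vectors Q"
    "s (lproj Q q) \<in> fibre Q (lproj Q q)"
  shows "eval_form Q q s = \<tau> (s (lproj Q q)) / \<tau> q"
proof -
  note t = fibre_trivialization[OF assms(1-3)]
  have q: "q \<in> fibre Q (lproj Q q)"
    using assms(4) by (auto simp: nonzero_vectors_def fibre_def)
  have nz: "\<tau> q \<noteq> 0"
    using nonzero_vectors_iff[OF assms(1-3) q] assms(4) by simp
  have "s (lproj Q q) = lsmul Q c q \<longleftrightarrow> c = \<tau> (s (lproj Q q)) / \<tau> q" for c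
  proof -
    have "s (lproj Q q) = lsmul Q c q \<longleftrightarrow> \<tau> (s (lproj Q q)) = \<tau> (lsmul Q c q)"
      using t(1) assms(5) t(7)[OF q] by (metis inj_onD)
    also have "\<dots> \<longleftrightarrow> c = \<tau> (s (lproj Q q)) / \<tau> q"
      using nz by (auto simp: t(8)[OF q] field_simps)
    finally show ?thesis .
  qed
  then show ?thesis
    unfolding eval_form_def by simp
qed

lemma hol_sections_fibre:
  "s \<in> hol_sections Q \<Longrightarrow> x \<in> points Q \<Longrightarrow> s x \<in> fibre Q x"
  unfolding hol_sections_def by auto

lemma section_comb_trivialization:
  assumes "fibrewise_trivialized Q" "(U, \<tau>) \<in> ltriv Q" "x \<in> U" "\<And>j. j < k \<Longrightarrow> b j x \<in> fibre Q x"
  shows "section_comb Q a b k x \<in> fibre Q x" "\<tau> (section_comb Q a b k x) = (\<Sum>j<k. a j * \<tau> (b j x))"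
proof -
  note t = fibre_trivialization[OF assms(1-3)]
  have "section_comb Q a b k x \<in> fibre Q x \<and>
      \<tau> (section_comb Q a b k x) = (\<Sum>j<k. a j * \<tau> (b j x))"
    using assms(4) by (induction k) (simp_all add: t)
  then show "section_comb Q a b k x \<in> fibre Q x"
    "\<tau> (section_comb Q a b k x) = (\<Sum>j<k. a j * \<tau> (b j x))" by auto
qed

lemma section_comb_cong:
  assumes "\<And>j. j < k \<Longrightarrow> a j = a' j"
  shows "section_comb Q a b k = section_comb Q a' b k"
  using assms by (induction k) auto

lemma section_comb_extensional: "section_comb Q a b k \<in> extensional (points Q)"
  by (cases k) auto

lemma eval_form_comb:
  assumes "fibrewise_trivialized Q" "q \<in> nonzero_vectors Q" "\<And>j. j < k \<Longrightarrow> b j \<in> hol_sections Q"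
  shows "eval_form Q q (section_comb Q a b k) = (\<Sum>j<k. a j * eval_form Q q (b j))"
proof -
  have "lproj Q q \<in> points Q"
    using assms(1,2) by (auto simp: fibrewise_trivialized_def nonzero_vectors_def)
  then obtain U \<tau> where U: "(U, \<tau>) \<in> ltriv Q" "lproj Q q \<in> U"
    using trivialization_at[OF assms(1)] by metis
  have b: "b j (lproj Q q) \<in> fibre Q (lproj Q q)" if "j < k" for j
    using hol_sections_fibre[OF assms(3)[OF that]] \<open>lproj Q q \<in> points Q\<close> by simp
  note c = section_comb_trivialization[OF assms(1) U, of k b a, OF b]
  show ?thesis
    using b c by (simp add: eval_form_trivialization[OF assms(1) U assms(2)] sum_divide_distrib)
qed

section \<open>Cyclic quotients of homogeneous representatives\<close>

lemma cinner_self: "cinner n u u = of_real (cnorm2 n u)"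
  unfolding cinner_def cnorm2_def of_real_sum
  by (intro sum.cong refl) (metis complex_norm_square mult.commute of_real_power)

lemma cinner_cscale: "cinner n (cscale a u) (cscale b v) = cnj a * b * cinner n u v"
  by (simp add: cinner_def cscale_def sum_distrib_left mult.assoc mult.left_commute)

lemma cnorm2_cscale: "cnorm2 n (cscale c u) = (cmod c)\<^sup>2 * cnorm2 n u"
  by (simp add: cnorm2_def cscale_def norm_mult power_mult_distrib sum_distrib_left)

text \<open>The last expression of the theorem. The successor stands in the first slot because
  conjugating the coefficients of coherent vectors exchanges the arguments of the scalar
  product.\<close>

definition cyclic_ratio :: "nat \<Rightarrow> nat \<Rightarrow> (nat \<Rightarrow> cvec) \<Rightarrow> complex" where
  "cyclic_ratio n m u =
     (\<Prod>k<m. cinner n (u (Suc k mod m)) (u k)) / of_real (\<Prod>k<m. cnorm2 n (u k))"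

text \<open>Rotation permutes \<open>{..<m}\<close>: the difference of two indices below
  \<open>m\<close> is divisible by \<open>m\<close> only if it is zero.\<close>

lemma prod_shift_mod:
  fixes f :: "nat \<Rightarrow> 'a::comm_monoid_mult"
  shows "(\<Prod>k<m. f ((k + d) mod m)) = (\<Prod>k<m. f k)"
proof (cases "m = 0")
  case False
  have "(\<lambda>k. (k + d) mod m) ` {..<m} = {..<m}"
  proof (intro endo_inj_surj)
    show "inj_on (\<lambda>k. (k + d) mod m) {..<m}"
    proof (rule linorder_inj_onI')
      fix x y assume xy: "x \<in> {..<m}" "y \<in> {..<m}" "x < y"
      show "(x + d) mod m \<noteq> (y + d) mod m"
      proof
        assume "(x + d) mod m = (y + d) mod m"
        then have "m dvd y - x"
          using xy(3) mod_eq_dvd_iff_nat[of "x + d" "y + d" m] by simp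
        then show False
          using xy by (auto dest: dvd_imp_le)
      qed
    qed
  qed (use False in auto)
  moreover have "inj_on (\<lambda>k. (k + d) mod m) {..<m}"
    using calculation by (simp add: eq_card_imp_inj_on)
  ultimately show ?thesis
    using prod.reindex[of "\<lambda>k. (k + d) mod m" "{..<m}" f] by simp
qed auto

lemma prod_Suc_mod:
  fixes f :: "nat \<Rightarrow> 'a::comm_monoid_mult"
  shows "(\<Prod>k<m. f (Suc k mod m)) = (\<Prod>k<m. f k)"
  using prod_shift_mod[of f 1 m] by simp

text \<open>Around the cycle every vector occurs once in the conjugate-linear and once in the linear
  slot. Its factor thus enters the numerator as a squared modulus, as it does in the
  denominator.\<close>

lemma cyclic_ratio_cscale:
  assumes "\<And>k. k < m \<Longrightarrow> c k \<noteq> 0" "\<And>k. k < m \<Longrightarrow> v k = cscale (c k) (u k)"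
  shows "cyclic_ratio n m v = cyclic_ratio n m u"
proof -
  have "(\<Prod>k<m. cinner n (v (Suc k mod m)) (v k)) =
      (\<Prod>k<m. cnj (c (Suc k mod m)) * (c k * cinner n (u (Suc k mod m)) (u k)))"
    using assms(2) by (intro prod.cong refl) (simp add: cinner_cscale mult.assoc)
  also have "\<dots> = (\<Prod>k<m. cnj (c k)) * (\<Prod>k<m. c k) * (\<Prod>k<m. cinner n (u (Suc k mod m)) (u k))"
    using prod_Suc_mod[of "\<lambda>k. cnj (c k)" m] by (simp add: prod.distrib mult.assoc)
  also have "\<dots> = of_real (\<Prod>k<m. (cmod (c k))\<^sup>2) * (\<Prod>k<m. cinner n (u (Suc k mod m)) (u k))"
    by (simp add: prod.distrib[symmetric] complex_norm_square[symmetric] mult.commute[of "cnj _"]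
        of_real_prod)
  finally have 1: "(\<Prod>k<m. cinner n (v (Suc k mod m)) (v k)) = \<dots>" .
  have 2: "(\<Prod>k<m. cnorm2 n (v k)) = (\<Prod>k<m. (cmod (c k))\<^sup>2) * (\<Prod>k<m. cnorm2 n (u k))"
    using assms(2) by (simp add: cnorm2_cscale prod.distrib)
  have "(\<Prod>k<m. (cmod (c k))\<^sup>2) \<noteq> 0"
    using assms(1) by (auto simp: prod_zero_iff)
  then show ?thesis
    unfolding cyclic_ratio_def 1 2 of_real_mult by (simp del: of_real_prod)
qed

lemma cyclic_ratio_rotate: "cyclic_ratio n m (\<lambda>k. u ((k + d) mod m)) = cyclic_ratio n m u"
proof -
  \<comment> \<open>Rotation commutes with the cyclic successor, so the numerator is merely
    reindexed.\<close>
  have "(\<Prod>k<m. cinner n (u ((Suc k mod m + d) mod m)) (u ((k + d) mod m))) =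
        (\<Prod>k<m. cinner n (u (Suc ((k + d) mod m) mod m)) (u ((k + d) mod m)))"
    by (intro prod.cong refl) (simp add: mod_simps)
  also have "\<dots> = (\<Prod>k<m. cinner n (u (Suc k mod m)) (u k))"
    using prod_shift_mod[of "\<lambda>k. cinner n (u (Suc k mod m)) (u k)" d m] .
  finally show ?thesis
    using prod_shift_mod[of "\<lambda>k. cnorm2 n (u k)" d m] unfolding cyclic_ratio_def by simp
qed

text \<open>Both representatives consist of the values \<open>\<tau> (s j x)\<close> divided by the
  coordinate of the chosen fibre vector; the factor between them is the quotient of these
  coordinates.\<close>

lemma homog_map_cscale:
  assumes "fibrewise_trivialized Q" "\<And>j. j \<le> N \<Longrightarrow> s j \<in> hol_sections Q"
    "u \<in> homog_map Q N s x" "v \<in> homog_map Q N s x"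
  obtains c where "c \<noteq> 0" "v = cscale c u"
proof -
  obtain q q' where q: "q \<in> nonzero_vectors Q" "lproj Q q = x"
      "u = (\<lambda>j. if j \<le> N then eval_form Q q (s j) else 0)"
    and q': "q' \<in> nonzero_vectors Q" "lproj Q q' = x"
      "v = (\<lambda>j. if j \<le> N then eval_form Q q' (s j) else 0)"
    using assms(3,4) unfolding homog_map_def by blast
  have x: "x \<in> points Q"
    using assms(1) q by (auto simp: fibrewise_trivialized_def nonzero_vectors_def)
  then obtain U \<tau> where U: "(U, \<tau>) \<in> ltriv Q" "x \<in> U"
    using trivialization_at[OF assms(1)] by metis
  have f: "q \<in> fibre Q x" "q' \<in> fibre Q x"
    using q q' by (auto simp: fibre_def nonzero_vectors_def)
  have nz: "\<tau> q \<noteq> 0" "\<tau> q' \<noteq> 0"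
    using nonzero_vectors_iff[OF assms(1) U] f q(1) q'(1) by auto
  have "eval_form Q q (s j) = \<tau> (s j x) / \<tau> q \<and> eval_form Q q' (s j) = \<tau> (s j x) / \<tau> q'" if "j \<le> N" for j
    using eval_form_trivialization[OF assms(1) U(1), of q "s j"]
      eval_form_trivialization[OF assms(1) U(1), of q' "s j"] q q' U(2)
      hol_sections_fibre[OF assms(2)[OF that] x] by simp
  then have "v = cscale (\<tau> q / \<tau> q') u"
    unfolding q(3) q'(3) cscale_def using nz by (auto simp: field_simps)
  then show ?thesis
    using that nz by (metis divide_eq_0_iff)
qed

text \<open>
  Since \<open>\<langle>e\<^sub>q, s\<^sub>j\<rangle>\<close> must be the value of the form \<open>q\<close>-hat at \<open>s\<^sub>j\<close>, the coefficients of \<open>e\<^sub>q\<close> are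
  the conjugates of these values, up to the normalization \<open>\<kappa>\<close> of the orthogonal basis.
\<close>

locale orthogonal_sections =
  fixes Q :: "('p, 'l) quantized" and N :: nat and s :: "nat \<Rightarrow> 'p \<Rightarrow> 'l" and \<kappa> :: real
  assumes triv: "fibrewise_trivialized Q"
    and basis_hol: "j \<le> N \<Longrightarrow> s j \<in> hol_sections Q"
    and comb_hol: "section_comb Q a s (Suc N) \<in> hol_sections Q"
    and spanning: "t \<in> hol_sections Q \<Longrightarrow> \<exists>a. t = section_comb Q a s (Suc N)"
    and inner_comb: "section_inner Q (section_comb Q a s (Suc N)) (section_comb Q b s (Suc N)) =
        of_real \<kappa> * cinner (Suc N) a b"
    and kappa_nonzero: "\<kappa> \<noteq> 0"
begin

lemma coherent_vector_eq:
  assumes q: "q \<in> nonzero_vectors Q"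
  shows "coherent_vector Q q =
    section_comb Q (\<lambda>j. cnj (eval_form Q q (s j)) / of_real \<kappa>) s (Suc N)" (is "_ = ?e")
  unfolding coherent_vector_def
proof (rule the_equality, intro conjI ballI)
  have ev: "eval_form Q q (section_comb Q b s (Suc N)) = (\<Sum>j<Suc N. b j * eval_form Q q (s j))" for b
    using eval_form_comb[OF triv q, of "Suc N" s b] basis_hol by (simp add: less_Suc_eq_le)
  show "?e \<in> hol_sections Q"
    by (rule comb_hol)
  show "section_inner Q ?e t = eval_form Q q t" if t: "t \<in> hol_sections Q" for t
  proof -
    obtain b where b: "t = section_comb Q b s (Suc N)"
      using spanning[OF t] by blast
    show ?thesis
      unfolding b inner_comb ev cinner_def sum_distrib_left
      using kappa_nonzero by (intro sum.cong refl) (simp add: field_simps)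
  qed
  fix e assume e: "e \<in> hol_sections Q \<and> (\<forall>t\<in>hol_sections Q. section_inner Q e t = eval_form Q q t)"
  obtain a where a: "e = section_comb Q a s (Suc N)"
    using spanning e by blast
  have "a j = cnj (eval_form Q q (s j)) / of_real \<kappa>" if j: "j < Suc N" for j
  proof -
    \<comment> \<open>Uniqueness: pairing with the \<open>j\<close>-th basis section, written as a
      combination, isolates the coefficient \<open>a j\<close>.\<close>
    have "section_inner Q e (section_comb Q (axis_vec j 1) s (Suc N)) =
        eval_form Q q (section_comb Q (axis_vec j 1) s (Suc N))"
      using e comb_hol by blast
    moreover have "(\<Sum>k<Suc N. axis_vec j 1 k * eval_form Q q (s k)) = eval_form Q q (s j)"
      using sum.delta[of "{..<Suc N}" j "\<lambda>k. eval_form Q q (s k)"] j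
      by (simp add: axis_vec_def if_distrib[of "\<lambda>x. x * _"] cong: if_cong del: sum.lessThan_Suc)
    moreover have "(\<Sum>k<Suc N. cnj (a k) * axis_vec j 1 k) = cnj (a j)"
      using sum.delta[of "{..<Suc N}" j "\<lambda>k. cnj (a k)"] j
      by (simp add: axis_vec_def if_distrib[of "\<lambda>x. _ * x"] cong: if_cong del: sum.lessThan_Suc)
    ultimately have "of_real \<kappa> * cnj (a j) = eval_form Q q (s j)"
      unfolding a inner_comb ev cinner_def by metis
    then have "cnj (of_real \<kappa> * cnj (a j)) = cnj (eval_form Q q (s j))"
      by simp
    then show ?thesis
      using kappa_nonzero by (simp add: field_simps)
  qed
  \<comment> \<open>Coefficients from \<open>Suc N\<close> on do not enter
    \<open>section_comb\<close>, so agreement below \<open>Suc N\<close> suffices.\<close>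
  then show "e = ?e"
    unfolding a by (rule section_comb_cong)
qed

text \<open>The two coefficient vectors contribute \<open>1 / \<kappa>\<^sup>2\<close> and the
  scalar product contributes \<open>\<kappa>\<close>. Conjugation of the coefficients puts the
  representative of \<open>q'\<close> first.\<close>

lemma coherent_inner:
  assumes q: "q \<in> nonzero_vectors Q" and q': "q' \<in> nonzero_vectors Q"
  shows "section_inner Q (coherent_vector Q q) (coherent_vector Q q') =
    cinner (Suc N) (\<lambda>j. if j \<le> N then eval_form Q q' (s j) else 0)
      (\<lambda>j. if j \<le> N then eval_form Q q (s j) else 0) / of_real \<kappa>"
  unfolding coherent_vector_eq[OF q] coherent_vector_eq[OF q'] inner_comb cinner_def
    sum_distrib_left sum_divide_distrib
  using kappa_nonzero by (intro sum.cong refl) (simp add: field_simps power2_eq_square)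

text \<open>All admissible families \<open>q\<close> give representatives that differ from
  \<open>u\<close> by factors, hence the same quotient; the \<open>m\<close> divisors
  \<open>\<kappa>\<close> above and below cancel.\<close>

lemma cyclic_fun_eq:
  assumes u: "\<And>k. k < m \<Longrightarrow> u k \<in> homog_map Q N s (x k)"
  shows "cyclic_fun Q m x = cyclic_ratio (Suc N) m u"
proof -
  have val: "cyclic_quotient Q m q = cyclic_ratio (Suc N) m u"
    if q: "\<forall>k<m. q k \<in> nonzero_vectors Q \<and> lproj Q (q k) = x k" for q
  proof -
    define v where "v k = (\<lambda>j. if j \<le> N then eval_form Q (q k) (s j) else 0)" for k
    have qk: "q k \<in> nonzero_vectors Q" if "k < m" for k
      using q that by blast
    have qs: "q (Suc k mod m) \<in> nonzero_vectors Q" if "k < m" for k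
      using qk that by (simp add: )
    have v: "v k \<in> homog_map Q N s (x k)" if "k < m" for k
      using q that unfolding homog_map_def v_def by blast
    have "\<exists>c. c \<noteq> 0 \<and> v k = cscale c (u k)" if "k < m" for k
      using homog_map_cscale[OF triv basis_hol u[OF that] v[OF that]] by blast
    then obtain c where c: "\<And>k. k < m \<Longrightarrow> c k \<noteq> 0 \<and> v k = cscale (c k) (u k)"
      by metis
    have "cyclic_quotient Q m q =
        (\<Prod>k<m. cinner (Suc N) (v (Suc k mod m)) (v k) / of_real \<kappa>) /
        (\<Prod>k<m. of_real (cnorm2 (Suc N) (v k)) / of_real \<kappa>)"
      unfolding cyclic_quotient_def
      by (intro arg_cong2[where f = divide] prod.cong refl;
          simp add: coherent_inner qk qs v_def[symmetric] cinner_self)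
    also have "\<dots> = cyclic_ratio (Suc N) m v"
      using kappa_nonzero by (simp add: cyclic_ratio_def prod_dividef)
    also have "\<dots> = cyclic_ratio (Suc N) m u"
      using c by (intro cyclic_ratio_cscale[where c = c]) auto
    finally show ?thesis .
  qed
  \<comment> \<open>An admissible family exists, so the condition under \<open>THE\<close> in
    \<open>cyclic_fun\<close> is not vacuous and determines the value.\<close>
  have "\<exists>q. q \<in> nonzero_vectors Q \<and> lproj Q q = x k" if "k < m" for k
    using u[OF that] unfolding homog_map_def by blast
  then obtain q where "\<forall>k<m. q k \<in> nonzero_vectors Q \<and> lproj Q (q k) = x k"
    by metis
  then show ?thesis
    unfolding cyclic_fun_def using val by (intro the_equality) (blast, metis)
qed

end

section \<open>Scalar products of sections over a compact manifold\<close>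

text \<open>\<open>mv_holomorphic_on\<close> asks for complex derivatives in single coordinates.
  Transferring them between functions that agree on \<open>D\<close> requires the slices of
  \<open>D\<close> to be open in the complex plane.\<close>

lemma openin_fun_upd_preimage:
  assumes "openin (top_of_set (cspace n)) D" "w \<in> cspace n" "i < n"
  shows "open {z. w(i := z) \<in> D}"
proof -
  obtain O' where O': "open O'" "D = cspace n \<inter> O'"
    using assms(1) by (auto simp: openin_open)
  have "w(i := z) \<in> cspace n" for z
    using assms(2,3) by (auto simp: cspace_def)
  then have "{z. w(i := z) \<in> D} = (\<lambda>z. w(i := z)) -` O'"
    using O' by auto
  moreover have "continuous_on UNIV (\<lambda>z. w(i := z))"
  proof (intro continuous_on_coordinatewise_then_product)
    show "continuous_on UNIV (\<lambda>z. (w(i := z)) k)" for k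
      by (cases "k = i") (auto intro: continuous_intros)
  qed
  ultimately show ?thesis
    using O'(1) by (simp add: open_vimage)
qed

lemma mv_holomorphic_on_cong:
  assumes D: "openin (top_of_set (cspace n)) D"
    and f: "mv_holomorphic_on n D f" and eq: "\<And>w. w \<in> D \<Longrightarrow> g w = f w"
  shows "mv_holomorphic_on n D g"
  unfolding mv_holomorphic_on_def
proof (intro conjI ballI allI impI)
  show "continuous_on D g"
    using f eq unfolding mv_holomorphic_on_def by (metis continuous_on_cong)
  fix w j assume w: "w \<in> D" and j: "j < n"
  then have "w \<in> cspace n"
    using D openin_imp_subset by blast
  then have op: "open {z. w(j := z) \<in> D}"
    by (rule openin_fun_upd_preimage[OF D _ j])
  obtain d where d: "((\<lambda>z. f (w(j := z))) has_field_derivative d) (at (w j))"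
    using f w j unfolding mv_holomorphic_on_def field_differentiable_def by blast
  have "((\<lambda>z. g (w(j := z))) has_field_derivative d) (at (w j))"
    by (rule has_field_derivative_transform_within_open[OF d op]) (use w eq in auto)
  then show "(\<lambda>z. g (w(j := z))) field_differentiable at (w j)"
    by (auto simp: field_differentiable_def)
qed

lemma mv_holomorphic_on_sum:
  assumes "\<And>i. i \<in> I \<Longrightarrow> mv_holomorphic_on n D (f i)"
  shows "mv_holomorphic_on n D (\<lambda>w. \<Sum>i\<in>I. a i * f i w)"
  using assms unfolding mv_holomorphic_on_def
  by (auto intro!: continuous_intros derivative_intros)

text \<open>The chart facts enter as the hypothesis \<open>op\<close>, so that the lemma covers both
  \<open>Q\<close>, where the manifold structure supplies them, and \<open>projective N\<close>,
  where explicit affine coordinates do.\<close>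

lemma section_comb_hol:
  assumes triv: "fibrewise_trivialized Q"
    and op: "\<And>c U \<tau>. c \<in> charts Q \<Longrightarrow> (U, \<tau>) \<in> ltriv Q \<Longrightarrow>
        openin (top_of_set (cspace (cdim Q))) (snd c ` (fst c \<inter> U)) \<and> inj_on (snd c) (fst c)"
    and b: "\<And>j. j < k \<Longrightarrow> b j \<in> hol_sections Q"
  shows "section_comb Q a b k \<in> hol_sections Q"
proof -
  have fib: "b j x \<in> fibre Q x" if "j < k" "x \<in> points Q" for j x
    using hol_sections_fibre[OF b] that by blast
  have "section_comb Q a b k \<in> Pi\<^sub>E (points Q) (fibre Q)"
  proof (rule PiE_I)
    fix x assume x: "x \<in> points Q"
    obtain U \<tau> where "(U, \<tau>) \<in> ltriv Q" "x \<in> U"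
      using trivialization_at[OF triv x] .
    then show "section_comb Q a b k x \<in> fibre Q x"
      using section_comb_trivialization(1)[OF triv] fib x by blast
  qed (use section_comb_extensional[of Q a b k] in \<open>auto simp: extensional_def\<close>)
  moreover have "holomorphic_fun_on Q U (\<lambda>x. \<tau> (section_comb Q a b k x))" if U: "(U, \<tau>) \<in> ltriv Q" for U \<tau>
    unfolding holomorphic_fun_on_def
  proof
    fix c assume c: "c \<in> charts Q"
    have "mv_holomorphic_on (cdim Q) (snd c ` (fst c \<inter> U)) (\<lambda>w. \<tau> (b j (chart_inv c w)))" if "j < k" for j
      using b[OF that] U c unfolding hol_sections_def holomorphic_fun_on_def by blast
    then have "mv_holomorphic_on (cdim Q) (snd c ` (fst c \<inter> U)) (\<lambda>w. \<Sum>j<k. a j * \<tau> (b j (chart_inv c w)))"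
      by (intro mv_holomorphic_on_sum) auto
    then show "mv_holomorphic_on (cdim Q) (snd c ` (fst c \<inter> U)) (\<lambda>w. \<tau> (section_comb Q a b k (chart_inv c w)))"
    proof (rule mv_holomorphic_on_cong[OF conjunct1[OF op[OF c U]]])
      fix w assume "w \<in> snd c ` (fst c \<inter> U)"
      then obtain x where x: "x \<in> fst c" "x \<in> U" "w = snd c x" by blast
      then have "chart_inv c w = x"
        using op[OF c U] unfolding chart_inv_def by simp
      moreover have "x \<in> points Q"
        using fibre_trivialization(9)[OF triv U x(2)] .
      ultimately show "\<tau> (section_comb Q a b k (chart_inv c w)) = (\<Sum>j<k. a j * \<tau> (b j (chart_inv c w)))"
        using section_comb_trivialization(2)[OF triv U x(2)] fib by simp
    qed
  qed
  ultimately show ?thesis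
    unfolding hol_sections_def by blast
qed

section \<open>Charts, partitions of unity and integrability\<close>

lemma complex_manifold_chart:
  assumes "complex_manifold Q" "c \<in> charts Q"
  shows "openin (mtop Q) (fst c)" "openin (top_of_set (cspace (cdim Q))) (snd c ` fst c)"
    "homeomorphic_map (subtopology (mtop Q) (fst c)) (top_of_set (snd c ` fst c)) (snd c)"
    "inj_on (snd c) (fst c)"
proof -
  have a: "openin (mtop Q) (fst c) \<and> openin (top_of_set (cspace (cdim Q))) (snd c ` fst c) \<and>
      homeomorphic_map (subtopology (mtop Q) (fst c)) (top_of_set (snd c ` fst c)) (snd c)"
    using assms(1)[unfolded complex_manifold_def, THEN conjunct2, THEN conjunct2, THEN conjunct2,
        THEN conjunct1, THEN bspec, OF assms(2)] by (simp add: case_prod_beta)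
  then show "openin (mtop Q) (fst c)" "openin (top_of_set (cspace (cdim Q))) (snd c ` fst c)"
    "homeomorphic_map (subtopology (mtop Q) (fst c)) (top_of_set (snd c ` fst c)) (snd c)" by auto
  have "topspace (subtopology (mtop Q) (fst c)) = fst c"
    using a by (simp add: openin_subset inf.absorb2)
  then show "inj_on (snd c) (fst c)"
    using a homeomorphic_imp_injective_map by metis
qed

lemma chart_image_openin:
  assumes M: "complex_manifold Q" and c: "c \<in> charts Q" and U: "openin (mtop Q) U"
  shows "openin (top_of_set (cspace (cdim Q))) (snd c ` (fst c \<inter> U))"
    "openin (top_of_set (snd c ` fst c)) (snd c ` (fst c \<inter> U))"
proof -
  note m = complex_manifold_chart[OF M c]
  have "openin (subtopology (mtop Q) (fst c)) (fst c \<inter> U)"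
    using U by (metis openin_subtopology_Int inf_commute)
  then show "openin (top_of_set (snd c ` fst c)) (snd c ` (fst c \<inter> U))"
    using homeomorphic_imp_open_map[OF m(3)] by (simp add: open_map_def)
  then show "openin (top_of_set (cspace (cdim Q))) (snd c ` (fst c \<inter> U))"
    using m(2) openin_trans by blast
qed

lemma chart_inv_continuous:
  assumes M: "complex_manifold Q" and c: "c \<in> charts Q"
  shows "continuous_map (top_of_set (snd c ` fst c)) (mtop Q) (chart_inv c)"
proof -
  note m = complex_manifold_chart[OF M c]
  obtain g where g: "homeomorphic_maps (subtopology (mtop Q) (fst c)) (top_of_set (snd c ` fst c)) (snd c) g"
    using m(3) by (auto simp: homeomorphic_map_maps)
  have eq: "g w = chart_inv c w" if "w \<in> snd c ` fst c" for w
  proof -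
    have "g w \<in> topspace (subtopology (mtop Q) (fst c))"
      using g[unfolded homeomorphic_maps_def, THEN conjunct2, THEN conjunct1, THEN continuous_map_funspace] that
      unfolding Pi_iff topspace_euclidean_subtopology by blast
    moreover have "snd c (g w) = w"
      using g that by (auto simp: homeomorphic_maps_def)
    ultimately
    have "g w \<in> fst c" "snd c (g w) = w" by auto
    then show ?thesis
      using m(4) unfolding chart_inv_def by (metis inv_into_f_f)
  qed
  have "continuous_map (top_of_set (snd c ` fst c)) (subtopology (mtop Q) (fst c)) (chart_inv c)"
    using g[unfolded homeomorphic_maps_def, THEN conjunct2, THEN conjunct1] eq
    by (rule continuous_map_eq) simp
  then show ?thesis
    by (simp add: continuous_map_in_subtopology)
qed

text \<open>Compact Hausdorff spaces are normal and regular. Urysohn functions supported inside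
  chart domains are positive near their centres, finitely many of them have a positive sum, and
  division by it normalizes. With existence, the \<open>SOME\<close> in
  \<open>volume_integral\<close> selects a genuine partition.\<close>

lemma partition_of_unity_exists:
  assumes M: "complex_manifold Q" and cpt: "compact_space (mtop Q)"
  shows "\<exists>F \<rho>. partition_of_unity Q F \<rho>"
proof -
  let ?X = "mtop Q"
  have H: "Hausdorff_space ?X" using M unfolding complex_manifold_def by blast
  have reg: "regular_space ?X" and norm: "normal_space ?X"
    using compact_Hausdorff_imp_regular_space[OF cpt H] compact_Hausdorff_or_regular_imp_normal_space[OF cpt] H
    by auto
  \<comment> \<open>The closed set \<open>V\<close> between the support of \<open>f\<close> and the
    chart domain is what later keeps the closure of the support inside the chart.\<close>
  define P where "P x c V f \<longleftrightarrow> c \<in> charts Q \<and> closedin ?X V \<and> V \<subseteq> fst c \<and>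
      continuous_map ?X euclideanreal f \<and> (\<forall>y\<in>topspace ?X. 0 \<le> f y) \<and>
      {y \<in> topspace ?X. f y \<noteq> 0} \<subseteq> V \<and> f x = (1::real)" for x c V f
  have "\<exists>c V f. P x c V f"
    if x: "x \<in> topspace ?X" for x
  proof -
    obtain c where c: "c \<in> charts Q" "x \<in> fst c"
      using M x unfolding complex_manifold_def by blast
    obtain W V where W: "openin ?X W" "closedin ?X V" "x \<in> W" "W \<subseteq> V" "V \<subseteq> fst c"
      using reg complex_manifold_chart(1)[OF M c(1)] c(2)
      unfolding neighbourhood_base_of_closedin[symmetric] neighbourhood_base_of by meson
    have "closedin ?X {x}"
      using Hausdorff_imp_t1_space[OF H] x by (simp add: t1_space_closedin_singleton)
    moreover have "closedin ?X (topspace ?X - W)"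
      using W(1) by blast
    moreover have "disjnt (topspace ?X - W) {x}"
      using W(3) by (auto simp: disjnt_def)
    ultimately obtain f where f: "continuous_map ?X (top_of_set {0..1::real}) f"
        "f ` (topspace ?X - W) \<subseteq> {0}" "f ` {x} \<subseteq> {1}"
      using Urysohn_lemma[OF norm, of "topspace ?X - W" "{x}" 0 1] by auto
    have "f y \<in> topspace (top_of_set {0..1::real})" if "y \<in> topspace ?X" for y
      using f(1) that unfolding continuous_map_def Pi_iff by blast
    then have "0 \<le> f y" if "y \<in> topspace ?X" for y
      using that by simp
    moreover have "continuous_map ?X euclideanreal f"
      using f(1) by (simp add: continuous_map_in_subtopology)
    moreover have "{y \<in> topspace ?X. f y \<noteq> 0} \<subseteq> V"
      using f(2) W(4) by blast
    ultimately show ?thesis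
      unfolding P_def using c(1) W(2,5) f(3) by (intro exI[of _ c] exI[of _ V] exI[of _ f] conjI) auto
  qed
  then obtain c V f where "\<And>x. x \<in> topspace ?X \<Longrightarrow> P x (c x) (V x) (f x)"
    by metis
  note cVf = this[unfolded P_def]
  let ?O = "\<lambda>x. {y \<in> topspace ?X. f x y \<in> {0<..}}"
  have "openin ?X (?O x)" if "x \<in> topspace ?X" for x
    using cVf[OF that] by (intro openin_continuous_map_preimage[where Y = euclideanreal]) auto
  moreover have "topspace ?X \<subseteq> \<Union> (?O ` topspace ?X)"
    using cVf by force
  ultimately obtain \<F> where \<F>: "finite \<F>" "\<F> \<subseteq> ?O ` topspace ?X" "topspace ?X \<subseteq> \<Union> \<F>"
    using cpt unfolding compact_space_alt by (metis (no_types, lifting) imageE)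
  then obtain S where S: "S \<subseteq> topspace ?X" "finite S" "\<F> = ?O ` S"
    by (meson finite_subset_image)
  define t where "t y = (\<Sum>x\<in>S. f x y)" for y
  have f0: "0 \<le> f x y" if "x \<in> S" "y \<in> topspace ?X" for x y
    using cVf S(1) that by blast
  have t: "t y > 0" if y: "y \<in> topspace ?X" for y
  proof -
    obtain x where "x \<in> S" "f x y > 0"
      using \<F>(3) S(3) y by auto
    then show ?thesis
      unfolding t_def using S(2) f0 y by (intro sum_pos2) auto
  qed
  \<comment> \<open>Several bumps may belong to the same chart, while the partition is indexed by
    charts; hence the grouping by \<open>c\<close>.\<close>
  define \<rho> where "\<rho> c' y = (\<Sum>x | x \<in> S \<and> c x = c'. f x y) / t y" for c' y
  have "partition_of_unity Q (c ` S) \<rho>"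
    unfolding partition_of_unity_def
  proof (intro conjI ballI)
    show "finite (c ` S)" using S by simp
    show "c ` S \<subseteq> charts Q" using S(1) cVf by auto
    fix c' assume "c' \<in> c ` S"
    have fc: "continuous_map ?X euclideanreal (f x)" if "x \<in> S" for x
      using S(1) cVf that by blast
    have "continuous_map ?X euclideanreal t"
      unfolding t_def by (intro continuous_map_sum S fc)
    then show "continuous_map ?X euclideanreal (\<rho> c')"
      unfolding \<rho>_def using t S(2) fc
      by (intro continuous_map_real_divide continuous_map_sum) (auto simp: less_le)
    show "0 \<le> \<rho> c' y" if "y \<in> topspace ?X" for y
      unfolding \<rho>_def using f0 t that by (intro divide_nonneg_pos sum_nonneg) auto
    have sub: "{y \<in> topspace ?X. \<rho> c' y \<noteq> 0} \<subseteq> (\<Union>x\<in>{x\<in>S. c x = c'}. V x)"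
    proof
      fix y assume y: "y \<in> {y \<in> topspace ?X. \<rho> c' y \<noteq> 0}"
      then have "(\<Sum>x | x \<in> S \<and> c x = c'. f x y) \<noteq> 0" by (auto simp: \<rho>_def)
      then obtain x where "x \<in> S" "c x = c'" "f x y \<noteq> 0"
        by (auto elim: sum.not_neutral_contains_not_neutral)
      then show "y \<in> (\<Union>x\<in>{x\<in>S. c x = c'}. V x)"
        using cVf[of x] S(1) y by blast
    qed
    have "closedin ?X (\<Union>x\<in>{x\<in>S. c x = c'}. V x)"
      using S cVf by (intro closedin_Union) auto
    then have "?X closure_of {y \<in> topspace ?X. \<rho> c' y \<noteq> 0} \<subseteq> (\<Union>x\<in>{x\<in>S. c x = c'}. V x)"
      using sub by (simp add: closure_of_minimal)
    also have "\<dots> \<subseteq> fst c'"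
      using S(1) cVf by blast
    finally show "?X closure_of {y \<in> topspace ?X. \<rho> c' y \<noteq> 0} \<subseteq> fst c'" .
  next
    fix y assume y: "y \<in> topspace ?X"
    have "(\<Sum>c'\<in>c ` S. \<rho> c' y) = (\<Sum>c'\<in>c ` S. \<Sum>x | x \<in> S \<and> c x = c'. f x y) / t y"
      unfolding \<rho>_def by (simp add: sum_divide_distrib)
    also have "(\<Sum>c'\<in>c ` S. \<Sum>x | x \<in> S \<and> c x = c'. f x y) = t y"
      unfolding t_def by (rule sum.image_gen[OF S(2), symmetric])
    finally show "(\<Sum>c'\<in>c ` S. \<rho> c' y) = 1"
      using t[OF y] by simp
  qed
  then show ?thesis by blast
qed

lemma sets_clebesgue [simp]: "sets (clebesgue n) = sets borel"
  by (simp add: clebesgue_def)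

lemma measurable_zero_extension:
  "(\<lambda>w (j::nat). if j < n then w j else 0) \<in> Pi\<^sub>M {..<n} (\<lambda>_. lborel :: complex measure) \<rightarrow>\<^sub>M borel"
proof (rule measurable_coordinatewise_then_product)
  show "(\<lambda>w. if j < n then w j else 0) \<in> borel_measurable (Pi\<^sub>M {..<n} (\<lambda>_. lborel :: complex measure))" for j
    by (cases "j < n") simp_all
qed

lemma product_sigma_finite_lborel: "product_sigma_finite (\<lambda>_. lborel :: complex measure)"
  by standard

lemmas emeasure_PiM_lborel = product_sigma_finite.emeasure_PiM[OF product_sigma_finite_lborel]

text \<open>Compactness bounds every coordinate, so the preimage in the finite product lies in a
  polydisc, which has finite volume.\<close>

lemma emeasure_clebesgue_compact:
  assumes K: "compact K"
  shows "emeasure (clebesgue n) K < \<infinity>"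
proof -
  let ?L = "Pi\<^sub>M {..<n} (\<lambda>_. lborel :: complex measure)"
  let ?e = "\<lambda>w j. if j < n then w j else 0"
  have "\<exists>B. \<forall>w\<in>K. cmod (w j) \<le> B" for j
  proof -
    have "compact ((\<lambda>w. w j) ` K)"
      by (intro compact_continuous_image K continuous_on_subset[OF continuous_on_product_coordinates]) simp
    then have "bounded ((\<lambda>w. w j) ` K)"
      by (rule compact_imp_bounded)
    then show ?thesis
      by (auto simp: bounded_iff)
  qed
  then obtain B where B: "\<And>j w. w \<in> K \<Longrightarrow> cmod (w j) \<le> B j"
    by metis
  have Ks [measurable]: "K \<in> sets borel"
    using K by (simp add: compact_imp_closed)
  have "emeasure (clebesgue n) K = emeasure ?L (?e -` K \<inter> space ?L)"
    unfolding clebesgue_def by (rule emeasure_distr[OF measurable_zero_extension Ks])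
  also have "\<dots> \<le> emeasure ?L (Pi\<^sub>E {..<n} (\<lambda>j. cball 0 (B j)))"
  proof (rule emeasure_mono)
    show "?e -` K \<inter> space ?L \<subseteq> Pi\<^sub>E {..<n} (\<lambda>j. cball 0 (B j))"
    proof
      fix w assume w: "w \<in> ?e -` K \<inter> space ?L"
      have "cmod (w j) \<le> B j" if "j < n" for j
        using B[of "?e w" j] w that by simp
      then show "w \<in> Pi\<^sub>E {..<n} (\<lambda>j. cball 0 (B j))"
        using w by (auto simp: space_PiM PiE_iff)
    qed
  qed (auto intro!: sets_PiM_I_finite)
  also have "\<dots> = (\<Prod>j<n. emeasure lborel (cball (0::complex) (B j)))"
    by (rule emeasure_PiM_lborel) auto
  also have "\<dots> = (\<Prod>j<n. ennreal (measure lborel (cball (0::complex) (B j))))"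
    using emeasure_bounded_finite[of "cball (0::complex) _"]
    by (intro prod.cong refl emeasure_eq_ennreal_measure) (simp add: less_top)
  also have "\<dots> < \<infinity>"
    by (simp add: prod_ennreal)
  finally show ?thesis .
qed

text \<open>\<open>g\<close> may be unbounded on the chart image. The factor \<open>\<rho> c\<close>
  vanishes off a compact set \<open>K\<close>, the image of the closure of its support; on
  \<open>K\<close> the integrand is bounded, and \<open>K\<close> has finite measure.\<close>

lemma set_integrable_partition_piece:
  fixes g :: "cvec \<Rightarrow> complex"
  assumes M: "complex_manifold Q" and cpt: "compact_space (mtop Q)"
    and P: "partition_of_unity Q F \<rho>" and c: "c \<in> F"
    and g: "continuous_on (snd c ` fst c) g"
  shows "set_integrable (clebesgue n) (snd c ` fst c) (\<lambda>w. \<rho> c (chart_inv c w) *\<^sub>R g w)"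
proof -
  let ?X = "mtop Q" and ?D = "snd c ` fst c" and ?h = "\<lambda>w. \<rho> c (chart_inv c w) *\<^sub>R g w"
  let ?S = "?X closure_of {x \<in> topspace ?X. \<rho> c x \<noteq> 0}"
  have cc: "c \<in> charts Q" and cont: "continuous_map ?X euclideanreal (\<rho> c)" and S: "?S \<subseteq> fst c"
    using P c unfolding partition_of_unity_def by auto
  note m = complex_manifold_chart[OF M cc]
  define K where "K = snd c ` ?S"
  have KD: "K \<subseteq> ?D" using S by (auto simp: K_def)
  have "compactin ?X ?S"
    using cpt by (simp add: closedin_compact_space)
  then have "compactin (subtopology ?X (fst c)) ?S"
    using S by (rule compact_imp_compactin_subtopology)
  then have "compactin (top_of_set ?D) K"
    unfolding K_def by (rule image_compactin[OF _ homeomorphic_imp_continuous_map[OF m(3)]])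
  then have K: "compact K"
    by (simp add: compactin_subtopology)
  have Ks: "K \<in> sets borel" using K by (simp add: compact_imp_closed)
  have "continuous_map (top_of_set ?D) euclideanreal (\<rho> c \<circ> chart_inv c)"
    by (rule continuous_map_compose[OF chart_inv_continuous[OF M cc] cont])
  then have "continuous_on ?D (\<lambda>w. \<rho> c (chart_inv c w))"
    by (simp add: continuous_map_iff_continuous o_def)
  then have h: "continuous_on ?D ?h"
    using g by (intro continuous_intros)
  have hK: "continuous_on K ?h"
    using continuous_on_subset[OF h KD] .
  have zero: "?h w = 0" if w: "w \<in> ?D" "w \<notin> K" for w
  proof -
    obtain x where x: "x \<in> fst c" "w = snd c x" using w(1) by blast
    then have inv: "chart_inv c w = x"
      using m(4) by (simp add: chart_inv_def)
    have "x \<in> topspace ?X"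
      using x(1) m(1) openin_subset by blast
    then have "\<rho> c x = 0"
      using w(2) x closure_of_subset[of "{x \<in> topspace ?X. \<rho> c x \<noteq> 0}" ?X] unfolding K_def by blast
    then show ?thesis by (simp add: inv)
  qed
  have eq: "indicator ?D w *\<^sub>R ?h w = indicator K w *\<^sub>R ?h w" for w
    using zero[of w] KD by (auto simp: indicator_def)
  obtain B where B: "\<And>w. w \<in> K \<Longrightarrow> norm (?h w) \<le> B"
    using compact_imp_bounded[OF compact_continuous_image[OF hK K]] by (auto simp: bounded_iff)
  have "integrable (clebesgue n) (\<lambda>w. indicator K w *\<^sub>R ?h w)"
  proof (rule integrableI_bounded_set[where A = K and B = B])
    show "(\<lambda>w. indicat_real K w *\<^sub>R ?h w) \<in> borel_measurable (clebesgue n)"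
      using borel_measurable_continuous_on_indicator[OF Ks hK] by (simp cong: measurable_cong_sets)
  qed (use Ks B emeasure_clebesgue_compact[OF K] in \<open>auto simp: indicator_def\<close>)
  then show ?thesis
    unfolding set_integrable_def eq .
qed

lemma continuous_on_liouville_density:
  assumes K: "two_form_on Q (kform Q)" and c: "c \<in> charts Q"
  shows "continuous_on (snd c ` fst c) (\<lambda>w. liouville_density (cdim Q) (kform Q c w))"
proof -
  have cont: "continuous_on (snd c ` fst c) (\<lambda>w. kform Q c w u v)"
    if "u \<in> cspace (cdim Q)" "v \<in> cspace (cdim Q)" for u v
  proof -
    have "smooth_on (cdim Q) (snd c ` fst c) (\<lambda>w. kform Q c w u v)"
      using K c that unfolding two_form_on_def by blast
    then have "Ck_on (cdim Q) 0 (snd c ` fst c) (\<lambda>w. kform Q c w u v)"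
      unfolding smooth_on_def by blast
    then show ?thesis by simp
  qed
  have ax: "axis_vec (\<sigma> k div 2) e \<in> cspace (cdim Q)" if "\<sigma> permutes {..<2 * cdim Q}" "k < 2 * cdim Q" for \<sigma> k e
    using permutes_in_image[OF that(1), of k] that(2) by (auto simp: axis_vec_def cspace_def)
  show ?thesis
    unfolding liouville_density_def wedge_power_def
    by (intro continuous_intros cont ax) auto
qed

section \<open>Sesquilinearity of the scalar product of sections\<close>

lemma hermitian_metric_fibre:
  assumes "hermitian_metric Q" "x \<in> points Q" "q \<in> fibre Q x" "r \<in> fibre Q x"
  shows "lmetric Q r q = cnj (lmetric Q q r)" "lmetric Q q (lsmul Q c r) = c * lmetric Q q r"
    "r' \<in> fibre Q x \<Longrightarrow> lmetric Q q (ladd Q r r') = lmetric Q q r + lmetric Q q r'"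
  using assms unfolding hermitian_metric_def by blast+

lemma lmetric_comb_right:
  assumes triv: "fibrewise_trivialized Q" and h: "hermitian_metric Q" and x: "x \<in> points Q"
    and q: "q \<in> fibre Q x" and b: "\<And>j. j < k \<Longrightarrow> b j x \<in> fibre Q x"
  shows "lmetric Q q (section_comb Q a b k x) = (\<Sum>j<k. a j * lmetric Q q (b j x))"
proof -
  obtain U \<tau> where U: "(U, \<tau>) \<in> ltriv Q" "x \<in> U"
    using trivialization_at[OF triv x] .
  note t = fibre_trivialization[OF triv U]
  show ?thesis
    using b
  proof (induction k)
    case 0
    \<comment> \<open>Homogeneity of the metric gives the value 0 once the zero vector is written as
      a multiple of \<open>q\<close>.\<close>
    have "lzero Q x = lsmul Q 0 q"
      using inj_onD[OF t(1), of "lzero Q x" "lsmul Q 0 q"] t q by simp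
    then show ?case
      using hermitian_metric_fibre(2)[OF h x q q, of 0] x by simp
  next
    case (Suc k)
    have "section_comb Q a b k x \<in> fibre Q x"
      using section_comb_trivialization(1)[OF triv U] Suc.prems by simp
    moreover have "b k x \<in> fibre Q x" using Suc.prems by simp
    ultimately show ?case
      using Suc x t hermitian_metric_fibre[OF h x q] by simp
  qed
qed

lemma lmetric_comb:
  assumes triv: "fibrewise_trivialized Q" and h: "hermitian_metric Q" and x: "x \<in> points Q"
    and b: "\<And>j. j < k \<Longrightarrow> b j x \<in> fibre Q x"
  shows "lmetric Q (section_comb Q a b k x) (section_comb Q a' b k x) =
    (\<Sum>i<k. \<Sum>j<k. cnj (a i) * a' j * lmetric Q (b i x) (b j x))"
proof -
  obtain U \<tau> where U: "(U, \<tau>) \<in> ltriv Q" "x \<in> U"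
    using trivialization_at[OF triv x] .
  have c: "section_comb Q a b k x \<in> fibre Q x" for a
    using section_comb_trivialization(1)[where b = b and k = k, OF triv U b] .
  have "lmetric Q (section_comb Q a b k x) (b j x) = (\<Sum>i<k. cnj (a i) * lmetric Q (b i x) (b j x))" if "j < k" for j
  proof -
    have "lmetric Q (section_comb Q a b k x) (b j x) = cnj (lmetric Q (b j x) (section_comb Q a b k x))"
      by (rule hermitian_metric_fibre(1)[OF h x b[OF that] c])
    also have "\<dots> = cnj (\<Sum>i<k. a i * lmetric Q (b j x) (b i x))"
      using lmetric_comb_right[where b = b and a = a and k = k, OF triv h x b[OF that] b] by simp
    also have "\<dots> = (\<Sum>i<k. cnj (a i) * lmetric Q (b i x) (b j x))"
      using hermitian_metric_fibre(1)[OF h x b[OF that] b] by simp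
    finally show ?thesis .
  qed
  then have "lmetric Q (section_comb Q a b k x) (section_comb Q a' b k x) =
      (\<Sum>j<k. a' j * (\<Sum>i<k. cnj (a i) * lmetric Q (b i x) (b j x)))"
    using lmetric_comb_right[where b = b and a = a' and k = k, OF triv h x c b] by simp
  also have "\<dots> = (\<Sum>j<k. \<Sum>i<k. cnj (a i) * a' j * lmetric Q (b i x) (b j x))"
    by (simp add: sum_distrib_left mult_ac)
  also have "\<dots> = (\<Sum>i<k. \<Sum>j<k. cnj (a i) * a' j * lmetric Q (b i x) (b j x))"
    by (rule sum.swap)
  finally show ?thesis .
qed

text \<open>Both vectors are multiples of the frame vector. This reduces the metric on sections to
  \<open>local_metric\<close>, the function whose smoothness \<open>hermitian_metric\<close>
  provides.\<close>

lemma lmetric_frame: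
  assumes triv: "fibrewise_trivialized Q" and h: "hermitian_metric Q"
    and U: "(U, \<tau>) \<in> ltriv Q" "x \<in> U" and q: "q \<in> fibre Q x" and r: "r \<in> fibre Q x"
  shows "lmetric Q q r = cnj (\<tau> q) * \<tau> r * of_real (Re (lmetric Q (frame Q \<tau> x) (frame Q \<tau> x)))"
proof -
  note t = fibre_trivialization[OF triv U]
  let ?f = "frame Q \<tau> x"
  have f: "?f \<in> fibre Q x" "\<tau> ?f = 1"
    using t(2) unfolding frame_def by (metis UNIV_I inv_into_into, metis UNIV_I f_inv_into_f)
  have e: "p = lsmul Q (\<tau> p) ?f" if "p \<in> fibre Q x" for p
    using inj_onD[OF t(1), of p "lsmul Q (\<tau> p) ?f"] t f that by simp
  note hf = hermitian_metric_fibre[OF h t(9)]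
  have "lmetric Q q r = \<tau> r * lmetric Q q ?f"
    using e[OF r] hf(2)[OF q f(1)] by metis
  also have "lmetric Q q ?f = cnj (lmetric Q ?f q)"
    by (rule hf(1)[OF f(1) q])
  also have "lmetric Q ?f q = \<tau> q * lmetric Q ?f ?f"
    using e[OF q] hf(2)[OF f(1) f(1)] by metis
  also have "lmetric Q ?f ?f = of_real (Re (lmetric Q ?f ?f))"
    using hf(1)[OF f(1) f(1)] by (simp add: complex_eq_iff)
  finally show ?thesis by simp
qed

text \<open>A chart domain need not lie in a trivializing set. Continuity is therefore checked at
  each point on the intersection with one, whose image is open in the chart image.\<close>

lemma continuous_on_lmetric:
  assumes M: "complex_manifold Q" and triv: "fibrewise_trivialized Q" and h: "hermitian_metric Q"
    and c: "c \<in> charts Q" and s: "s \<in> hol_sections Q" and t: "t \<in> hol_sections Q"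
  shows "continuous_on (snd c ` fst c) (\<lambda>w. lmetric Q (s (chart_inv c w)) (t (chart_inv c w)))"
    (is "continuous_on ?D ?f")
proof -
  note m = complex_manifold_chart[OF M c]
  have "continuous (at w within ?D) ?f" if w: "w \<in> ?D" for w
  proof -
    obtain x where x: "x \<in> fst c" "w = snd c x" using w by blast
    then have "x \<in> points Q" using m(1) openin_subset by blast
    then obtain U \<tau> where U: "(U, \<tau>) \<in> ltriv Q" "x \<in> U"
      using trivialization_at[OF triv] by metis
    let ?E = "snd c ` (fst c \<inter> U)"
    have Uo: "openin (mtop Q) U"
      by (rule fibrewise_trivializedD(1)[OF triv U(1)])
    obtain O' where O': "open O'" "?E = ?D \<inter> O'"
      using chart_image_openin(2)[OF M c Uo] by (auto simp: openin_open)
    have "continuous_on ?E (\<lambda>w. \<tau> (s (chart_inv c w)))" "continuous_on ?E (\<lambda>w. \<tau> (t (chart_inv c w)))"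
      using s t U(1) c unfolding hol_sections_def holomorphic_fun_on_def mv_holomorphic_on_def by blast+
    moreover have "continuous_on ?E (local_metric Q \<tau> c)"
    proof -
      have "smooth_on (cdim Q) ?E (local_metric Q \<tau> c)"
        using h U(1) c unfolding hermitian_metric_def by blast
      then have "Ck_on (cdim Q) 0 ?E (local_metric Q \<tau> c)"
        unfolding smooth_on_def by blast
      then show ?thesis by simp
    qed
    ultimately have "continuous_on ?E (\<lambda>w. cnj (\<tau> (s (chart_inv c w))) * \<tau> (t (chart_inv c w)) *
        of_real (local_metric Q \<tau> c w))"
      by (intro continuous_intros)
    then have "continuous_on ?E ?f"
    proof (rule iffD2[OF continuous_on_cong[OF refl], rotated])
      fix w' assume "w' \<in> ?E"
      then obtain y where y: "y \<in> fst c" "y \<in> U" "w' = snd c y" by blast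
      then have inv: "chart_inv c w' = y"
        using m(4) by (simp add: chart_inv_def)
      have yp: "y \<in> points Q" using y(1) m(1) openin_subset by blast
      show "?f w' = cnj (\<tau> (s (chart_inv c w'))) * \<tau> (t (chart_inv c w')) * of_real (local_metric Q \<tau> c w')"
        unfolding inv local_metric_def
        by (rule lmetric_frame[OF triv h U(1) y(2) hol_sections_fibre[OF s yp] hol_sections_fibre[OF t yp]])
    qed
    moreover have "w \<in> ?E" using x U(2) by blast
    ultimately have "continuous (at w within ?E) ?f"
      unfolding continuous_on_eq_continuous_within by blast
    moreover have "at w within ?E = at w within ?D"
      using O' \<open>w \<in> ?E\<close> by (intro at_within_nhd[where S = O']) auto
    ultimately show ?thesis by simp
  qed
  then show ?thesis by (simp add: continuous_on_eq_continuous_within)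
qed

lemma closed_cspace: "closed (cspace n)"
proof -
  have "cspace n = (\<Inter>j\<in>{n..}. {w. w j = 0})" by (auto simp: cspace_def)
  moreover have "closed {w :: cvec. w j = 0}" for j
    by (intro closed_Collect_eq continuous_intros continuous_on_product_coordinates)
  ultimately show ?thesis by (simp add: closed_INT)
qed

text \<open>The partition picked by \<open>SOME\<close> is the same for all sections, so this is
  linearity of finitely many chart integrals. Splitting them requires every summand to be
  integrable, which \<open>set_integrable_partition_piece\<close> gives.\<close>

lemma section_inner_comb:
  assumes M: "complex_manifold Q" and cpt: "compact_space (mtop Q)"
    and K: "two_form_on Q (kform Q)"
    and triv: "fibrewise_trivialized Q" and h: "hermitian_metric Q"
    and b: "\<And>j. j < k \<Longrightarrow> b j \<in> hol_sections Q"
  shows "section_inner Q (section_comb Q a b k) (section_comb Q a' b k) =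
    (\<Sum>i<k. \<Sum>j<k. cnj (a i) * a' j * section_inner Q (b i) (b j))"
proof -
  obtain F \<rho> where F: "(SOME (F, \<rho>). partition_of_unity Q F \<rho>) = (F, \<rho>)"
    by fastforce
  obtain F0 \<rho>0 where "partition_of_unity Q F0 \<rho>0"
    using partition_of_unity_exists[OF M cpt] by blast
  then have P: "partition_of_unity Q F \<rho>"
    using someI[of "\<lambda>(F, \<rho>). partition_of_unity Q F \<rho>" "(F0, \<rho>0)"] F by simp
  let ?n = "cdim Q" and ?D = "\<lambda>c. snd c ` fst c"
  let ?d = "\<lambda>c w. liouville_density (cdim Q) (kform Q c w)"
  let ?i = "\<lambda>c s t. (LINT w : ?D c | clebesgue ?n. (\<rho> c (chart_inv c w) * ?d c w) *\<^sub>R lmetric Q (s (chart_inv c w)) (t (chart_inv c w)))"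
  let ?g = "\<lambda>c i j w. (\<rho> c (chart_inv c w) * ?d c w) *\<^sub>R lmetric Q (b i (chart_inv c w)) (b j (chart_inv c w))"
  have inner: "section_inner Q s t = (\<Sum>c\<in>F. ?i c s t)" for s t
    unfolding section_inner_def volume_integral_def F by simp
  have "?i c (section_comb Q a b k) (section_comb Q a' b k) =
      (\<Sum>i<k. \<Sum>j<k. cnj (a i) * a' j * ?i c (b i) (b j))" if c: "c \<in> F" for c
  proof -
    have cc: "c \<in> charts Q" using P c unfolding partition_of_unity_def by blast
    note m = complex_manifold_chart[OF M cc]
    have int: "set_integrable (clebesgue ?n) (?D c)
        (?g c i j)"
      if "i < k" "j < k" for i j
    proof -
      have "continuous_on (?D c) (\<lambda>w. ?d c w *\<^sub>R lmetric Q (b i (chart_inv c w)) (b j (chart_inv c w)))"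
        by (intro continuous_intros continuous_on_liouville_density[OF K cc]
            continuous_on_lmetric[OF M triv h cc] b that)
      from set_integrable_partition_piece[OF M cpt P c this] show ?thesis
        by simp
    qed
    have Db: "?D c \<in> sets (clebesgue ?n)"
    proof -
      obtain O' where "open O'" "?D c = cspace ?n \<inter> O'"
        using m(2) by (auto simp: openin_open)
      then show ?thesis by (simp add: closed_cspace)
    qed
    have "?i c (section_comb Q a b k) (section_comb Q a' b k) =
      (LINT w : ?D c | clebesgue ?n. (\<Sum>i<k. \<Sum>j<k. cnj (a i) * a' j *
        ?g c i j w))"
    proof (rule set_lebesgue_integral_cong[OF Db], intro allI impI)
      fix w assume "w \<in> ?D c"
      then obtain x where x: "x \<in> fst c" "w = snd c x" by blast
      then have inv: "chart_inv c w = x"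
        using m(4) by (simp add: chart_inv_def)
      have xp: "x \<in> points Q" using x(1) m(1) openin_subset by blast
      have fib: "b j x \<in> fibre Q x" if "j < k" for j
        using hol_sections_fibre[OF b[OF that] xp] .
      show "(\<rho> c (chart_inv c w) * ?d c w) *\<^sub>R lmetric Q (section_comb Q a b k (chart_inv c w)) (section_comb Q a' b k (chart_inv c w)) =
        (\<Sum>i<k. \<Sum>j<k. cnj (a i) * a' j *
        ?g c i j w)"
        unfolding inv
        using lmetric_comb[where b = b and k = k and a = a and a' = a', OF triv h xp fib]
        by (simp only: scaleR_sum_right mult_scaleR_right)
    qed
    also have "\<dots> = (LINT w | clebesgue ?n. (\<Sum>i<k. \<Sum>j<k. cnj (a i) * a' j * (indicator (?D c) w *\<^sub>R
        ?g c i j w)))"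
      unfolding set_lebesgue_integral_def by (simp only: scaleR_sum_right mult_scaleR_right)
    also have "\<dots> = (\<Sum>i<k. LINT w | clebesgue ?n. (\<Sum>j<k. cnj (a i) * a' j * (indicator (?D c) w *\<^sub>R
        ?g c i j w)))"
      by (intro Bochner_Integration.integral_sum Bochner_Integration.integrable_sum integrable_mult_right
          int[unfolded set_integrable_def]) auto
    also have "\<dots> = (\<Sum>i<k. \<Sum>j<k. LINT w | clebesgue ?n. cnj (a i) * a' j * (indicator (?D c) w *\<^sub>R
        ?g c i j w))"
      by (intro sum.cong refl Bochner_Integration.integral_sum integrable_mult_right
          int[unfolded set_integrable_def]) auto
    also have "\<dots> = (\<Sum>i<k. \<Sum>j<k. cnj (a i) * a' j * ?i c (b i) (b j))"
      unfolding set_lebesgue_integral_def by (intro sum.cong refl integral_mult_right_zero)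
    finally show ?thesis .
  qed
  then have "section_inner Q (section_comb Q a b k) (section_comb Q a' b k) =
      (\<Sum>c\<in>F. \<Sum>i<k. \<Sum>j<k. cnj (a i) * a' j * ?i c (b i) (b j))"
    unfolding inner by simp
  also have "\<dots> = (\<Sum>i<k. \<Sum>j<k. cnj (a i) * a' j * section_inner Q (b i) (b j))"
    unfolding inner sum_distrib_left by (simp add: sum.swap[of _ F])
  finally show ?thesis .
qed

section \<open>The Liouville density of the Fubini-Study form\<close>

text \<open>Composition with the transposition reverses the sign and keeps \<open>h\<close>, so the
  sum equals its own negative.\<close>

lemma sum_permutes_sign_eq_0:
  fixes h :: "('a \<Rightarrow> 'a) \<Rightarrow> real"
  assumes "finite A" "i \<in> A" "j \<in> A" "i \<noteq> j"
    "\<And>\<sigma>. \<sigma> permutes A \<Longrightarrow> h (\<sigma> \<circ> Transposition.transpose i j) = h \<sigma>"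
  shows "(\<Sum>\<sigma> | \<sigma> permutes A. of_int (sign \<sigma>) * h \<sigma>) = 0"
proof -
  have t: "Transposition.transpose i j permutes A"
    using assms by (simp add: permutes_swap_id)
  have "(\<Sum>\<sigma> | \<sigma> permutes A. of_int (sign \<sigma>) * h \<sigma>) =
      (\<Sum>\<sigma> | \<sigma> permutes A. of_int (sign (\<sigma> \<circ> Transposition.transpose i j)) * h (\<sigma> \<circ> Transposition.transpose i j))"
    by (rule sum_permutations_compose_right[OF t])
  also have "\<dots> = (\<Sum>\<sigma> | \<sigma> permutes A. - (of_int (sign \<sigma>) * h \<sigma>))"
  proof (rule sum.cong[OF refl], clarify)
    fix \<sigma> assume s: "\<sigma> permutes A"
    have "sign (\<sigma> \<circ> Transposition.transpose i j) = - sign \<sigma>"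
      using assms(4) permutes_imp_permutation[OF assms(1) s] permutes_imp_permutation[OF assms(1) t]
      by (simp add: sign_compose sign_swap_id)
    then show "of_int (sign (\<sigma> \<circ> Transposition.transpose i j)) * h (\<sigma> \<circ> Transposition.transpose i j) = - (of_int (sign \<sigma>) * h \<sigma>)"
      using assms(5)[OF s] by simp
  qed
  finally show ?thesis
    by (simp add: sum_negf)
qed

section \<open>The Pfaffian of the standard symplectic form and its rank-two updates\<close>

lemma even_neq_odd: "2 * a \<noteq> Suc (2 * b)" "Suc (2 * a) \<noteq> 2 * b" for a b :: nat
  by presburger+

text \<open>The matrix of the sum of the forms dx_j wedge dy_j in the interleaved basis e_0, i e_0,
  e_1, i e_1, ... used by \<open>liouville_density\<close>.\<close>

definition std_sympl :: "nat \<Rightarrow> nat \<Rightarrow> real" where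
  "std_sympl a b = (if even a \<and> b = Suc a then 1 else if even b \<and> a = Suc b then -1 else 0)"

text \<open>The index of the other member of the pair e_j, i e_j: the only one on which
  \<open>std_sympl a\<close> does not vanish.\<close>

definition partner :: "nat \<Rightarrow> nat" where
  "partner a = (if even a then Suc a else a - 1)"

lemma partner_simps [simp]:
  "partner (2 * k) = Suc (2 * k)" "partner (Suc (2 * k)) = 2 * k" "partner (partner a) = a"
  "partner a \<noteq> a" "partner a div 2 = a div 2"
  by (auto simp: partner_def elim!: oddE)

lemma partner_lt: "a < 2 * n \<Longrightarrow> partner a < 2 * n"
  by (auto simp: partner_def elim!: evenE oddE)

lemma std_sympl_nonzero_iff: "std_sympl a b \<noteq> 0 \<longleftrightarrow> b = partner a"
  by (auto simp: std_sympl_def partner_def elim: oddE)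

lemma std_sympl_swap: "std_sympl b a = - std_sympl a b"
  by (auto simp: std_sympl_def)

text \<open>A summand of the Pfaffian of \<open>std_sympl\<close>, in the unnormalized form that
  runs over all permutations.\<close>

definition pfaff_term :: "nat \<Rightarrow> (nat \<Rightarrow> nat) \<Rightarrow> real" where
  "pfaff_term n \<sigma> = of_int (sign \<sigma>) * (\<Prod>k<n. std_sympl (\<sigma> (2 * k)) (\<sigma> (Suc (2 * k))))"

text \<open>The sign of the permutation and one antisymmetric factor change simultaneously.\<close>

lemma pfaff_term_swap:
  assumes "\<sigma> permutes {..<2 * n}" "k < n"
  shows "pfaff_term n (\<sigma> \<circ> Transposition.transpose (2 * k) (Suc (2 * k))) = pfaff_term n \<sigma>"
proof -
  let ?t = "Transposition.transpose (2 * k) (Suc (2 * k))"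
  have t: "?t permutes {..<2 * n}"
    using assms(2) by (intro permutes_swap_id) auto
  have s: "sign (\<sigma> \<circ> ?t) = - sign \<sigma>"
    using permutes_imp_permutation[OF _ assms(1)] permutes_imp_permutation[OF _ t]
    by (simp add: sign_compose sign_swap_id)
  have "(\<Prod>l<n. std_sympl ((\<sigma> \<circ> ?t) (2 * l)) ((\<sigma> \<circ> ?t) (Suc (2 * l)))) =
      (\<Prod>l<n. (if l = k then -1 else 1) * std_sympl (\<sigma> (2 * l)) (\<sigma> (Suc (2 * l))))"
    by (intro prod.cong refl) (auto simp: Transposition.transpose_def even_neq_odd std_sympl_swap[of "\<sigma> (Suc (2 * k))"])
  also have "\<dots> = - (\<Prod>l<n. std_sympl (\<sigma> (2 * l)) (\<sigma> (Suc (2 * l))))"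
    using assms(2) prod.delta[of "{..<n}" k "\<lambda>_. -1::real"] by (simp add: prod.distrib)
  finally show ?thesis
    unfolding pfaff_term_def s by simp
qed

text \<open>Exchanging two whole pairs is an even permutation and only reorders the factors.\<close>

lemma pfaff_term_swap_pairs:
  assumes "\<sigma> permutes {..<2 * n}" "k < n" "l < n" "k \<noteq> l"
  shows "pfaff_term n (\<sigma> \<circ> (Transposition.transpose (2 * k) (2 * l) \<circ> Transposition.transpose (Suc (2 * k)) (Suc (2 * l)))) =
    pfaff_term n \<sigma>"
proof -
  let ?t = "Transposition.transpose (2 * k) (2 * l)" and ?u = "Transposition.transpose (Suc (2 * k)) (Suc (2 * l))"
  have t: "?t permutes {..<2 * n}" "?u permutes {..<2 * n}"
    using assms by (auto intro!: permutes_swap_id)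
  note p = permutes_imp_permutation[OF finite_lessThan assms(1)]
    permutes_imp_permutation[OF finite_lessThan t(1)] permutes_imp_permutation[OF finite_lessThan t(2)]
  have s: "sign (\<sigma> \<circ> (?t \<circ> ?u)) = sign \<sigma>"
    using assms(4) p by (simp add: sign_compose sign_swap_id permutation_compose)
  have tu: "(?t \<circ> ?u) (2 * j) = 2 * Transposition.transpose k l j" "(?t \<circ> ?u) (Suc (2 * j)) = Suc (2 * Transposition.transpose k l j)" for j
    by (auto simp: Transposition.transpose_def even_neq_odd)
  have "(\<Prod>j<n. std_sympl ((\<sigma> \<circ> (?t \<circ> ?u)) (2 * j)) ((\<sigma> \<circ> (?t \<circ> ?u)) (Suc (2 * j)))) =
      (\<Prod>j<n. std_sympl (\<sigma> (2 * Transposition.transpose k l j)) (\<sigma> (Suc (2 * Transposition.transpose k l j))))"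
    unfolding o_apply[of \<sigma>] tu ..
  also have "\<dots> = (\<Prod>j<n. std_sympl (\<sigma> (2 * j)) (\<sigma> (Suc (2 * j))))"
    using permutes_swap_id[of k "{..<n}" l] assms
    by (subst prod.permute[of "Transposition.transpose k l" "{..<n}"]) (auto simp: o_def)
  finally show ?thesis
    unfolding pfaff_term_def s by simp
qed

text \<open>Swaps inside a pair and exchanges of pairs leave the term unchanged. They bring the
  value \<open>2 * n\<close> to position \<open>2 * n\<close>; then either the last factor vanishes
  or \<open>Suc (2 * n)\<close> is fixed too, and the permutation reduces to one of
  \<open>{..<2 * n}\<close>.\<close>

lemma pfaff_term_nonneg:
  assumes "\<sigma> permutes {..<2 * n}"
  shows "pfaff_term n \<sigma> \<ge> 0"
  using assms
proof (induction n arbitrary: \<sigma>)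
  case 0
  then show ?case
    by (simp add: pfaff_term_def permutes_empty)
next
  case (Suc n)
  have fixed: "pfaff_term (Suc n) \<rho> \<ge> 0"
    if r: "\<rho> permutes {..<2 * Suc n}" "\<rho> (2 * n) = 2 * n" for \<rho>
  proof (cases "pfaff_term (Suc n) \<rho> = 0")
    case False
    then have "std_sympl (\<rho> (2 * n)) (\<rho> (Suc (2 * n))) \<noteq> 0"
      unfolding pfaff_term_def by auto
    then have r2: "\<rho> (Suc (2 * n)) = Suc (2 * n)"
      using r(2) by (simp add: std_sympl_nonzero_iff)
    have "\<rho> permutes {..<2 * n}"
    proof (rule permutes_superset[OF r(1)])
      fix x assume "x \<in> {..<2 * Suc n} - {..<2 * n}"
      then have "x = 2 * n \<or> x = Suc (2 * n)" by auto
      then show "\<rho> x = x" using r(2) r2 by auto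
    qed
    then have "pfaff_term n \<rho> \<ge> 0" by (rule Suc.IH)
    moreover have "pfaff_term (Suc n) \<rho> = pfaff_term n \<rho>"
      unfolding pfaff_term_def using r(2) r2 by (simp add: std_sympl_def)
    ultimately show ?thesis by simp
  qed simp
  have last: "pfaff_term (Suc n) \<rho> \<ge> 0"
    if r: "\<rho> permutes {..<2 * Suc n}" "\<rho> (2 * n) = 2 * n \<or> \<rho> (Suc (2 * n)) = 2 * n" for \<rho>
    using r(2)
  proof
    assume odd: "\<rho> (Suc (2 * n)) = 2 * n"
    let ?t = "Transposition.transpose (2 * n) (Suc (2 * n))"
    have t: "?t permutes {..<2 * Suc n}"
      by (intro permutes_swap_id) auto
    have "pfaff_term (Suc n) (\<rho> \<circ> ?t) \<ge> 0"
      using odd by (intro fixed permutes_compose[OF t r(1)]) auto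
    then show ?thesis
      using pfaff_term_swap[OF r(1), of n] by simp
  qed (use fixed r in auto)
  obtain i where i: "i < 2 * Suc n" "\<sigma> i = 2 * n"
    using permutes_surj[OF Suc.prems] permutes_in_image[OF Suc.prems]
    by (metis lessThan_iff mult_less_cancel1 surj_def zero_less_numeral lessI)
  show ?case
  proof (cases "i div 2 = n")
    case True
    then have "i = 2 * n \<or> i = Suc (2 * n)" by auto
    then show ?thesis using last[OF Suc.prems] i by auto
  next
    case False
    define k where "k = i div 2"
    have k: "k < Suc n" "k \<noteq> n" using i False by (auto simp: k_def)
    have ik: "i = 2 * k \<or> i = Suc (2 * k)" unfolding k_def by auto
    let ?t = "Transposition.transpose (2 * k) (2 * n) \<circ> Transposition.transpose (Suc (2 * k)) (Suc (2 * n))"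
    have t: "?t permutes {..<2 * Suc n}"
      using k by (intro permutes_compose permutes_swap_id) auto
    have "(\<sigma> \<circ> ?t) (2 * n) = \<sigma> (2 * k)" "(\<sigma> \<circ> ?t) (Suc (2 * n)) = \<sigma> (Suc (2 * k))"
      using k by (auto simp: Transposition.transpose_def even_neq_odd)
    then have "pfaff_term (Suc n) (\<sigma> \<circ> ?t) \<ge> 0"
      using ik i by (intro last permutes_compose[OF t Suc.prems]) auto
    then show ?thesis
      using pfaff_term_swap_pairs[OF Suc.prems k(1) _ k(2)] by simp
  qed
qed

text \<open>The identity contributes 1 and no term is negative. This sum divided by
  \<open>fact n\<close> becomes the constant of the Fubini-Study volume.\<close>

lemma pfaff_term_sum_pos: "(\<Sum>\<sigma> | \<sigma> permutes {..<2 * n}. pfaff_term n \<sigma>) > 0"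
proof (rule sum_pos2[where i = id])
  show "0 < pfaff_term n id"
    by (simp add: pfaff_term_def std_sympl_def)
qed (auto simp: finite_permutations pfaff_term_nonneg permutes_id)

lemma sum_even_odd:
  fixes f :: "nat \<Rightarrow> 'a::comm_monoid_add"
  shows "(\<Sum>i<2 * n. f i) = (\<Sum>k<n. f (2 * k) + f (Suc (2 * k)))"
  by (induction n) (simp_all add: algebra_simps)

text \<open>When all other positions hold complete pairs, the two remaining values are a pair as
  well, because \<open>partner\<close> is an involution and \<open>\<sigma>\<close> is
  injective.\<close>

lemma forced_partner:
  assumes "\<sigma> permutes {..<2 * n}" "k < n"
    "\<And>l. l < n \<Longrightarrow> l \<noteq> k \<Longrightarrow> \<sigma> (Suc (2 * l)) = partner (\<sigma> (2 * l))"
  shows "\<sigma> (Suc (2 * k)) = partner (\<sigma> (2 * k))"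
proof -
  have inj: "\<sigma> a = \<sigma> b \<longleftrightarrow> a = b" for a b
    using permutes_inj[OF assms(1)] by (simp add: inj_eq)
  have "\<sigma> (2 * k) < 2 * n"
    using permutes_in_image[OF assms(1), of "2 * k"] assms(2) by simp
  then have "partner (\<sigma> (2 * k)) < 2 * n"
    by (rule partner_lt)
  then obtain i where i: "i < 2 * n" "\<sigma> i = partner (\<sigma> (2 * k))"
    using permutes_surj[OF assms(1)] permutes_in_image[OF assms(1)]
    by (metis lessThan_iff surj_def)
  define l where "l = i div 2"
  have l: "l < n" "i = 2 * l \<or> i = Suc (2 * l)"
    using i by (auto simp: l_def)
  have "l = k"
  proof (rule ccontr)
    assume lk: "l \<noteq> k"
    note a = assms(3)[OF l(1) lk]
    from l(2) show False
    proof
      assume "i = 2 * l"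
      then have "\<sigma> (Suc (2 * l)) = \<sigma> (2 * k)" using a i(2) by simp
      then show False using inj even_neq_odd by metis
    next
      assume "i = Suc (2 * l)"
      then have "partner (\<sigma> (2 * l)) = partner (\<sigma> (2 * k))" using a i(2) by simp
      then have "\<sigma> (2 * l) = \<sigma> (2 * k)" by (metis partner_simps(3))
      then show False using inj lk by simp
    qed
  qed
  moreover have "i \<noteq> 2 * k" using i(2) partner_simps(4) by metis
  ultimately show ?thesis using l(2) i(2) by metis
qed

text \<open>
  Two factors of the rank-two form \<open>x \<otimes> y - y \<otimes> x\<close> contain the same covector twice, so that
  antisymmetrization annihilates their product.
\<close>

lemma antisymmetrized_rank_two:
  fixes x y :: "nat \<Rightarrow> real"
  assumes kl: "k < n" "l < n" "k \<noteq> l"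
    and R: "\<And>\<sigma> a b. \<sigma> permutes {..<2 * n} \<Longrightarrow> a \<in> {2 * k, Suc (2 * k)} \<Longrightarrow> b \<in> {2 * l, Suc (2 * l)} \<Longrightarrow>
        R (\<sigma> \<circ> Transposition.transpose a b) = (R \<sigma> :: real)"
  shows "(\<Sum>\<sigma> | \<sigma> permutes {..<2 * n}. of_int (sign \<sigma>) *
      ((x (\<sigma> (2 * k)) * y (\<sigma> (Suc (2 * k))) - y (\<sigma> (2 * k)) * x (\<sigma> (Suc (2 * k)))) *
       (x (\<sigma> (2 * l)) * y (\<sigma> (Suc (2 * l))) - y (\<sigma> (2 * l)) * x (\<sigma> (Suc (2 * l)))) * R \<sigma>)) = 0"
    (is "?lhs = 0")
proof -
  let ?a = "2 * k" and ?b = "Suc (2 * k)" and ?d = "2 * l" and ?e = "Suc (2 * l)"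
  let ?S = "{\<sigma>. \<sigma> permutes {..<2 * n}}"
  let ?t1 = "\<lambda>\<sigma>. x (\<sigma> ?a) * y (\<sigma> ?b) * x (\<sigma> ?d) * y (\<sigma> ?e) * R \<sigma>"
  let ?t2 = "\<lambda>\<sigma>. x (\<sigma> ?a) * y (\<sigma> ?b) * y (\<sigma> ?d) * x (\<sigma> ?e) * R \<sigma>"
  let ?t3 = "\<lambda>\<sigma>. y (\<sigma> ?a) * x (\<sigma> ?b) * x (\<sigma> ?d) * y (\<sigma> ?e) * R \<sigma>"
  let ?t4 = "\<lambda>\<sigma>. y (\<sigma> ?a) * x (\<sigma> ?b) * y (\<sigma> ?d) * x (\<sigma> ?e) * R \<sigma>"
  have z1: "(\<Sum>\<sigma>\<in>?S. of_int (sign \<sigma>) * ?t1 \<sigma>) = 0"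
    by (rule sum_permutes_sign_eq_0[where i = ?a and j = ?d])
      (use kl in \<open>simp_all add: R even_neq_odd\<close>)
  have z2: "(\<Sum>\<sigma>\<in>?S. of_int (sign \<sigma>) * ?t2 \<sigma>) = 0"
    by (rule sum_permutes_sign_eq_0[where i = ?a and j = ?e])
      (use kl in \<open>simp_all add: R even_neq_odd\<close>)
  have z3: "(\<Sum>\<sigma>\<in>?S. of_int (sign \<sigma>) * ?t3 \<sigma>) = 0"
    by (rule sum_permutes_sign_eq_0[where i = ?b and j = ?d])
      (use kl in \<open>simp_all add: R even_neq_odd\<close>)
  have z4: "(\<Sum>\<sigma>\<in>?S. of_int (sign \<sigma>) * ?t4 \<sigma>) = 0"
    by (rule sum_permutes_sign_eq_0[where i = ?b and j = ?e])
      (use kl in \<open>simp_all add: R even_neq_odd\<close>)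
  have "?lhs = (\<Sum>\<sigma>\<in>?S. of_int (sign \<sigma>) * ?t1 \<sigma> - of_int (sign \<sigma>) * ?t2 \<sigma>
      - of_int (sign \<sigma>) * ?t3 \<sigma> + of_int (sign \<sigma>) * ?t4 \<sigma>)"
    by (intro sum.cong refl) (simp add: algebra_simps)
  also have "\<dots> = 0"
    by (simp only: sum.distrib sum_subtractf z1 z2 z3 z4)
  finally show ?thesis .
qed

text \<open>The Pfaffian analogue of the determinant formula for a rank-one update. The product is
  expanded over the set \<open>A\<close> of positions that take their factor from \<open>X\<close>.
  Sets with at least two elements cancel by antisymmetry; singletons yield the sum of
  \<open>X\<close> over the symplectic pairs.\<close>

lemma pfaffian_rank_two_update:
  fixes x y :: "nat \<Rightarrow> real" and c :: real
  defines "X \<equiv> \<lambda>a b. c * (x a * y b - y a * x b)"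
  shows "(\<Sum>\<sigma> | \<sigma> permutes {..<2 * n}. of_int (sign \<sigma>) *
      (\<Prod>k<n. std_sympl (\<sigma> (2 * k)) (\<sigma> (Suc (2 * k))) + X (\<sigma> (2 * k)) (\<sigma> (Suc (2 * k))))) =
    (\<Sum>\<sigma> | \<sigma> permutes {..<2 * n}. pfaff_term n \<sigma>) * (1 + (\<Sum>j<n. X (2 * j) (Suc (2 * j))))"
    (is "?lhs = ?D * _")
proof -
  let ?S = "{\<sigma>. \<sigma> permutes {..<2 * n}}"
  let ?J = "\<lambda>\<sigma> k. std_sympl (\<sigma> (2 * k)) (\<sigma> (Suc (2 * k)))"
  let ?X = "\<lambda>\<sigma> k. X (\<sigma> (2 * k)) (\<sigma> (Suc (2 * k)))"
  define G where "G A = (\<Sum>\<sigma>\<in>?S. of_int (sign \<sigma>) * ((\<Prod>k\<in>A. ?X \<sigma> k) * (\<Prod>k\<in>{..<n} - A. ?J \<sigma> k)))" for A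
  have "?lhs = (\<Sum>\<sigma>\<in>?S. \<Sum>A\<in>Pow {..<n}. of_int (sign \<sigma>) * ((\<Prod>k\<in>A. ?X \<sigma> k) * (\<Prod>k\<in>{..<n} - A. ?J \<sigma> k)))"
    by (simp add: prod_add add.commute[of "std_sympl _ _"] sum_distrib_left)
  also have "\<dots> = (\<Sum>A\<in>Pow {..<n}. G A)"
    unfolding G_def by (rule sum.swap)
  also have "\<dots> = (\<Sum>A\<in>insert {} ((\<lambda>k. {k}) ` {..<n}). G A)"
  proof (rule sum.mono_neutral_right)
    show "\<forall>A\<in>Pow {..<n} - insert {} ((\<lambda>k. {k}) ` {..<n}). G A = 0"
    proof
      fix A assume A: "A \<in> Pow {..<n} - insert {} ((\<lambda>k. {k}) ` {..<n})"
      then obtain k where k: "k \<in> A" by blast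
      with A have "A \<noteq> {k}" by blast
      with k obtain l where l: "l \<in> A" "l \<noteq> k" by blast
      have lt: "k < n" "l < n" using k l A by auto
      have fin: "finite A" using A finite_subset by blast
      \<comment> \<open>All factors away from the positions \<open>k\<close> and \<open>l\<close>,
        with the two constants \<open>c\<close> that these positions contribute.\<close>
      let ?R = "\<lambda>\<sigma>. c\<^sup>2 * ((\<Prod>j\<in>A - {k} - {l}. ?X \<sigma> j) * (\<Prod>j\<in>{..<n} - A. ?J \<sigma> j))"
      have "G A = (\<Sum>\<sigma>\<in>?S. of_int (sign \<sigma>) *
        ((x (\<sigma> (2 * k)) * y (\<sigma> (Suc (2 * k))) - y (\<sigma> (2 * k)) * x (\<sigma> (Suc (2 * k)))) *
         (x (\<sigma> (2 * l)) * y (\<sigma> (Suc (2 * l))) - y (\<sigma> (2 * l)) * x (\<sigma> (Suc (2 * l)))) * ?R \<sigma>))"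
        unfolding G_def
      proof (intro sum.cong refl)
        fix \<sigma>
        have "(\<Prod>j\<in>A. ?X \<sigma> j) = ?X \<sigma> k * (?X \<sigma> l * (\<Prod>j\<in>A - {k} - {l}. ?X \<sigma> j))"
          using prod.remove[OF fin k, of "?X \<sigma>"] prod.remove[of "A - {k}" l "?X \<sigma>"] fin l by simp
        then show "of_int (sign \<sigma>) * ((\<Prod>k\<in>A. ?X \<sigma> k) * (\<Prod>k\<in>{..<n} - A. ?J \<sigma> k)) = of_int (sign \<sigma>) *
          ((x (\<sigma> (2 * k)) * y (\<sigma> (Suc (2 * k))) - y (\<sigma> (2 * k)) * x (\<sigma> (Suc (2 * k)))) *
           (x (\<sigma> (2 * l)) * y (\<sigma> (Suc (2 * l))) - y (\<sigma> (2 * l)) * x (\<sigma> (Suc (2 * l)))) * ?R \<sigma>)"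
          by (simp add: X_def power2_eq_square)
      qed
      also have "\<dots> = 0"
      proof (rule antisymmetrized_rank_two[OF lt])
        fix \<sigma> :: "nat \<Rightarrow> nat" and a b
        assume ab: "a \<in> {2 * k, Suc (2 * k)}" "b \<in> {2 * l, Suc (2 * l)}"
        have t: "Transposition.transpose a b (2 * j) = 2 * j"
            "Transposition.transpose a b (Suc (2 * j)) = Suc (2 * j)" if "j \<noteq> k" "j \<noteq> l" for j
          using ab that by (auto simp: Transposition.transpose_def even_neq_odd)
        have "?J (\<sigma> \<circ> Transposition.transpose a b) j = ?J \<sigma> j"
          "?X (\<sigma> \<circ> Transposition.transpose a b) j = ?X \<sigma> j" if "j \<noteq> k" "j \<noteq> l" for j
          using t[OF that] by simp_all
        moreover have "j \<noteq> k \<and> j \<noteq> l" if "j \<in> {..<n} - A" for j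
          using that k l by auto
        ultimately show "?R (\<sigma> \<circ> Transposition.transpose a b) = ?R \<sigma>"
          by (intro arg_cong2[where f = times] prod.cong refl) blast+
      qed (use l in auto)
      finally show "G A = 0" .
    qed
  qed auto
  also have "\<dots> = G {} + (\<Sum>k<n. G {k})"
    by (subst sum.insert) (auto simp: sum.reindex inj_on_def)
  also have "G {} = ?D"
    by (simp add: G_def pfaff_term_def)
  also have "(\<Sum>k<n. G {k}) = ?D * (\<Sum>j<n. X (2 * j) (Suc (2 * j)))"
  proof -
    \<comment> \<open>On a symplectic pair the antisymmetric \<open>X\<close> is a multiple of
      \<open>std_sympl\<close>; \<open>\<xi>\<close> is this multiple, the same for both members of
      the pair.\<close>
    define \<xi> where "\<xi> a = X (2 * (a div 2)) (Suc (2 * (a div 2)))" for a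
    have \<xi>: "X a (partner a) = std_sympl a (partner a) * \<xi> a" for a
      by (auto simp: \<xi>_def X_def partner_def std_sympl_def algebra_simps elim!: evenE oddE)
    have "G {k} = (\<Sum>\<sigma>\<in>?S. pfaff_term n \<sigma> * \<xi> (\<sigma> (2 * k)))" if k: "k < n" for k
      unfolding G_def
    proof (intro sum.cong refl)
      fix \<sigma> assume "\<sigma> \<in> ?S"
      then have s: "\<sigma> permutes {..<2 * n}" by simp
      have p: "(\<Prod>j<n. ?J \<sigma> j) = ?J \<sigma> k * (\<Prod>j\<in>{..<n} - {k}. ?J \<sigma> j)"
        using k by (intro prod.remove) auto
      show "of_int (sign \<sigma>) * ((\<Prod>k\<in>{k}. ?X \<sigma> k) * (\<Prod>k\<in>{..<n} - {k}. ?J \<sigma> k)) =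
          pfaff_term n \<sigma> * \<xi> (\<sigma> (2 * k))"
      proof (cases "(\<Prod>j\<in>{..<n} - {k}. ?J \<sigma> j) = 0")
        case False
        then have "?J \<sigma> j \<noteq> 0" if "j < n" "j \<noteq> k" for j
          using that by (auto simp: prod_zero_iff)
        \<comment> \<open>All other factors are nonzero, so the other positions hold complete pairs
          and position \<open>k\<close> must as well. This is what lets \<open>X\<close> be replaced
          by \<open>\<xi>\<close> times \<open>std_sympl\<close>.\<close>
        then have "\<sigma> (Suc (2 * k)) = partner (\<sigma> (2 * k))"
          by (intro forced_partner[OF s k]) (simp add: std_sympl_nonzero_iff)
        then show ?thesis
          unfolding pfaff_term_def p using \<xi>[of "\<sigma> (2 * k)"] by simp
      qed (simp add: pfaff_term_def p)
    qed
    then have "(\<Sum>k<n. G {k}) = (\<Sum>\<sigma>\<in>?S. pfaff_term n \<sigma> * (\<Sum>k<n. \<xi> (\<sigma> (2 * k))))"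
      by (simp add: sum_distrib_left sum.swap[of _ ?S])
    also have "\<dots> = (\<Sum>\<sigma>\<in>?S. pfaff_term n \<sigma> * (\<Sum>j<n. X (2 * j) (Suc (2 * j))))"
    proof (intro sum.cong refl)
      fix \<sigma> assume "\<sigma> \<in> ?S"
      then have s: "\<sigma> permutes {..<2 * n}" by simp
      show "pfaff_term n \<sigma> * (\<Sum>k<n. \<xi> (\<sigma> (2 * k))) = pfaff_term n \<sigma> * (\<Sum>j<n. X (2 * j) (Suc (2 * j)))"
      proof (cases "pfaff_term n \<sigma> = 0")
        case False
        then have "?J \<sigma> j \<noteq> 0" if "j < n" for j
          using that by (auto simp: pfaff_term_def prod_zero_iff)
        then have "\<xi> (\<sigma> (Suc (2 * j))) = \<xi> (\<sigma> (2 * j))" if "j < n" for j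
          using that by (simp add: std_sympl_nonzero_iff \<xi>_def)
        \<comment> \<open>Counting both members of each pair doubles the sum and makes it run over
          all indices, where \<open>\<sigma>\<close> is only a reordering.\<close>
        then have "2 * (\<Sum>k<n. \<xi> (\<sigma> (2 * k))) = (\<Sum>i<2 * n. \<xi> (\<sigma> i))"
          unfolding sum_even_odd by (simp add: sum_distrib_left)
        also have "\<dots> = (\<Sum>i<2 * n. \<xi> i)"
          using sum.permute[OF s, of \<xi>] by (simp add: o_def)
        also have "\<dots> = 2 * (\<Sum>j<n. X (2 * j) (Suc (2 * j)))"
          unfolding sum_even_odd by (simp add: sum_distrib_left \<xi>_def)
        finally show ?thesis by simp
      qed simp
    qed
    finally show ?thesis by (simp add: sum_distrib_right)
  qed
  finally show ?thesis by (simp add: algebra_simps)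
qed

section \<open>The Fubini-Study form in affine coordinates\<close>

lemma cnorm2_line:
  assumes "j < n"
  shows "cnorm2 n (cadd w (cscale (of_real t) (axis_vec j e))) =
    cnorm2 n w + 2 * t * Re (cnj (w j) * e) + t\<^sup>2 * (cmod e)\<^sup>2"
proof -
  have "cnorm2 n (cadd w (cscale (of_real t) (axis_vec j e))) =
      (\<Sum>k<n. (cmod (w k))\<^sup>2 + (if k = j then 2 * t * Re (cnj (w k) * e) + t\<^sup>2 * (cmod e)\<^sup>2 else 0))"
    unfolding cnorm2_def
    by (intro sum.cong refl)
      (auto simp: cadd_def cscale_def axis_vec_def cmod_power2, simp add: power2_eq_square algebra_simps)
  then show ?thesis
    using assms by (simp add: sum.distrib cnorm2_def)
qed

lemma cnorm2_nonneg: "cnorm2 n w \<ge> 0"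
  by (simp add: cnorm2_def sum_nonneg)

text \<open>By \<open>cnorm2_line\<close> the squared norm is a quadratic polynomial of the real
  parameter along a coordinate line; its linear coefficient determines the derivative.\<close>

lemma dir_deriv_log_cnorm2:
  assumes "j < n"
  shows "dir_deriv (axis_vec j e) (\<lambda>w. complex_of_real (ln (1 + cnorm2 n w))) w =
    of_real (2 * Re (cnj (w j) * e) / (1 + cnorm2 n w))"
proof -
  have pos: "1 + cnorm2 n w > 0"
    using cnorm2_nonneg[of n w] by linarith
  have "((\<lambda>t. ln (1 + cnorm2 n (cadd w (cscale (of_real t) (axis_vec j e)))))
      has_field_derivative 2 * Re (cnj (w j) * e) / (1 + cnorm2 n w)) (at 0)"
    unfolding cnorm2_line[OF assms] using pos
    by (auto intro!: derivative_eq_intros simp: field_simps)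
  then show ?thesis
    unfolding dir_deriv_def
    by (intro vector_derivative_at has_vector_derivative_of_real)
      (simp add: has_real_derivative_iff_has_vector_derivative)
qed

lemma wirt_bar_log_cnorm2:
  assumes "k < n"
  shows "wirt_bar k (\<lambda>w. complex_of_real (ln (1 + cnorm2 n w))) =
    (\<lambda>w. w k / of_real (1 + cnorm2 n w))"
proof
  fix w
  let ?a = "complex_of_real (2 * Re (cnj (w k) * 1))" and ?b = "complex_of_real (2 * Re (cnj (w k) * \<i>))"
  let ?T = "complex_of_real (1 + cnorm2 n w)"
  have "(?a / ?T + \<i> * (?b / ?T)) / 2 = (?a + \<i> * ?b) / ?T / 2"
    by (simp only: add_divide_distrib times_divide_eq_right)
  also have "?a + \<i> * ?b = 2 * w k"
    by (simp add: complex_eq_iff)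
  also have "2 * w k / ?T / 2 = w k / ?T"
    by (simp only: divide_divide_eq_left' divide_divide_eq_left mult.commute[of ?T]
        mult_divide_mult_cancel_left_if) simp
  finally show "wirt_bar k (\<lambda>w. complex_of_real (ln (1 + cnorm2 n w))) w = w k / ?T"
    unfolding wirt_bar_def dir_deriv_log_cnorm2[OF assms] of_real_divide .
qed

lemma wirt_quotient_cnorm2:
  assumes "j < n"
  shows "wirt j (\<lambda>w. w k / of_real (1 + cnorm2 n w)) w =
    (if j = k then 1 else 0) / of_real (1 + cnorm2 n w)
      - cnj (w j) * w k / (of_real (1 + cnorm2 n w))\<^sup>2"
proof -
  define T where "T = 1 + cnorm2 n w"
  have pos: "T > 0"
    using cnorm2_nonneg[of n w] unfolding T_def by linarith
  have d: "dir_deriv (axis_vec j e) (\<lambda>w. w k / of_real (1 + cnorm2 n w)) w =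
      (if j = k then e else 0) / of_real T - w k * of_real (2 * Re (cnj (w j) * e)) / (of_real T)\<^sup>2" for e
  proof -
    let ?g = "\<lambda>t. T + 2 * t * Re (cnj (w j) * e) + t\<^sup>2 * (cmod e)\<^sup>2"
    let ?a = "if j = k then e else 0"
    have g: "(?g has_field_derivative 2 * Re (cnj (w j) * e)) (at 0)"
      by (auto intro!: derivative_eq_intros)
    have "((\<lambda>t. inverse (?g t)) has_field_derivative - (2 * Re (cnj (w j) * e)) / T\<^sup>2) (at 0)"
      using pos by (auto intro!: derivative_eq_intros simp: field_simps power2_eq_square)
    then have i: "((\<lambda>t. complex_of_real (inverse (?g t))) has_vector_derivative
        of_real (- (2 * Re (cnj (w j) * e)) / T\<^sup>2)) (at 0)"
      by (intro has_vector_derivative_of_real) (simp add: has_real_derivative_iff_has_vector_derivative)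
    have l: "((\<lambda>t. w k + of_real t * ?a) has_vector_derivative ?a) (at 0)"
      by (auto intro!: derivative_eq_intros has_vector_derivative_of_real)
    have "((\<lambda>t. (w k + of_real t * ?a) * of_real (inverse (?g t))) has_vector_derivative
        (w k * of_real (- (2 * Re (cnj (w j) * e)) / T\<^sup>2) + ?a * of_real (inverse T))) (at 0)"
      using has_vector_derivative_mult[OF l i] by simp
    then have D: "((\<lambda>t. (w k + of_real t * ?a) * of_real (inverse (?g t))) has_vector_derivative
        ?a / of_real T - w k * of_real (2 * Re (cnj (w j) * e)) / (of_real T)\<^sup>2) (at 0)"
      by (rule back_subst[where P = "\<lambda>x. (_ has_vector_derivative x) _"])
        (simp add: divide_inverse algebra_simps)
    have F: "(\<lambda>t. cadd w (cscale (of_real t) (axis_vec j e)) k /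
        of_real (1 + cnorm2 n (cadd w (cscale (of_real t) (axis_vec j e))))) =
        (\<lambda>t. (w k + of_real t * ?a) * of_real (inverse (?g t)))"
      unfolding cnorm2_line[OF assms] T_def
      by (auto simp: cadd_def cscale_def axis_vec_def divide_inverse add.assoc)
    show ?thesis
      unfolding dir_deriv_def F by (rule vector_derivative_at[OF D])
  qed
  let ?A = "complex_of_real (2 * Re (cnj (w j) * 1))" and ?B = "complex_of_real (2 * Re (cnj (w j) * \<i>))"
  have AB: "?A - \<i> * ?B = 2 * cnj (w j)"
    by (simp add: complex_eq_iff)
  have "w k * ?A - \<i> * (w k * ?B) = w k * (?A - \<i> * ?B)"
    by (simp only: right_diff_distrib mult.left_commute[of "\<i>"])
  also have "\<dots> = 2 * (cnj (w j) * w k)"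
    unfolding AB by (simp only: mult_ac)
  finally have "w k * ?A - \<i> * (w k * ?B) = 2 * (cnj (w j) * w k)" .
  then have e: "w k * complex_of_real (2 * Re (cnj (w j) * 1)) =
      2 * (cnj (w j) * w k) + \<i> * (w k * of_real (2 * Re (cnj (w j) * \<i>)))"
    by (simp add: algebra_simps)
  have nz: "complex_of_real T \<noteq> 0"
    using pos by simp
  show ?thesis
    unfolding wirt_def d T_def[symmetric] e using nz
    by (simp add: field_simps power2_eq_square)
qed

text \<open>The complex Hessian of the potential is the identity over \<open>T\<close> minus a
  rank-one hermitian matrix over \<open>T\<^sup>2\<close>. The factors 2 arise because
  \<open>ddbar\<close> antisymmetrizes in \<open>u\<close> and \<open>v\<close> without a factor
  1/2.\<close>

lemma fubini_study_eq:
  fixes n u v w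
  defines "T \<equiv> 1 + cnorm2 n w"
  defines "\<theta> \<equiv> \<lambda>u. cinner n w u"
  shows "fubini_study n c w u v =
    2 / T * Im (cinner n u v) + 2 / T\<^sup>2 * Im (\<theta> u * cnj (\<theta> v))"
proof -
  have "ddbar n (\<lambda>w. complex_of_real (ln (1 + cnorm2 n w))) w u v =
      (\<Sum>j<n. \<Sum>k<n. (if j = k then (u j * cnj (v k) - v j * cnj (u k)) / of_real T else 0)
        - ((cnj (w j) * u j) * cnj (cnj (w k) * v k) - (cnj (w j) * v j) * cnj (cnj (w k) * u k)) / (of_real T)\<^sup>2)"
    unfolding ddbar_def
  proof (intro sum.cong refl)
    fix j k assume j: "j \<in> {..<n}" and k: "k \<in> {..<n}"
    have h: "wirt j (wirt_bar k (\<lambda>w. complex_of_real (ln (1 + cnorm2 n w)))) w =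
      (if j = k then 1 else 0) / of_real T - cnj (w j) * w k / (of_real T)\<^sup>2"
      using wirt_bar_log_cnorm2[of k n] wirt_quotient_cnorm2[of j n k w] j k unfolding T_def by simp
    show "wirt j (wirt_bar k (\<lambda>w. complex_of_real (ln (1 + cnorm2 n w)))) w *
        (u j * cnj (v k) - v j * cnj (u k)) =
        (if j = k then (u j * cnj (v k) - v j * cnj (u k)) / of_real T else 0)
        - ((cnj (w j) * u j) * cnj (cnj (w k) * v k) - (cnj (w j) * v j) * cnj (cnj (w k) * u k)) / (of_real T)\<^sup>2"
      unfolding h by (simp add: algebra_simps diff_divide_distrib)
  qed
  also have "\<dots> = (\<Sum>j<n. u j * cnj (v j) - v j * cnj (u j)) / of_real T
      - (\<theta> u * cnj (\<theta> v) - \<theta> v * cnj (\<theta> u)) / (of_real T)\<^sup>2"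
    unfolding \<theta>_def cinner_def cnj_sum sum_product
    by (simp add: sum_subtractf sum_divide_distrib diff_divide_distrib)
  also have "(\<Sum>j<n. u j * cnj (v j) - v j * cnj (u j)) = - 2 * \<i> * of_real (Im (cinner n u v))"
    unfolding cinner_def Im_sum of_real_sum sum_distrib_left
    by (intro sum.cong refl) (simp add: complex_eq_iff)
  also have "\<theta> u * cnj (\<theta> v) - \<theta> v * cnj (\<theta> u) = 2 * \<i> * of_real (Im (\<theta> u * cnj (\<theta> v)))"
    by (simp add: complex_eq_iff)
  finally show ?thesis
    unfolding fubini_study_def by (simp add: Re_divide_of_real flip: of_real_power)
qed

lemma cinner_axis_right: "j < n \<Longrightarrow> cinner n w (axis_vec j e) = cnj (w j) * e"
  using sum.delta[of "{..<n}" j "\<lambda>k. cnj (w k) * e"]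
  by (simp add: cinner_def axis_vec_def if_distrib[of "\<lambda>x. _ * x"] cong: if_cong)

text \<open>On the real basis the form is \<open>2 / T\<close> times \<open>std_sympl\<close> plus a
  rank-two term. The powers of 2 cancel against the normalization of \<open>wedge_power\<close>, the
  scalar factors leave \<open>1 / T ^ n\<close>, and the rank-two update supplies one more
  \<open>1 / T\<close>.\<close>

lemma liouville_density_fubini_study:
  obtains K where "K > 0"
    "\<And>c w. liouville_density n (fubini_study n c w) = K / (1 + cnorm2 n w) ^ Suc n"
proof
  let ?D = "\<Sum>\<sigma> | \<sigma> permutes {..<2 * n}. pfaff_term n \<sigma>"
  show "?D / fact n > 0"
    using pfaff_term_sum_pos[of n] by simp
  fix c w
  let ?T = "1 + cnorm2 n w"
  have T: "?T > 0"
    using cnorm2_nonneg[of n w] by linarith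
  define e :: "nat \<Rightarrow> complex" where "e k = (if even k then 1 else \<i>)" for k
  \<comment> \<open>Real and imaginary part of the linear form \<open>cinner n w\<close> on the real
    basis: the two covectors that span the rank-two term.\<close>
  define x y where "x a = Re (cnj (w (a div 2)) * e a)" and "y a = Im (cnj (w (a div 2)) * e a)" for a
  let ?X = "\<lambda>a b. - 1 / ?T * (x a * y b - y a * x b)"
  have form: "fubini_study n c w (axis_vec (a div 2) (e a)) (axis_vec (b div 2) (e b)) =
      2 / ?T * (std_sympl a b + ?X a b)" if "a < 2 * n" "b < 2 * n" for a b
  proof -
    have ab: "a div 2 < n" "b div 2 < n"
      using that by auto
    have i1: "Im (cinner n (axis_vec (a div 2) (e a)) (axis_vec (b div 2) (e b))) = std_sympl a b"
      unfolding cinner_axis_right[OF ab(2)]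
      by (auto simp: axis_vec_def e_def std_sympl_def elim!: evenE oddE)
    have i2: "Im (cinner n w (axis_vec (a div 2) (e a)) * cnj (cinner n w (axis_vec (b div 2) (e b)))) =
        y a * x b - x a * y b"
      unfolding cinner_axis_right[OF ab(1)] cinner_axis_right[OF ab(2)] x_def y_def
      by (simp del: complex_cnj_mult, simp add: algebra_simps)
    show ?thesis
      unfolding fubini_study_eq i1 i2
      by (simp add: power2_eq_square algebra_simps diff_divide_distrib)
  qed
  have "wedge_power n (fubini_study n c w) (\<lambda>k. axis_vec (k div 2) (e k)) =
      1 / 2 ^ n * (\<Sum>\<sigma> | \<sigma> permutes {..<2 * n}. of_int (sign \<sigma>) *
        ((2 / ?T) ^ n * (\<Prod>k<n. std_sympl (\<sigma> (2 * k)) (\<sigma> (Suc (2 * k))) + ?X (\<sigma> (2 * k)) (\<sigma> (Suc (2 * k))))))"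
    unfolding wedge_power_def
  proof (intro arg_cong2[where f = times] sum.cong refl)
    fix \<sigma> assume "\<sigma> \<in> {\<sigma>. \<sigma> permutes {..<2 * n}}"
    then have s: "\<sigma> permutes {..<2 * n}" by simp
    have lt: "\<sigma> (2 * k) < 2 * n" "\<sigma> (2 * k + 1) < 2 * n" if "k < n" for k
      using permutes_in_image[OF s, of "2 * k"] permutes_in_image[OF s, of "2 * k + 1"] that by auto
    have "(\<Prod>k<n. fubini_study n c w (axis_vec (\<sigma> (2 * k) div 2) (e (\<sigma> (2 * k))))
          (axis_vec (\<sigma> (2 * k + 1) div 2) (e (\<sigma> (2 * k + 1))))) =
        (\<Prod>k<n. 2 / ?T * (std_sympl (\<sigma> (2 * k)) (\<sigma> (2 * k + 1)) + ?X (\<sigma> (2 * k)) (\<sigma> (2 * k + 1))))"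
      using form lt by (intro prod.cong refl) auto
    also have "\<dots> = (2 / ?T) ^ n * (\<Prod>k<n. std_sympl (\<sigma> (2 * k)) (\<sigma> (Suc (2 * k))) + ?X (\<sigma> (2 * k)) (\<sigma> (Suc (2 * k))))"
      unfolding prod.distrib by simp
    finally show "(\<Prod>k<n. fubini_study n c w (axis_vec (\<sigma> (2 * k) div 2) (e (\<sigma> (2 * k))))
          (axis_vec (\<sigma> (2 * k + 1) div 2) (e (\<sigma> (2 * k + 1))))) = \<dots>" .
  qed
  also have "\<dots> = 1 / ?T ^ n * (\<Sum>\<sigma> | \<sigma> permutes {..<2 * n}. of_int (sign \<sigma>) *
        (\<Prod>k<n. std_sympl (\<sigma> (2 * k)) (\<sigma> (Suc (2 * k))) + ?X (\<sigma> (2 * k)) (\<sigma> (Suc (2 * k)))))"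
    by (simp add: sum_distrib_left power_divide mult.left_commute)
  also have "\<dots> = 1 / ?T ^ n * (?D * (1 + (\<Sum>j<n. ?X (2 * j) (Suc (2 * j)))))"
    unfolding pfaffian_rank_two_update ..
  \<comment> \<open>On e_j and i e_j the form \<open>cinner n w\<close> takes the values
    \<open>cnj (w j)\<close> and \<open>\<i> * cnj (w j)\<close>; the determinant of their real and
    imaginary parts is the squared modulus of \<open>w j\<close>.\<close>
  also have "(\<Sum>j<n. ?X (2 * j) (Suc (2 * j))) = (\<Sum>j<n. - 1 / ?T * (cmod (w j))\<^sup>2)"
    by (intro sum.cong refl arg_cong2[where f = times])
      (simp add: x_def y_def e_def cmod_power2, simp add: power2_eq_square)
  also have "\<dots> = - 1 / ?T * cnorm2 n w"
    by (simp only: cnorm2_def sum_distrib_left)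
  \<comment> \<open>This raises the exponent from \<open>n\<close> to \<open>Suc n\<close>.\<close>
  also have "1 + - 1 / ?T * cnorm2 n w = 1 / ?T"
    using T by (simp add: field_simps)
  finally show "liouville_density n (fubini_study n c w) = ?D / fact n / ?T ^ Suc n"
    unfolding liouville_density_def e_def by (simp add: field_simps)
qed

section \<open>The unit ball in affine coordinates\<close>

lemma borel_measurable_Complex [measurable]:
  assumes [measurable]: "f \<in> borel_measurable M" "g \<in> borel_measurable M"
  shows "(\<lambda>x. Complex (f x) (g x)) \<in> borel_measurable M"
  unfolding Complex_eq by measurable

text \<open>Lebesgue measure is determined by boxes. Seen as area measure, it admits iterated
  integration and the affine substitution rule on the real line.\<close>

lemma lborel_complex: "(lborel :: complex measure) =
    distr (lborel \<Otimes>\<^sub>M lborel) borel (\<lambda>(x, y). Complex x y)" (is "_ = ?M")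
proof (rule lborel_eqI)
  fix l u :: complex assume "\<And>b. b \<in> Basis \<Longrightarrow> l \<bullet> b \<le> u \<bullet> b"
  from this[of 1] this[of \<i>] have le: "Re l \<le> Re u" "Im l \<le> Im u"
    by (auto simp: Basis_complex_def)
  have "(\<lambda>(x, y). Complex x y) -` box l u \<inter> space (lborel \<Otimes>\<^sub>M lborel) =
      box (Re l) (Re u) \<times> box (Im l) (Im u)"
    by (auto simp: mem_box Basis_complex_def space_pair_measure)
  then have "emeasure ?M (box l u) = emeasure (lborel \<Otimes>\<^sub>M lborel) (box (Re l) (Re u) \<times> box (Im l) (Im u))"
    by (subst emeasure_distr) (simp_all, measurable)
  also have "\<dots> = ennreal (Re u - Re l) * ennreal (Im u - Im l)"
    using le by (subst lborel.emeasure_pair_measure_Times) simp_all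
  also have "\<dots> = ennreal (\<Prod>b\<in>Basis. (u - l) \<bullet> b)"
    using le by (simp add: Basis_complex_def ennreal_mult)
  finally show "emeasure ?M (box l u) = \<dots>" .
qed simp

lemma nn_integral_lborel_complex:
  assumes [measurable]: "f \<in> borel_measurable borel"
  shows "(\<integral>\<^sup>+z. f z \<partial>lborel) = (\<integral>\<^sup>+x. \<integral>\<^sup>+y. f (Complex x y) \<partial>lborel \<partial>lborel)"
    "(\<integral>\<^sup>+z. f z \<partial>lborel) = (\<integral>\<^sup>+y. \<integral>\<^sup>+x. f (Complex x y) \<partial>lborel \<partial>lborel)"
proof -
  have "(\<integral>\<^sup>+z. f z \<partial>lborel) = (\<integral>\<^sup>+p. f (case p of (x, y) \<Rightarrow> Complex x y) \<partial>(lborel \<Otimes>\<^sub>M lborel))"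
    by (subst lborel_complex, subst nn_integral_distr) (simp_all add: case_prod_beta)
  then have p: "(\<integral>\<^sup>+z. f z \<partial>lborel) = (\<integral>\<^sup>+p. f (Complex (fst p) (snd p)) \<partial>(lborel \<Otimes>\<^sub>M lborel))"
    by (simp add: case_prod_beta)
  show "(\<integral>\<^sup>+z. f z \<partial>lborel) = (\<integral>\<^sup>+x. \<integral>\<^sup>+y. f (Complex x y) \<partial>lborel \<partial>lborel)"
    unfolding p by (subst lborel.nn_integral_fst[symmetric]) simp_all
  show "(\<integral>\<^sup>+z. f z \<partial>lborel) = (\<integral>\<^sup>+y. \<integral>\<^sup>+x. f (Complex x y) \<partial>lborel \<partial>lborel)"
    unfolding p by (subst lborel_pair.nn_integral_snd[symmetric]) simp_all
qed

text \<open>The factor is the determinant of multiplication by \<open>c\<close> as a real matrix.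
  Elimination reduces the substitution to two affine substitutions in one real variable.\<close>

lemma nn_integral_lborel_complex_mult:
  fixes f :: "complex \<Rightarrow> ennreal"
  assumes [measurable]: "f \<in> borel_measurable borel" and c: "c \<noteq> 0"
  shows "(\<integral>\<^sup>+z. f z \<partial>lborel) = ennreal ((cmod c)\<^sup>2) * (\<integral>\<^sup>+z. f (c * z) \<partial>lborel)"
proof -
  define a b where "a = Re c" and "b = Im c"
  have cn: "(cmod c)\<^sup>2 = a\<^sup>2 + b\<^sup>2"
    by (simp add: cmod_power2 a_def b_def)
  have mult: "c * Complex x y = Complex (a * x - b * y) (b * x + a * y)" for x y
    by (simp add: complex_eq_iff a_def b_def)
  have I: "(\<integral>\<^sup>+z. f (c * z) \<partial>lborel) =
      (\<integral>\<^sup>+y. \<integral>\<^sup>+x. f (Complex (a * x - b * y) (b * x + a * y)) \<partial>lborel \<partial>lborel)"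
    by (subst nn_integral_lborel_complex(2)) (simp_all add: mult)
  show ?thesis
  proof (cases "a = 0")
    case False
    \<comment> \<open>With \<open>y\<close> fixed, \<open>x\<close> is replaced by u = a x - b y;
      then, with \<open>u\<close> fixed, \<open>y\<close> by v = (b / a) u + d y. Comparison with v
      = b x + a y gives \<open>d\<close>, and \<open>a * d\<close> is the determinant.\<close>
    define d where "d = b\<^sup>2 / a + a"
    have ad: "\<bar>d\<bar> * \<bar>a\<bar> = a\<^sup>2 + b\<^sup>2"
      using False by (simp add: d_def abs_mult[symmetric] field_simps power2_eq_square)
    have d0: "d \<noteq> 0"
    proof
      assume "d = 0"
      then have "a\<^sup>2 + b\<^sup>2 = 0" using ad by simp
      then show False using False by (simp add: sum_power2_eq_zero_iff)
    qed
    have inner: "ennreal \<bar>a\<bar> * (\<integral>\<^sup>+x. f (Complex (a * x - b * y) (b * x + a * y)) \<partial>lborel) =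
        (\<integral>\<^sup>+u. f (Complex u (b / a * u + d * y)) \<partial>lborel)" for y
    proof -
      let ?g = "\<lambda>u. f (Complex u (b / a * u + d * y))"
      have "(\<integral>\<^sup>+u. ?g u \<partial>lborel) = ennreal \<bar>a\<bar> * (\<integral>\<^sup>+x. ?g (- (b * y) + a * x) \<partial>lborel)"
        by (rule nn_integral_real_affine[OF _ False]) simp
      moreover have "Complex (- (b * y) + a * x) (b / a * (- (b * y) + a * x) + d * y) =
          Complex (a * x - b * y) (b * x + a * y)" for x
        using False by (simp add: d_def field_simps power2_eq_square)
      ultimately show ?thesis by simp
    qed
    have "ennreal ((cmod c)\<^sup>2) * (\<integral>\<^sup>+z. f (c * z) \<partial>lborel) = ennreal \<bar>d\<bar> * (ennreal \<bar>a\<bar> *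
       (\<integral>\<^sup>+y. \<integral>\<^sup>+x. f (Complex (a * x - b * y) (b * x + a * y)) \<partial>lborel \<partial>lborel))"
      unfolding I cn ad[symmetric] by (simp add: ennreal_mult mult.assoc)
    also have "\<dots> = ennreal \<bar>d\<bar> * (\<integral>\<^sup>+y. \<integral>\<^sup>+u. f (Complex u (b / a * u + d * y)) \<partial>lborel \<partial>lborel)"
      by (subst nn_integral_cmult[symmetric]) (simp_all add: inner)
    also have "\<dots> = (\<integral>\<^sup>+u. ennreal \<bar>d\<bar> * (\<integral>\<^sup>+y. f (Complex u (b / a * u + d * y)) \<partial>lborel) \<partial>lborel)"
      by (subst lborel_pair.Fubini') (simp_all add: nn_integral_cmult)
    also have "\<dots> = (\<integral>\<^sup>+u. \<integral>\<^sup>+v. f (Complex u v) \<partial>lborel \<partial>lborel)"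
      by (intro nn_integral_cong nn_integral_real_affine[OF _ d0, symmetric]) simp
    finally show ?thesis
      by (simp add: nn_integral_lborel_complex(1))
  next
    case True
    \<comment> \<open>Multiplication by an imaginary number exchanges the real axes up to the
      factors \<open>b\<close> and \<open>- b\<close>.\<close>
    then have b0: "b \<noteq> 0" using c by (auto simp: a_def b_def complex_eq_iff)
    have "ennreal ((cmod c)\<^sup>2) * (\<integral>\<^sup>+z. f (c * z) \<partial>lborel) = ennreal \<bar>-b\<bar> * (ennreal \<bar>b\<bar> *
       (\<integral>\<^sup>+y. \<integral>\<^sup>+x. f (Complex (- b * y) (b * x)) \<partial>lborel \<partial>lborel))"
      unfolding I cn True by (simp add: ennreal_mult[symmetric] mult.assoc[symmetric] power2_eq_square)
    also have "\<dots> = ennreal \<bar>-b\<bar> * (\<integral>\<^sup>+y. ennreal \<bar>b\<bar> * (\<integral>\<^sup>+x. f (Complex (- b * y) (0 + b * x)) \<partial>lborel) \<partial>lborel)"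
      by (subst nn_integral_cmult[symmetric]) simp_all
    also have "\<dots> = ennreal \<bar>-b\<bar> * (\<integral>\<^sup>+y. (\<integral>\<^sup>+x. f (Complex (0 + (- b) * y) x) \<partial>lborel) \<partial>lborel)"
      by (subst nn_integral_real_affine[OF _ b0, where t = 0]) simp_all
    also have "\<dots> = (\<integral>\<^sup>+y. (\<integral>\<^sup>+x. f (Complex y x) \<partial>lborel) \<partial>lborel)"
      using b0 by (intro nn_integral_real_affine[symmetric]) simp_all
    finally show ?thesis
      by (simp add: nn_integral_lborel_complex(1))
  qed
qed

abbreviation lborel_vec :: "nat set \<Rightarrow> cvec measure" where
  "lborel_vec I \<equiv> Pi\<^sub>M I (\<lambda>_. lborel)"

text \<open>Rectangles determine a product measure, and each factor scales by the squared modulus of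
  its coefficient. The statement serves the passage to affine coordinates (scalings) as well as the
  symmetries of the ball (signs and permutations).\<close>

lemma lborel_vec_transform:
  assumes J: "finite J" and \<pi>: "bij_betw \<pi> J I" and c: "\<And>j. j \<in> J \<Longrightarrow> c j \<noteq> 0"
  shows "lborel_vec J = density (distr (lborel_vec I) (lborel_vec J) (\<lambda>x. \<lambda>j\<in>J. c j * x (\<pi> j)))
    (\<lambda>_. ennreal (\<Prod>j\<in>J. (cmod (c j))\<^sup>2))" (is "_ = ?D")
proof -
  have I: "finite I" using \<pi> J bij_betw_finite by blast
  have \<pi>I: "j \<in> J \<Longrightarrow> \<pi> j \<in> I" for j using \<pi> by (auto simp: bij_betw_def)
  define \<sigma> where "\<sigma> = inv_into J \<pi>"
  have \<sigma>: "\<sigma> i \<in> J" "\<pi> (\<sigma> i) = i" if "i \<in> I" for i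
    using \<pi> that unfolding \<sigma>_def by (auto simp: bij_betw_def inv_into_into f_inv_into_f)
  have \<sigma>\<pi>: "\<sigma> (\<pi> j) = j" if "j \<in> J" for j
    using \<pi> that unfolding \<sigma>_def by (auto simp: bij_betw_def)
  let ?T = "\<lambda>x. \<lambda>j\<in>J. c j * x (\<pi> j)"
  have [measurable]: "?T \<in> lborel_vec I \<rightarrow>\<^sub>M lborel_vec J"
    using \<pi>I by (intro measurable_restrict) auto
  show ?thesis
  proof (rule product_sigma_finite.PiM_eqI[OF product_sigma_finite_lborel, symmetric, OF J])
    fix A :: "nat \<Rightarrow> complex set" assume A: "\<And>j. j \<in> J \<Longrightarrow> A j \<in> sets lborel"
    let ?A = "\<lambda>j. {z. c j * z \<in> A j}"
    have A' [measurable]: "?A j \<in> sets lborel" if "j \<in> J" for j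
      using A[OF that] by measurable
    have e: "emeasure lborel (A j) = ennreal ((cmod (c j))\<^sup>2) * emeasure lborel (?A j)" if "j \<in> J" for j
    proof -
      have [measurable]: "A j \<in> sets borel" using A[OF that] by simp
      have "emeasure lborel (A j) = (\<integral>\<^sup>+z. indicator (A j) z \<partial>lborel)" by simp
      also have "\<dots> = ennreal ((cmod (c j))\<^sup>2) * (\<integral>\<^sup>+z. indicator (A j) (c j * z) \<partial>lborel)"
        by (intro nn_integral_lborel_complex_mult c that) simp
      also have "(\<integral>\<^sup>+z. indicator (A j) (c j * z) \<partial>lborel) = (\<integral>\<^sup>+z. indicator (?A j) z \<partial>lborel)"
        by (intro nn_integral_cong) (simp add: indicator_def)
      finally show ?thesis using A'[OF that] by simp
    qed
    have pre: "?T -` Pi\<^sub>E J A \<inter> space (lborel_vec I) = Pi\<^sub>E I (\<lambda>i. ?A (\<sigma> i))"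
    proof (intro set_eqI iffI)
      fix x assume x: "x \<in> ?T -` Pi\<^sub>E J A \<inter> space (lborel_vec I)"
      then have "c j * x (\<pi> j) \<in> A j" if "j \<in> J" for j
        using that by (auto simp: PiE_iff)
      from this[OF \<sigma>(1)] show "x \<in> Pi\<^sub>E I (\<lambda>i. ?A (\<sigma> i))"
        using x \<sigma>(2) by (auto simp: PiE_iff space_PiM)
    next
      fix x assume x: "x \<in> Pi\<^sub>E I (\<lambda>i. ?A (\<sigma> i))"
      then show "x \<in> ?T -` Pi\<^sub>E J A \<inter> space (lborel_vec I)"
        using \<pi>I \<sigma>\<pi> by (fastforce simp: PiE_iff space_PiM)
    qed
    have "emeasure ?D (Pi\<^sub>E J A) = ennreal (\<Prod>j\<in>J. (cmod (c j))\<^sup>2) * emeasure (lborel_vec I) (Pi\<^sub>E I (\<lambda>i. ?A (\<sigma> i)))"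
      using A J by (subst emeasure_density_const) (auto simp: emeasure_distr pre intro!: sets_PiM_I_finite)
    also have "emeasure (lborel_vec I) (Pi\<^sub>E I (\<lambda>i. ?A (\<sigma> i))) = (\<Prod>i\<in>I. emeasure lborel (?A (\<sigma> i)))"
      using A' \<sigma>(1) by (intro emeasure_PiM_lborel I) blast
    also have "\<dots> = (\<Prod>j\<in>J. emeasure lborel (?A j))"
      using \<sigma>\<pi> by (subst prod.reindex_bij_betw[OF \<pi>, symmetric]) simp
    also have "ennreal (\<Prod>j\<in>J. (cmod (c j))\<^sup>2) * \<dots> = (\<Prod>j\<in>J. emeasure lborel (A j))"
      by (simp add: e prod.distrib prod_ennreal)
    finally show "emeasure ?D (Pi\<^sub>E J A) = (\<Prod>j\<in>J. emeasure lborel (A j))" .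
  qed simp
qed

lemma measurable_lborel_vec_transform:
  assumes "\<And>j. j \<in> J \<Longrightarrow> \<pi> j \<in> I"
  shows "(\<lambda>x. \<lambda>j\<in>J. c j * x (\<pi> j)) \<in> lborel_vec I \<rightarrow>\<^sub>M lborel_vec J"
  using assms by (intro measurable_restrict) auto

lemma nn_integral_lborel_vec_transform:
  assumes J: "finite J" and \<pi>: "bij_betw \<pi> J I" and c: "\<And>j. j \<in> J \<Longrightarrow> c j \<noteq> 0"
    and g [measurable]: "g \<in> borel_measurable (lborel_vec J)"
  shows "(\<integral>\<^sup>+x. g x \<partial>lborel_vec J) =
    ennreal (\<Prod>j\<in>J. (cmod (c j))\<^sup>2) * (\<integral>\<^sup>+x. g (\<lambda>j\<in>J. c j * x (\<pi> j)) \<partial>lborel_vec I)"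
proof -
  have T [measurable]: "(\<lambda>x. \<lambda>j\<in>J. c j * x (\<pi> j)) \<in> lborel_vec I \<rightarrow>\<^sub>M lborel_vec J"
    using \<pi> by (intro measurable_lborel_vec_transform) (auto simp: bij_betw_def)
  let ?D = "distr (lborel_vec I) (lborel_vec J) (\<lambda>x. \<lambda>j\<in>J. c j * x (\<pi> j))"
  have "(\<integral>\<^sup>+x. g x \<partial>lborel_vec J) =
      (\<integral>\<^sup>+x. g x \<partial>density ?D (\<lambda>_. ennreal (\<Prod>j\<in>J. (cmod (c j))\<^sup>2)))"
    by (rule arg_cong[where f = "\<lambda>M. nn_integral M g", OF lborel_vec_transform[OF J \<pi> c]])
  also have "\<dots> = (\<integral>\<^sup>+x. ennreal (\<Prod>j\<in>J. (cmod (c j))\<^sup>2) * g x \<partial>?D)"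
    by (rule nn_integral_density) measurable
  also have "\<dots> = ennreal (\<Prod>j\<in>J. (cmod (c j))\<^sup>2) * (\<integral>\<^sup>+x. g x \<partial>?D)"
    by (rule nn_integral_cmult) measurable
  also have "(\<integral>\<^sup>+x. g x \<partial>?D) = (\<integral>\<^sup>+x. g (\<lambda>j\<in>J. c j * x (\<pi> j)) \<partial>lborel_vec I)"
    by (rule nn_integral_distr[OF T]) measurable
  finally show ?thesis .
qed

text \<open>For unimodular coefficients the density is 1, so the two measures coincide.\<close>

lemma integral_lborel_vec_transform:
  fixes g :: "cvec \<Rightarrow> complex"
  assumes J: "finite J" and \<pi>: "bij_betw \<pi> J I" and c: "\<And>j. j \<in> J \<Longrightarrow> cmod (c j) = 1"
    and [measurable]: "g \<in> borel_measurable (lborel_vec J)"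
  shows "(\<integral>x. g x \<partial>lborel_vec J) = (\<integral>x. g (\<lambda>j\<in>J. c j * x (\<pi> j)) \<partial>lborel_vec I)"
proof -
  have T [measurable]: "(\<lambda>x. \<lambda>j\<in>J. c j * x (\<pi> j)) \<in> lborel_vec I \<rightarrow>\<^sub>M lborel_vec J"
    using \<pi> by (intro measurable_lborel_vec_transform) (auto simp: bij_betw_def)
  have "c j \<noteq> 0" if "j \<in> J" for j using c[OF that] by auto
  then show ?thesis
    using c by (subst lborel_vec_transform[OF J \<pi>, of c])
      (simp_all add: density_1 integral_distr[OF T])
qed

lemma emeasure_ball_minus_0_pos:
  assumes "r > 0"
  shows "emeasure lborel (ball (0::complex) r - {0}) > 0"
proof -
  have "emeasure lborel (ball (0::complex) r - {0}) = emeasure lborel (ball (0::complex) r)"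
    by (intro emeasure_Diff_null_set) auto
  also have "\<dots> = ennreal (measure lborel (ball (0::complex) r))"
    using emeasure_lborel_ball_finite[of "0::complex" r] by (intro emeasure_eq_ennreal_measure) auto
  finally show ?thesis
    using assms by (simp add: content_ball_pos)
qed

section \<open>Integrating out one homogeneous coordinate\<close>

lemma measurable_cnorm2 [measurable]: "cnorm2 n \<in> borel_measurable (lborel_vec {..<n})"
  unfolding cnorm2_def[abs_def] by measurable

text \<open>Enumerates the indices different from \<open>a\<close> in increasing order, which is the
  order used by \<open>affine_coord\<close>.\<close>

definition skip :: "nat \<Rightarrow> nat \<Rightarrow> nat" where
  "skip a j = (if j < a then j else Suc j)"

text \<open>The affine coordinates as an element of the finite product: undefined from
  \<open>n\<close> on, where \<open>affine_coord\<close> is zero.\<close>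

definition affine_vec :: "nat \<Rightarrow> nat \<Rightarrow> cvec \<Rightarrow> cvec" where
  "affine_vec n a z = (\<lambda>j\<in>{..<n}. z (skip a j) / z a)"

lemma measurable_affine_vec [measurable]:
  assumes "a \<le> n"
  shows "affine_vec n a \<in> lborel_vec {..<Suc n} \<rightarrow>\<^sub>M lborel_vec {..<n}"
  unfolding affine_vec_def[abs_def]
proof (rule measurable_restrict)
  fix j assume "j \<in> {..<n}"
  then have [measurable]: "skip a j \<in> {..<Suc n}" "a \<in> {..<Suc n}"
    using assms by (auto simp: skip_def)
  show "(\<lambda>z. z (skip a j) / z a) \<in> lborel_vec {..<Suc n} \<rightarrow>\<^sub>M lborel"
    by measurable
qed

text \<open>The integral over the homogeneous coordinate that is split off; the power of the modulus
  is the Jacobian of the \<open>n\<close> substitutions z_j = y w_j.\<close>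

definition radial_const :: "nat \<Rightarrow> ennreal" where
  "radial_const n = (\<integral>\<^sup>+y. indicator {y. y \<noteq> 0 \<and> (cmod y)\<^sup>2 \<le> 1} y * ennreal ((cmod y)\<^sup>2 ^ n) \<partial>lborel)"

lemma radial_const_bounds: "0 < radial_const n" "radial_const n < \<infinity>"
proof -
  have "radial_const n \<le> (\<integral>\<^sup>+y. indicator (cball 0 1) (y::complex) \<partial>lborel)"
    unfolding radial_const_def
    by (intro nn_integral_mono)
      (auto simp: indicator_def power_le_one abs_square_le_1 split: if_splits)
  also have "\<dots> < \<infinity>"
    using emeasure_lborel_cbox_finite emeasure_bounded_finite[of "cball (0::complex) 1"] by simp
  finally show "radial_const n < \<infinity>" .
  show "0 < radial_const n"
  proof (rule ccontr)
    assume "\<not> 0 < radial_const n"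
    then have "radial_const n = 0" by simp
    then have "AE y in lborel. indicator {y. y \<noteq> 0 \<and> (cmod y)\<^sup>2 \<le> 1} y * ennreal ((cmod y)\<^sup>2 ^ n) = 0"
      unfolding radial_const_def by (subst (asm) nn_integral_0_iff_AE) auto
    then have "AE y in lborel. y \<notin> ball (0::complex) 1 - {0}"
      by eventually_elim (auto simp: indicator_def abs_square_le_1)
    then have "emeasure lborel (ball (0::complex) 1 - {0}) = 0"
      by (subst (asm) AE_iff_measurable[where N = "ball 0 1 - {0}"]) auto
    then show False
      using emeasure_ball_minus_0_pos[of 1] by simp
  qed
qed

text \<open>
  The coordinate \<open>z\<^sub>a\<close> is integrated out after the substitution \<open>z\<^sub>j = z\<^sub>a w\<^sub>j\<close>: the unit ball of
  \<open>\<complex>\<^bsup>n+1\<^esup>\<close> induces, in every affine chart, the Fubini-Study volume up to one and the same constant.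
\<close>

lemma nn_integral_ball_affine:
  assumes a: "a \<le> n" and g [measurable]: "g \<in> borel_measurable (lborel_vec {..<n})"
  shows "(\<integral>\<^sup>+z. indicator {z. cnorm2 (Suc n) z \<le> 1 \<and> z a \<noteq> 0} z * g (affine_vec n a z) \<partial>lborel_vec {..<Suc n}) =
    radial_const n * (\<integral>\<^sup>+w. ennreal (1 / (1 + cnorm2 n w) ^ Suc n) * g w \<partial>lborel_vec {..<n})"
proof -
  have pair: "pair_sigma_finite (lborel :: complex measure) (lborel_vec {..<n})"
    by (intro pair_sigma_finite.intro lborel.sigma_finite_measure_axioms
        product_sigma_finite.sigma_finite[OF product_sigma_finite_lborel]) simp
  let ?h = "\<lambda>z. indicator {z. cnorm2 (Suc n) z \<le> 1 \<and> z a \<noteq> 0} z * g (affine_vec n a z)"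
  \<comment> \<open>Moves the coordinate \<open>a\<close> to the last place, so that every chart is
    reduced to the chart \<open>n\<close>.\<close>
  define \<pi> where "\<pi> j = (if j < a then j else if j = a then n else j - 1)" for j
  have \<pi>: "bij_betw \<pi> {..<Suc n} {..<Suc n}"
    by (rule bij_betw_byWitness[where f' = "\<lambda>j. if j = n then a else skip a j"])
      (use a in \<open>auto simp: \<pi>_def skip_def\<close>)
  have [measurable]: "a \<in> {..<Suc n}" using a by simp
  have [measurable]: "?h \<in> borel_measurable (lborel_vec {..<Suc n})"
    using a by measurable
  have h: "?h (\<lambda>j\<in>{..<Suc n}. 1 * x (\<pi> j)) =
      indicator {x. cnorm2 (Suc n) x \<le> 1 \<and> x n \<noteq> 0} x * g (affine_vec n n x)" for x
  proof -
    have "cnorm2 (Suc n) (\<lambda>j\<in>{..<Suc n}. 1 * x (\<pi> j)) = (\<Sum>j<Suc n. (cmod (x (\<pi> j)))\<^sup>2)"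
      unfolding cnorm2_def by (intro sum.cong refl) auto
    also have "\<dots> = cnorm2 (Suc n) x"
      unfolding cnorm2_def by (rule sum.reindex_bij_betw[OF \<pi>])
    finally have "cnorm2 (Suc n) (\<lambda>j\<in>{..<Suc n}. 1 * x (\<pi> j)) = cnorm2 (Suc n) x" .
    moreover have "affine_vec n a (\<lambda>j\<in>{..<Suc n}. 1 * x (\<pi> j)) = affine_vec n n x"
      unfolding affine_vec_def using a by (intro restrict_ext) (auto simp: skip_def \<pi>_def)
    ultimately show ?thesis
      using a by (simp add: indicator_def \<pi>_def)
  qed
  \<comment> \<open>The condition of lying in the ball, after the substitution, for the last
    coordinate \<open>y\<close> and affine coordinates \<open>w\<close>.\<close>
  let ?S = "\<lambda>w y. indicator {y. y \<noteq> 0 \<and> (cmod y)\<^sup>2 * (1 + cnorm2 n w) \<le> 1} y :: ennreal"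
  have "(\<integral>\<^sup>+z. ?h z \<partial>lborel_vec {..<Suc n}) = ennreal (\<Prod>j<Suc n. (cmod 1)\<^sup>2) *
      (\<integral>\<^sup>+x. ?h (\<lambda>j\<in>{..<Suc n}. 1 * x (\<pi> j)) \<partial>lborel_vec {..<Suc n})"
    by (rule nn_integral_lborel_vec_transform[OF finite_lessThan \<pi>]) (rule one_neq_zero, measurable)
  also have "\<dots> = (\<integral>\<^sup>+x. indicator {x. cnorm2 (Suc n) x \<le> 1 \<and> x n \<noteq> 0} x * g (affine_vec n n x) \<partial>lborel_vec (insert n {..<n}))"
    unfolding h unfolding lessThan_Suc
    by (simp only: norm_one power_one prod.neutral_const ennreal_1 mult_1_left)
  also have "\<dots> = (\<integral>\<^sup>+y. \<integral>\<^sup>+x. indicator {x. cnorm2 (Suc n) x \<le> 1 \<and> x n \<noteq> 0} (x(n := y)) *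
      g (affine_vec n n (x(n := y))) \<partial>lborel_vec {..<n} \<partial>lborel)"
  proof (rule product_sigma_finite.product_nn_integral_insert_rev[OF product_sigma_finite_lborel])
    show "(\<lambda>x. indicator {x. cnorm2 (Suc n) x \<le> 1 \<and> x n \<noteq> 0} x * g (affine_vec n n x))
        \<in> borel_measurable (lborel_vec (insert n {..<n}))"
      unfolding lessThan_Suc[symmetric] by measurable
  qed simp_all
  also have "\<dots> = (\<integral>\<^sup>+y. \<integral>\<^sup>+w. ennreal ((cmod y)\<^sup>2 ^ n) * (?S w y * g w) \<partial>lborel_vec {..<n} \<partial>lborel)"
  proof (rule nn_integral_cong)
    fix y :: complex
    let ?k = "\<lambda>x. indicator {x. cnorm2 (Suc n) x \<le> 1 \<and> x n \<noteq> 0} (x(n := y)) * g (affine_vec n n (x(n := y)))"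
    show "(\<integral>\<^sup>+x. ?k x \<partial>lborel_vec {..<n}) = (\<integral>\<^sup>+w. ennreal ((cmod y)\<^sup>2 ^ n) * (?S w y * g w) \<partial>lborel_vec {..<n})"
    proof (cases "y = 0")
      case False
      have upd: "(\<lambda>x. x(n := y)) \<in> lborel_vec {..<n} \<rightarrow>\<^sub>M lborel_vec {..<Suc n}"
        unfolding lessThan_Suc by measurable
      have k [measurable]: "?k \<in> borel_measurable (lborel_vec {..<n})"
        by (rule measurable_compose[OF upd, of "\<lambda>x. indicator {x. cnorm2 (Suc n) x \<le> 1 \<and> x n \<noteq> 0} x *
            g (affine_vec n n x)"]) measurable
      have "(\<integral>\<^sup>+x. ?k x \<partial>lborel_vec {..<n}) =
          ennreal (\<Prod>j<n. (cmod y)\<^sup>2) * (\<integral>\<^sup>+w. ?k (\<lambda>j\<in>{..<n}. y * w j) \<partial>lborel_vec {..<n})"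
        using False by (intro nn_integral_lborel_vec_transform[where \<pi> = "\<lambda>j. j"] k) (auto simp: bij_betw_def)
      also have "(\<integral>\<^sup>+w. ?k (\<lambda>j\<in>{..<n}. y * w j) \<partial>lborel_vec {..<n}) = (\<integral>\<^sup>+w. ?S w y * g w \<partial>lborel_vec {..<n})"
      proof (intro nn_integral_cong)
        fix w assume w: "w \<in> space (lborel_vec {..<n})"
        have "affine_vec n n ((\<lambda>j\<in>{..<n}. y * w j)(n := y)) = restrict w {..<n}"
          unfolding affine_vec_def using False by (intro restrict_ext) (auto simp: skip_def)
        also have "\<dots> = w"
          using w by (auto simp: space_PiM PiE_restrict)
        finally have "affine_vec n n ((\<lambda>j\<in>{..<n}. y * w j)(n := y)) = w" .
        moreover have "cnorm2 (Suc n) ((\<lambda>j\<in>{..<n}. y * w j)(n := y)) = (cmod y)\<^sup>2 * (1 + cnorm2 n w)"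
          by (simp add: cnorm2_def norm_mult power_mult_distrib sum_distrib_left algebra_simps)
        ultimately show "?k (\<lambda>j\<in>{..<n}. y * w j) = ?S w y * g w"
          by (simp add: indicator_def)
      qed
      also have "ennreal (\<Prod>j<n. (cmod y)\<^sup>2) * \<dots> = (\<integral>\<^sup>+w. ennreal ((cmod y)\<^sup>2 ^ n) * (?S w y * g w) \<partial>lborel_vec {..<n})"
        by (subst nn_integral_cmult) simp_all
      finally show ?thesis .
    qed simp
  qed
  also have "\<dots> = (\<integral>\<^sup>+w. \<integral>\<^sup>+y. ennreal ((cmod y)\<^sup>2 ^ n) * (?S w y * g w) \<partial>lborel \<partial>lborel_vec {..<n})"
    by (rule pair_sigma_finite.Fubini'[OF pair, symmetric]) measurable
  also have "\<dots> = (\<integral>\<^sup>+w. radial_const n * (ennreal (1 / (1 + cnorm2 n w) ^ Suc n) * g w) \<partial>lborel_vec {..<n})"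
  proof (intro nn_integral_cong)
    fix w
    define t where "t = 1 + cnorm2 n w"
    have t: "t > 0" unfolding t_def cnorm2_def by (simp add: add_pos_nonneg sum_nonneg)
    \<comment> \<open>Scaling by \<open>?r\<close> maps the unit disc to the disc of
      \<open>?S w\<close>. The area contributes \<open>1 / t\<close> and the Jacobian weight
      \<open>1 / t ^ n\<close>, which together are the Fubini-Study density.\<close>
    let ?r = "complex_of_real (1 / sqrt t)"
    have r: "(cmod ?r)\<^sup>2 = 1 / t" "?r \<noteq> 0"
      using t by (auto simp: power_divide norm_divide)
    let ?q = "\<lambda>y. ?S w y * ennreal ((cmod y)\<^sup>2 ^ n)"
    have q [measurable]: "?q \<in> borel_measurable borel"
      by measurable
    have "(\<integral>\<^sup>+y. ennreal ((cmod y)\<^sup>2 ^ n) * (?S w y * g w) \<partial>lborel) = (\<integral>\<^sup>+y. ?q y \<partial>lborel) * g w"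
      by (subst nn_integral_multc[symmetric]) (simp_all add: mult_ac)
    also have "(\<integral>\<^sup>+y. ?q y \<partial>lborel) = ennreal (1 / t) * (\<integral>\<^sup>+y. ?q (?r * y) \<partial>lborel)"
      unfolding r(1)[symmetric] by (rule nn_integral_lborel_complex_mult[OF q r(2)])
    also have "(\<integral>\<^sup>+y. ?q (?r * y) \<partial>lborel) = (\<integral>\<^sup>+y. ennreal (1 / t ^ n) *
        (indicator {y. y \<noteq> 0 \<and> (cmod y)\<^sup>2 \<le> 1} y * ennreal ((cmod y)\<^sup>2 ^ n)) \<partial>lborel)"
    proof (intro nn_integral_cong)
      fix y
      have y: "(cmod (?r * y))\<^sup>2 = 1 / t * (cmod y)\<^sup>2"
        unfolding norm_mult power_mult_distrib r(1) ..
      have "?S w (?r * y) = indicator {y. y \<noteq> 0 \<and> (cmod y)\<^sup>2 \<le> 1} y"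
      proof -
        have "(cmod (?r * y))\<^sup>2 * t = (cmod y)\<^sup>2"
          unfolding y using t by simp
        moreover have "?r * y \<noteq> 0 \<longleftrightarrow> y \<noteq> 0"
          using r(2) by simp
        ultimately show ?thesis
          unfolding indicator_def t_def[symmetric] mem_Collect_eq by (simp only:)
      qed
      moreover have "ennreal ((cmod (?r * y))\<^sup>2 ^ n) = ennreal (1 / t ^ n) * ennreal ((cmod y)\<^sup>2 ^ n)"
        unfolding y power_mult_distrib using t
        by (subst ennreal_mult[symmetric]) (simp_all add: power_divide)
      ultimately show "?q (?r * y) = ennreal (1 / t ^ n) *
          (indicator {y. y \<noteq> 0 \<and> (cmod y)\<^sup>2 \<le> 1} y * ennreal ((cmod y)\<^sup>2 ^ n))"
        by (simp add: mult_ac)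
    qed
    also have "\<dots> = ennreal (1 / t ^ n) * radial_const n"
      unfolding radial_const_def by (rule nn_integral_cmult) measurable
    also have "ennreal (1 / t) * (ennreal (1 / t ^ n) * radial_const n) * g w =
        radial_const n * (ennreal (1 / t ^ Suc n) * g w)"
    proof -
      have "ennreal (1 / t ^ Suc n) = ennreal (1 / t) * ennreal (1 / t ^ n)"
        using t by (simp add: ennreal_mult[symmetric])
      then show ?thesis by (simp add: mult_ac)
    qed
    finally show "(\<integral>\<^sup>+y. ennreal ((cmod y)\<^sup>2 ^ n) * (?S w y * g w) \<partial>lborel) =
        radial_const n * (ennreal (1 / (1 + cnorm2 n w) ^ Suc n) * g w)"
      unfolding t_def .
  qed
  also have "\<dots> = radial_const n * (\<integral>\<^sup>+w. ennreal (1 / (1 + cnorm2 n w) ^ Suc n) * g w \<partial>lborel_vec {..<n})"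
    by (rule nn_integral_cmult) measurable
  finally show ?thesis .
qed

text \<open>The identity for nonnegative functions says that the image of the ball measure in affine
  coordinates is a density of Lebesgue measure; this carries over to complex integrands.
  \<open>C\<close> precedes the quantifier over \<open>a\<close>, so that contributions of different
  charts can be added.\<close>

lemma integral_ball_affine:
  "\<exists>C>0. \<forall>a f. a \<le> n \<longrightarrow> (f :: cvec \<Rightarrow> complex) \<in> borel_measurable (lborel_vec {..<n}) \<longrightarrow>
      (\<integral>z. indicator {z. cnorm2 (Suc n) z \<le> 1 \<and> z a \<noteq> 0} z *\<^sub>R f (affine_vec n a z) \<partial>lborel_vec {..<Suc n}) =
      C *\<^sub>R (\<integral>w. (1 / (1 + cnorm2 n w) ^ Suc n) *\<^sub>R f w \<partial>lborel_vec {..<n})"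
proof (intro exI conjI allI impI)
  define C where "C = enn2real (radial_const n)"
  have C: "ennreal C = radial_const n" and "C > 0"
    using radial_const_bounds[of n] by (auto simp: C_def enn2real_positive_iff)
  then show "enn2real (radial_const n) > 0" by (simp add: C_def)
  fix a and f :: "cvec \<Rightarrow> complex"
  assume a: "a \<le> n" and f [measurable]: "f \<in> borel_measurable (lborel_vec {..<n})"
  let ?S = "{z. cnorm2 (Suc n) z \<le> 1 \<and> z a \<noteq> 0}" and ?A = "affine_vec n a"
  let ?B = "density (lborel_vec {..<Suc n}) (\<lambda>z. indicator ?S z)"
  let ?d = "\<lambda>w. C * (1 / (1 + cnorm2 n w) ^ Suc n)"
  have [measurable]: "a \<in> {..<Suc n}" using a by simp
  have A [measurable]: "?A \<in> lborel_vec {..<Suc n} \<rightarrow>\<^sub>M lborel_vec {..<n}"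
    using a by measurable
  have A' [measurable]: "?A \<in> ?B \<rightarrow>\<^sub>M lborel_vec {..<n}"
    by measurable
  have d: "?d w \<ge> 0" for w
    using \<open>C > 0\<close> by (simp add: cnorm2_def sum_nonneg)
  have "distr ?B (lborel_vec {..<n}) ?A = density (lborel_vec {..<n}) ?d"
  proof (rule measure_eqI)
    fix X assume "X \<in> sets (distr ?B (lborel_vec {..<n}) ?A)"
    then have X [measurable]: "X \<in> sets (lborel_vec {..<n})" by simp
    have "emeasure (distr ?B (lborel_vec {..<n}) ?A) X = (\<integral>\<^sup>+z. indicator X z \<partial>distr ?B (lborel_vec {..<n}) ?A)"
      by simp
    also have "\<dots> = (\<integral>\<^sup>+z. indicator X (?A z) \<partial>?B)"
      by (rule nn_integral_distr) measurable
    also have "\<dots> = (\<integral>\<^sup>+z. indicator ?S z * indicator X (?A z) \<partial>lborel_vec {..<Suc n})"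
      by (rule nn_integral_density) measurable
    also have "\<dots> = radial_const n * (\<integral>\<^sup>+w. ennreal (1 / (1 + cnorm2 n w) ^ Suc n) * indicator X w \<partial>lborel_vec {..<n})"
      by (rule nn_integral_ball_affine[OF a]) measurable
    also have "\<dots> = (\<integral>\<^sup>+w. ennreal C * (ennreal (1 / (1 + cnorm2 n w) ^ Suc n) * indicator X w) \<partial>lborel_vec {..<n})"
      unfolding C[symmetric] by (rule nn_integral_cmult[symmetric]) measurable
    also have "\<dots> = (\<integral>\<^sup>+w. ennreal (?d w) * indicator X w \<partial>lborel_vec {..<n})"
      using \<open>C > 0\<close> by (intro nn_integral_cong)
        (subst ennreal_mult, simp_all add: cnorm2_def sum_nonneg mult.assoc)
    also have "\<dots> = emeasure (density (lborel_vec {..<n}) ?d) X"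
      by (rule emeasure_density[symmetric]) measurable
    finally show "emeasure (distr ?B (lborel_vec {..<n}) ?A) X = \<dots>" .
  qed simp
  then have "(\<integral>z. f z \<partial>distr ?B (lborel_vec {..<n}) ?A) = (\<integral>w. f w \<partial>density (lborel_vec {..<n}) ?d)"
    by simp
  also have "(\<integral>z. f z \<partial>distr ?B (lborel_vec {..<n}) ?A) = (\<integral>z. f (?A z) \<partial>?B)"
    by (rule integral_distr) measurable
  also have "\<dots> = (\<integral>z. f (?A z) \<partial>density (lborel_vec {..<Suc n}) (\<lambda>z. ennreal (indicator ?S z)))"
    by (simp add: ennreal_indicator)
  also have "\<dots> = (\<integral>z. indicator ?S z *\<^sub>R f (?A z) \<partial>lborel_vec {..<Suc n})"
  proof (rule integral_density)
    show "indicat_real ?S \<in> borel_measurable (lborel_vec {..<Suc n})"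
      by measurable
    show "(\<lambda>z. f (?A z)) \<in> borel_measurable (lborel_vec {..<Suc n})"
      by measurable
  qed simp
  also have "(\<integral>w. f w \<partial>density (lborel_vec {..<n}) ?d) = (\<integral>w. ?d w *\<^sub>R f w \<partial>lborel_vec {..<n})"
  proof (rule integral_density)
    show "?d \<in> borel_measurable (lborel_vec {..<n})"
      by measurable
  qed (use d in \<open>simp_all add: f\<close>)
  also have "\<dots> = C *\<^sub>R (\<integral>w. (1 / (1 + cnorm2 n w) ^ Suc n) *\<^sub>R f w \<partial>lborel_vec {..<n})"
    by (simp flip: integral_scaleR_right)
  finally show "(\<integral>z. indicator ?S z *\<^sub>R f (?A z) \<partial>lborel_vec {..<Suc n}) =
      enn2real (radial_const n) *\<^sub>R (\<integral>w. (1 / (1 + cnorm2 n w) ^ Suc n) *\<^sub>R f w \<partial>lborel_vec {..<n})"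
    unfolding C_def .
qed

section \<open>Gram integrals of the coordinates over the ball\<close>

lemma emeasure_cnorm2_ball_finite:
  "emeasure (lborel_vec {..<n}) {z \<in> space (lborel_vec {..<n}). cnorm2 n z \<le> 1} < \<infinity>"
proof -
  have "{z \<in> space (lborel_vec {..<n}). cnorm2 n z \<le> 1} \<subseteq> Pi\<^sub>E {..<n} (\<lambda>_. cball 0 1)"
  proof clarify
    fix z assume z: "z \<in> space (lborel_vec {..<n})" "cnorm2 n z \<le> 1"
    have "cmod (z j) \<le> 1" if "j < n" for j
    proof -
      have "(cmod (z j))\<^sup>2 \<le> cnorm2 n z"
        unfolding cnorm2_def using that by (intro member_le_sum) auto
      with z(2) have "(cmod (z j))\<^sup>2 \<le> 1" by linarith
      then show ?thesis by (simp add: abs_square_le_1)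
    qed
    then show "z \<in> Pi\<^sub>E {..<n} (\<lambda>_. cball 0 1)"
      using z(1) by (auto simp: space_PiM PiE_iff)
  qed
  then have "emeasure (lborel_vec {..<n}) {z \<in> space (lborel_vec {..<n}). cnorm2 n z \<le> 1} \<le>
      emeasure (lborel_vec {..<n}) (Pi\<^sub>E {..<n} (\<lambda>_. cball 0 1))"
    by (rule emeasure_mono) (auto intro!: sets_PiM_I_finite)
  also have "\<dots> = (\<Prod>j<n. emeasure lborel (cball (0::complex) 1))"
    by (rule emeasure_PiM_lborel) auto
  also have "\<dots> < \<infinity>"
    using emeasure_bounded_finite[of "cball (0::complex) 1"]
    by (simp add: power_less_top_ennreal)
  finally show ?thesis .
qed

text \<open>For \<open>n = Suc N\<close> this is the pointwise scalar product of the sections Z_j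
  and Z_k, lifted to the ball. At the origin division by zero gives 0.\<close>

definition ball_gram :: "nat \<Rightarrow> nat \<Rightarrow> nat \<Rightarrow> cvec \<Rightarrow> complex" where
  "ball_gram n j k z = indicator {z. cnorm2 n z \<le> 1} z *\<^sub>R (cnj (z j) * z k / of_real (cnorm2 n z))"

lemma measurable_ball_gram [measurable]:
  assumes "j < n" "k < n"
  shows "ball_gram n j k \<in> borel_measurable (lborel_vec {..<n})"
proof -
  have [measurable]: "j \<in> {..<n}" "k \<in> {..<n}" using assms by auto
  have [measurable]: "cnj \<in> borel_measurable borel"
    by (intro borel_measurable_continuous_onI continuous_intros)
  show ?thesis unfolding ball_gram_def[abs_def] by measurable
qed

lemma integrable_ball_gram:
  assumes jk: "j < n" "k < n"
  shows "integrable (lborel_vec {..<n}) (ball_gram n j k)"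
proof (rule integrableI_bounded_set[OF _ _ emeasure_cnorm2_ball_finite[of n], where B = 1])
  have "norm (ball_gram n j k z) \<le> 1" for z
  proof (cases "cnorm2 n z = 0")
    case False
    have "cnorm2 n z \<ge> 0" by (simp add: cnorm2_def sum_nonneg)
    then have pos: "cnorm2 n z > 0" using False by simp
    have "(cmod (z j))\<^sup>2 \<le> cnorm2 n z" "(cmod (z k))\<^sup>2 \<le> cnorm2 n z"
      unfolding cnorm2_def using jk by (auto intro!: member_le_sum)
    then have "2 * (cmod (z j) * cmod (z k)) \<le> 2 * cnorm2 n z"
      using sum_squares_bound[of "cmod (z j)" "cmod (z k)"] by linarith
    then show ?thesis
      using pos by (simp add: ball_gram_def indicator_def norm_mult norm_divide)
  qed (simp add: ball_gram_def)
  then show "AE z in lborel_vec {..<n}. z \<in> {z \<in> space (lborel_vec {..<n}). cnorm2 n z \<le> 1} \<longrightarrow>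
      norm (ball_gram n j k z) \<le> 1" by simp
  show "AE z in lborel_vec {..<n}. z \<notin> {z \<in> space (lborel_vec {..<n}). cnorm2 n z \<le> 1} \<longrightarrow>
      ball_gram n j k z = 0"
    by (intro AE_I2) (auto simp: ball_gram_def indicator_def)
qed (use jk in measurable)

lemma cnorm2_cong: "(\<And>j. j < n \<Longrightarrow> cmod (u j) = cmod (v j)) \<Longrightarrow> cnorm2 n u = cnorm2 n v"
  by (simp add: cnorm2_def)

text \<open>The integrand is odd under the sign change of \<open>z j\<close>, which preserves the
  ball and the measure.\<close>

lemma ball_gram_orthogonal:
  assumes jk: "j < n" "k < n" "j \<noteq> k"
  shows "(\<integral>z. ball_gram n j k z \<partial>lborel_vec {..<n}) = 0"
proof -
  define c :: "nat \<Rightarrow> complex" where "c i = (if i = j then -1 else 1)" for i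
  have "cnorm2 n (\<lambda>i\<in>{..<n}. c i * x i) = cnorm2 n x" for x
    by (intro cnorm2_cong) (simp add: c_def norm_mult)
  then have g: "ball_gram n j k (\<lambda>i\<in>{..<n}. c i * x i) = - ball_gram n j k x" for x
    using jk by (simp add: ball_gram_def indicator_def c_def)
  have "(\<integral>z. ball_gram n j k z \<partial>lborel_vec {..<n}) =
      (\<integral>z. ball_gram n j k (\<lambda>i\<in>{..<n}. c i * z i) \<partial>lborel_vec {..<n})"
    using jk by (intro integral_lborel_vec_transform) (auto simp: c_def bij_betw_def)
  then show ?thesis
    unfolding g by simp
qed

text \<open>Exchanging the coordinates 0 and \<open>j\<close> preserves the ball and the
  measure.\<close>

lemma ball_gram_diagonal:
  assumes j: "j < n"
  shows "(\<integral>z. ball_gram n j j z \<partial>lborel_vec {..<n}) = (\<integral>z. ball_gram n 0 0 z \<partial>lborel_vec {..<n})"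
proof -
  let ?\<pi> = "Transposition.transpose 0 j"
  have \<pi>: "?\<pi> permutes {..<n}"
    using j by (intro permutes_swap_id) auto
  have "cnorm2 n (\<lambda>i\<in>{..<n}. 1 * x (?\<pi> i)) = (\<Sum>i<n. (cmod (x (?\<pi> i)))\<^sup>2)" for x
    unfolding cnorm2_def by (intro sum.cong refl) auto
  then have "cnorm2 n (\<lambda>i\<in>{..<n}. 1 * x (?\<pi> i)) = cnorm2 n x" for x
    using sum.permute[OF \<pi>, of "\<lambda>i. (cmod (x i))\<^sup>2"] by (simp add: cnorm2_def o_def)
  then have g: "ball_gram n j j (\<lambda>i\<in>{..<n}. 1 * x (?\<pi> i)) = ball_gram n 0 0 x" for x
    using j by (simp add: ball_gram_def indicator_def)
  have "(\<integral>z. ball_gram n j j z \<partial>lborel_vec {..<n}) =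
      (\<integral>z. ball_gram n j j (\<lambda>i\<in>{..<n}. 1 * z (?\<pi> i)) \<partial>lborel_vec {..<n})"
    using j permutes_imp_bij[OF \<pi>] by (intro integral_lborel_vec_transform) auto
  then show ?thesis
    unfolding g .
qed

lemma ball_gram_pos:
  assumes n: "n > 0"
  obtains I where "I > 0" "(\<integral>z. ball_gram n 0 0 z \<partial>lborel_vec {..<n}) = of_real I"
proof
  let ?f = "\<lambda>z. Re (ball_gram n 0 0 z)"
  have re: "ball_gram n 0 0 z = of_real (?f z)" for z
    by (simp add: ball_gram_def mult.commute[of "cnj _"] complex_norm_square[symmetric]
        scaleR_conv_of_real flip: of_real_power of_real_divide of_real_mult)
  have int: "integrable (lborel_vec {..<n}) ?f"
    using integrable_ball_gram[OF n n] by (rule integrable_Re)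
  have f: "?f z = indicator {z. cnorm2 n z \<le> 1} z * ((cmod (z 0))\<^sup>2 / cnorm2 n z)" for z
    by (simp add: ball_gram_def mult.commute[of "cnj _"] complex_norm_square[symmetric]
         flip: of_real_power of_real_divide of_real_mult)
  have nn: "?f z \<ge> 0" for z
    unfolding f by (simp add: cnorm2_def sum_nonneg)
  show "(\<integral>z. ball_gram n 0 0 z \<partial>lborel_vec {..<n}) = of_real (\<integral>z. ?f z \<partial>lborel_vec {..<n})"
    by (subst re) (rule integral_complex_of_real)
  have "(\<integral>z. ?f z \<partial>lborel_vec {..<n}) \<noteq> 0"
  proof
    \<comment> \<open>The radius keeps the product of \<open>n\<close> such discs inside the unit
      ball, and removing 0 keeps \<open>z 0\<close> nonzero: the integrand is positive on a set of
      positive measure.\<close>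
    define R where "R = ball (0::complex) (1 / sqrt n) - {0}"
    have R [measurable]: "R \<in> sets lborel" unfolding R_def by simp
    have box: "Pi\<^sub>E {..<n} (\<lambda>_. R) \<in> sets (lborel_vec {..<n})"
      by (intro sets_PiM_I_finite) (use R in simp_all)
    assume "(\<integral>z. ?f z \<partial>lborel_vec {..<n}) = 0"
    then have "AE z in lborel_vec {..<n}. ?f z = 0"
      using integral_nonneg_eq_0_iff_AE[OF int] nn by simp
    then have "AE z in lborel_vec {..<n}. z \<notin> Pi\<^sub>E {..<n} (\<lambda>_. R)"
    proof eventually_elim
      case (elim z)
      show ?case
      proof
        assume z: "z \<in> Pi\<^sub>E {..<n} (\<lambda>_. R)"
        have "(cmod (z j))\<^sup>2 \<le> 1 / n" if "j < n" for j
        proof -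
          have "cmod (z j) \<le> 1 / sqrt n"
            using z that by (auto simp: PiE_iff R_def intro: less_imp_le)
          then have "(cmod (z j))\<^sup>2 \<le> (1 / sqrt n)\<^sup>2"
            by (intro power_mono) auto
          then show ?thesis by (simp add: power_divide)
        qed
        then have "cnorm2 n z \<le> (\<Sum>j<n. 1 / n)"
          unfolding cnorm2_def by (intro sum_mono) auto
        then have "cnorm2 n z \<le> 1" using n by simp
        moreover have "z 0 \<noteq> 0" using z n by (auto simp: PiE_iff R_def)
        moreover have "(cmod (z 0))\<^sup>2 \<le> cnorm2 n z"
          unfolding cnorm2_def using n by (intro member_le_sum) auto
        ultimately show False
          using elim unfolding f by (auto simp: indicator_def)
      qed
    qed
    then have "emeasure (lborel_vec {..<n}) (Pi\<^sub>E {..<n} (\<lambda>_. R)) = 0"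
      using sets.sets_into_space[OF box] by (subst (asm) AE_iff_measurable[OF box]) auto
    moreover have "emeasure (lborel_vec {..<n}) (Pi\<^sub>E {..<n} (\<lambda>_. R)) = (\<Prod>j<n. emeasure lborel R)"
      by (rule emeasure_PiM_lborel) (use R in simp_all)
    moreover have "emeasure lborel R > 0"
      unfolding R_def using n by (intro emeasure_ball_minus_0_pos) simp
    ultimately show False by simp
  qed
  then show "(\<integral>z. ?f z \<partial>lborel_vec {..<n}) > 0"
    using integral_nonneg_AE[of ?f "lborel_vec {..<n}"] nn by (simp add: less_le)
qed

section \<open>Projective space and the hyperplane bundle\<close>

abbreviation punctured :: "nat \<Rightarrow> cvec set" where
  "punctured N \<equiv> cspace (Suc N) - {\<lambda>_. 0}"

lemma cscale_cscale [simp]: "cscale a (cscale b z) = cscale (a * b) z"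
  by (simp add: cscale_def mult.assoc)

lemma cscale_1 [simp]: "cscale 1 z = z"
  by (simp add: cscale_def)

lemma cscale_0 [simp]: "cscale 0 z = (\<lambda>_. 0)"
  by (simp add: cscale_def)

lemma cscale_apply: "cscale c z j = c * z j"
  by (simp add: cscale_def)

lemma cscale_eq_0_iff: "cscale c z = (\<lambda>_. 0) \<longleftrightarrow> c = 0 \<or> z = (\<lambda>_. 0)"
  by (auto simp: cscale_def fun_eq_iff)

lemma cscale_cspace: "z \<in> cspace n \<Longrightarrow> cscale c z \<in> cspace n"
  by (simp add: cspace_def cscale_def)

lemma cscale_punctured: "z \<in> punctured N \<Longrightarrow> c \<noteq> 0 \<Longrightarrow> cscale c z \<in> punctured N"
  by (simp add: cscale_cspace cscale_eq_0_iff)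

lemma hclass_refl: "z \<in> hclass z"
  unfolding hclass_def by (rule CollectI, rule exI[of _ 1]) simp

lemma hclass_cscale:
  assumes "c \<noteq> 0"
  shows "hclass (cscale c z) = hclass z"
proof (intro subset_antisym subsetI)
  fix x assume "x \<in> hclass (cscale c z)"
  then obtain d where "d \<noteq> 0" "x = cscale (d * c) z"
    unfolding hclass_def by auto
  then show "x \<in> hclass z"
    unfolding hclass_def using assms by (intro CollectI exI[of _ "d * c"]) simp
next
  fix x assume "x \<in> hclass z"
  then obtain d where "d \<noteq> 0" "x = cscale d z"
    unfolding hclass_def by auto
  then show "x \<in> hclass (cscale c z)"
    unfolding hclass_def using assms by (intro CollectI exI[of _ "d / c"]) simp
qed

lemma proj_spaceE:
  assumes "p \<in> proj_space N"
  obtains z where "z \<in> punctured N" "p = hclass z"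
  using assms unfolding proj_space_def by blast

lemma hclass_proj_space: "z \<in> punctured N \<Longrightarrow> hclass z \<in> proj_space N"
  unfolding proj_space_def by blast

lemma proj_space_mem:
  assumes "p \<in> proj_space N" "z \<in> p"
  shows "z \<in> punctured N" "p = hclass z"
proof -
  obtain y where y: "y \<in> punctured N" "p = hclass y" using proj_spaceE[OF assms(1)] .
  then obtain c where "c \<noteq> 0" "z = cscale c y"
    using assms(2) unfolding hclass_def by blast
  then show "z \<in> punctured N" "p = hclass z"
    using y cscale_punctured hclass_cscale by metis+
qed

text \<open>Preimages under \<open>hclass\<close> commute with intersections and unions, so the
  recipe under \<open>topology\<close> is a topology: the quotient topology.\<close>

lemma openin_proj_topology:
  "openin (proj_topology N) U \<longleftrightarrow> U \<subseteq> proj_space N \<and>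
     openin (top_of_set (punctured N)) {z \<in> punctured N. hclass z \<in> U}"
proof -
  have "istopology (\<lambda>U. U \<subseteq> proj_space N \<and>
      openin (top_of_set (punctured N)) {z \<in> punctured N. hclass z \<in> U})"
    unfolding istopology_def
  proof (intro conjI allI impI)
    fix S T
    assume S: "S \<subseteq> proj_space N \<and> openin (top_of_set (punctured N)) {z \<in> punctured N. hclass z \<in> S}"
      and T: "T \<subseteq> proj_space N \<and> openin (top_of_set (punctured N)) {z \<in> punctured N. hclass z \<in> T}"
    then show "S \<inter> T \<subseteq> proj_space N" by blast
    have "{z \<in> punctured N. hclass z \<in> S \<inter> T} =
        {z \<in> punctured N. hclass z \<in> S} \<inter> {z \<in> punctured N. hclass z \<in> T}" by blast
    then show "openin (top_of_set (punctured N)) {z \<in> punctured N. hclass z \<in> S \<inter> T}"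
      using openin_Int[OF conjunct2[OF S] conjunct2[OF T]] by (simp only:)
  next
    fix \<K>
    assume K: "\<forall>K\<in>\<K>. K \<subseteq> proj_space N \<and> openin (top_of_set (punctured N)) {z \<in> punctured N. hclass z \<in> K}"
    then show "\<Union> \<K> \<subseteq> proj_space N" by blast
    have "{z \<in> punctured N. hclass z \<in> \<Union> \<K>} = (\<Union>K\<in>\<K>. {z \<in> punctured N. hclass z \<in> K})" by blast
    then show "openin (top_of_set (punctured N)) {z \<in> punctured N. hclass z \<in> \<Union> \<K>}"
      using K by (simp only:) (intro openin_Union, blast)
  qed
  then show ?thesis
    unfolding proj_topology_def by (simp add: topology_inverse')
qed

lemma topspace_proj_topology [simp]: "topspace (proj_topology N) = proj_space N"
proof (intro subset_antisym)
  show "topspace (proj_topology N) \<subseteq> proj_space N"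
    using openin_topspace[of "proj_topology N"] unfolding openin_proj_topology by blast
  have eq: "{z \<in> punctured N. hclass z \<in> proj_space N} = punctured N"
    using hclass_proj_space by blast
  have "openin (proj_topology N) (proj_space N)"
    by (simp only: openin_proj_topology eq openin_subtopology_self subset_refl simp_thms)
  then show "proj_space N \<subseteq> topspace (proj_topology N)"
    by (rule openin_subset)
qed

lemma continuous_map_hclass: "continuous_map (top_of_set (punctured N)) (proj_topology N) hclass"
  unfolding continuous_map_def
  by (auto simp: openin_proj_topology intro: hclass_proj_space)

text \<open>The universal property of the quotient: continuity may be tested on homogeneous
  representatives.\<close>

lemma continuous_map_proj_topology:
  assumes "continuous_on (punctured N) (\<lambda>z. f (hclass z))"
  shows "continuous_map (proj_topology N) euclidean f"
  unfolding continuous_map_def openin_proj_topology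
proof (intro conjI allI impI)
  fix U :: "'a set" assume "openin euclidean U"
  then have "openin (top_of_set (punctured N)) (punctured N \<inter> (\<lambda>z. f (hclass z)) -` U)"
    using continuous_openin_preimage_gen[OF assms] by simp
  moreover have "punctured N \<inter> (\<lambda>z. f (hclass z)) -` U =
      {z \<in> punctured N. hclass z \<in> {x \<in> topspace (proj_topology N). f x \<in> U}}"
    using hclass_proj_space by auto
  ultimately show "openin (top_of_set (punctured N)) \<dots>" by metis
qed auto

section \<open>Affine charts\<close>

lemma hclass_affine_part:
  "z \<in> punctured N \<Longrightarrow> hclass z \<in> affine_part N a \<longleftrightarrow> z a \<noteq> 0"
  unfolding affine_part_def
  by (auto simp: hclass_proj_space intro: hclass_refl) (auto simp: hclass_def cscale_apply)

lemma affine_part_mem: "p \<in> affine_part N a \<Longrightarrow> z \<in> p \<Longrightarrow> z a \<noteq> 0"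
  unfolding affine_part_def by blast

lemma affine_part_proj_space: "p \<in> affine_part N a \<Longrightarrow> p \<in> proj_space N"
  unfolding affine_part_def by blast

text \<open>The representative chosen by \<open>SOME\<close> differs from \<open>z\<close> by a
  factor, which cancels in the quotients.\<close>

lemma affine_coord_hclass:
  "affine_coord N a (hclass z) = (\<lambda>j. if j < N then z (skip a j) / z a else 0)"
proof -
  have "(SOME y. y \<in> hclass z) \<in> hclass z"
    by (metis hclass_refl someI)
  then obtain c where c: "c \<noteq> 0" "(SOME y. y \<in> hclass z) = cscale c z"
    unfolding hclass_def by blast
  then show ?thesis
    by (auto simp: affine_coord_def c skip_def cscale_apply fun_eq_iff Let_def)
qed

text \<open>The representative with \<open>a\<close>-th entry \<open>1\<close> of the point with coordinates \<open>w\<close> in the chart \<open>a\<close>.\<close>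

definition homogenize :: "nat \<Rightarrow> cvec \<Rightarrow> cvec" where
  "homogenize a w = (\<lambda>j. if j < a then w j else if j = a then 1 else w (j - 1))"

lemma homogenize_simps [simp]:
  "homogenize a w a = 1" "homogenize a w (skip a j) = w j"
  by (auto simp: homogenize_def skip_def)

lemma homogenize_fun_upd: "homogenize a (w(i := c)) = (homogenize a w)(skip a i := c)"
  by (auto simp: homogenize_def skip_def fun_eq_iff)

lemma homogenize_punctured:
  assumes "w \<in> cspace N" "a \<le> N"
  shows "homogenize a w \<in> punctured N"
proof -
  have "homogenize a w \<noteq> (\<lambda>_. 0)"
    using homogenize_simps(1)[of a w] by (metis zero_neq_one)
  moreover have "homogenize a w \<in> cspace (Suc N)"
    using assms by (auto simp: homogenize_def cspace_def)
  ultimately show ?thesis by simp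
qed

lemma affine_coord_cspace: "affine_coord N a p \<in> cspace N"
  by (simp add: affine_coord_def cspace_def Let_def)

lemma affine_coord_homogenize:
  "w \<in> cspace N \<Longrightarrow> affine_coord N a (hclass (homogenize a w)) = w"
  unfolding affine_coord_hclass by (auto simp: cspace_def fun_eq_iff)

lemma homogenize_affine_coord:
  assumes "z \<in> punctured N" "z a \<noteq> 0" "a \<le> N"
  shows "homogenize a (affine_coord N a (hclass z)) = cscale (1 / z a) z"
  unfolding affine_coord_hclass
proof
  fix j
  show "homogenize a (\<lambda>j. if j < N then z (skip a j) / z a else 0) j = cscale (1 / z a) z j"
    using assms by (cases "j \<le> N") (auto simp: homogenize_def skip_def cscale_def cspace_def)
qed

lemma hclass_homogenize_affine_coord:
  assumes "p \<in> affine_part N a" "a \<le> N"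
  shows "hclass (homogenize a (affine_coord N a p)) = p"
proof -
  obtain z where z: "z \<in> punctured N" "p = hclass z"
    using proj_spaceE[OF affine_part_proj_space[OF assms(1)]] .
  then have "z a \<noteq> 0" using assms(1) hclass_affine_part by blast
  then show ?thesis
    using homogenize_affine_coord[OF z(1) _ assms(2)] hclass_cscale z(2) by simp
qed

lemma inj_on_affine_coord: "a \<le> N \<Longrightarrow> inj_on (affine_coord N a) (affine_part N a)"
  by (rule inj_on_inverseI[where g = "\<lambda>w. hclass (homogenize a w)"])
    (rule hclass_homogenize_affine_coord)

lemma affine_coord_image:
  assumes "a \<le> N"
  shows "affine_coord N a ` (affine_part N a \<inter> affine_part N b) = {w \<in> cspace N. homogenize a w b \<noteq> 0}"
proof (intro set_eqI iffI)
  fix w assume "w \<in> affine_coord N a ` (affine_part N a \<inter> affine_part N b)"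
  then obtain p where p: "p \<in> affine_part N a" "p \<in> affine_part N b" "w = affine_coord N a p" by blast
  then have "homogenize a w \<in> p"
    using hclass_homogenize_affine_coord[OF p(1) assms] hclass_refl by metis
  then show "w \<in> {w \<in> cspace N. homogenize a w b \<noteq> 0}"
    using affine_part_mem[OF p(2)] affine_coord_cspace p(3) by simp
next
  fix w assume w: "w \<in> {w \<in> cspace N. homogenize a w b \<noteq> 0}"
  then have "hclass (homogenize a w) \<in> affine_part N a \<inter> affine_part N b"
    using homogenize_punctured[OF _ assms] hclass_affine_part by auto
  then show "w \<in> affine_coord N a ` (affine_part N a \<inter> affine_part N b)"
    using affine_coord_homogenize w by (metis (no_types, lifting) image_eqI mem_Collect_eq)
qed

lemma affine_coord_image_self: "a \<le> N \<Longrightarrow> affine_coord N a ` affine_part N a = cspace N"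
  using affine_coord_image[of a N a] by simp

lemma chart_inv_affine:
  assumes "a \<le> N" "w \<in> cspace N"
  shows "chart_inv (affine_part N a, affine_coord N a) w = hclass (homogenize a w)"
proof -
  have "hclass (homogenize a w) \<in> affine_part N a"
    using homogenize_punctured[OF assms(2,1)] by (simp add: hclass_affine_part)
  then show ?thesis
    unfolding chart_inv_def using inv_into_f_f[OF inj_on_affine_coord[OF assms(1)]]
      affine_coord_homogenize[OF assms(2)] by (metis fst_conv snd_conv)
qed

lemma continuous_on_homogenize: "continuous_on S (\<lambda>w. homogenize a w j)"
  unfolding homogenize_def
  by (cases "j < a"; cases "j = a")
    (auto intro!: continuous_intros continuous_on_subset[OF continuous_on_product_coordinates])

lemma openin_homogenize_nonzero:
  "openin (top_of_set (cspace N)) {w \<in> cspace N. homogenize a w b \<noteq> 0}"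
proof -
  have "open {w. homogenize a w b \<noteq> 0}"
    by (intro open_Collect_neq continuous_on_homogenize continuous_intros)
  then show ?thesis
    unfolding Collect_conj_eq Collect_mem_eq by (rule openin_open_Int)
qed

lemma openin_affine_part: "openin (proj_topology N) (affine_part N a)"
  unfolding openin_proj_topology
proof
  show "affine_part N a \<subseteq> proj_space N" unfolding affine_part_def by blast
  have "{z \<in> punctured N. hclass z \<in> affine_part N a} = punctured N \<inter> {z. z a \<noteq> 0}"
    using hclass_affine_part by blast
  moreover have "open {z :: cvec. z a \<noteq> 0}"
    by (intro open_Collect_neq continuous_on_product_coordinates continuous_intros)
  ultimately show "openin (top_of_set (punctured N)) {z \<in> punctured N. hclass z \<in> affine_part N a}"
    by (simp add: openin_open_Int)
qed

lemma affine_parts_cover: "(\<Union>a\<in>{..N}. affine_part N a) = proj_space N"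
proof (intro subset_antisym subsetI)
  fix p assume "p \<in> proj_space N"
  then obtain z where z: "z \<in> punctured N" "p = hclass z" by (rule proj_spaceE)
  then obtain a where "z a \<noteq> 0" by (auto simp: fun_eq_iff)
  moreover have "a \<le> N"
    using z(1) \<open>z a \<noteq> 0\<close> by (auto simp: cspace_def not_less_eq_eq)
  ultimately show "p \<in> (\<Union>a\<in>{..N}. affine_part N a)"
    using z hclass_affine_part by blast
qed (auto simp: affine_part_def)

section \<open>Fibres of the hyperplane bundle as linear forms on lines\<close>

lemma taut_line_hclass: "taut_line (hclass z) = {cscale c z |c. True}"
proof (intro subset_antisym subsetI)
  fix x assume "x \<in> taut_line (hclass z)"
  then show "x \<in> {cscale c z |c. True}"
    unfolding hclass_def by auto (rule exI[of _ 0], simp)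
next
  fix x assume "x \<in> {cscale c z |c. True}"
  then show "x \<in> taut_line (hclass z)"
    unfolding hclass_def by (cases "x = (\<lambda>_. 0)") (auto simp: cscale_eq_0_iff)
qed

lemma cadd_cscale: "cadd (cscale a z) (cscale b z) = cscale (a + b) z"
  by (simp add: cadd_def cscale_def algebra_simps)

text \<open>On a line, homogeneity along one generator already implies additivity.\<close>

lemma hyperplane_total_iff:
  assumes "z \<in> punctured N"
  shows "(hclass z, l) \<in> hyperplane_total N \<longleftrightarrow>
    l \<in> extensional (taut_line (hclass z)) \<and> (\<forall>c. l (cscale c z) = c * l z)"
proof -
  have lin: "(\<forall>y \<in> taut_line (hclass z). \<forall>y' \<in> taut_line (hclass z). l (cadd y y') = l y + l y') \<and>
      (\<forall>y \<in> taut_line (hclass z). \<forall>c. l (cscale c y) = c * l y) \<longleftrightarrow> (\<forall>c. l (cscale c z) = c * l z)"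
    (is "?L \<longleftrightarrow> ?R")
  proof
    assume ?L
    then show ?R using hclass_refl by blast
  next
    assume r: ?R
    then show ?L
      unfolding taut_line_hclass by (auto simp: cadd_cscale r[rule_format] algebra_simps)
  qed
  show ?thesis
    unfolding hyperplane_total_def using hclass_proj_space[OF assms] lin by auto
qed

lemma projective_simps [simp]:
  "mtop (projective N) = proj_topology N" "cdim (projective N) = N"
  "charts (projective N) = {(affine_part N a, affine_coord N a) |a. a \<le> N}"
  "kform (projective N) = fubini_study N" "ltotal (projective N) = hyperplane_total N"
  "lproj (projective N) = fst" "lzero (projective N) = (\<lambda>p. (p, \<lambda>z \<in> taut_line p. 0))"
  "ladd (projective N) = (\<lambda>(p, l) (p', l'). (p, \<lambda>z \<in> taut_line p. l z + l' z))"
  "lsmul (projective N) = (\<lambda>c (p, l). (p, \<lambda>z \<in> taut_line p. c * l z))"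
  "ltriv (projective N) = {(affine_part N a, hyperplane_coord a) |a. a \<le> N}"
  "lmetric (projective N) = hyperplane_metric N"
  by (simp_all add: projective_def)

lemma fibre_projective:
  assumes "z \<in> punctured N"
  shows "fibre (projective N) (hclass z) =
    {(hclass z, l) |l. l \<in> extensional (taut_line (hclass z)) \<and> (\<forall>c. l (cscale c z) = c * l z)}"
  unfolding fibre_def using hyperplane_total_iff[OF assms] by auto

lemma hyperplane_coord_hclass:
  assumes "\<And>c. l (cscale c z) = c * l z" "z b \<noteq> 0"
  shows "hyperplane_coord b (hclass z, l) = l z / z b"
proof -
  have "(\<forall>y\<in>hclass z. l y = t * y b) \<longleftrightarrow> t = l z / z b" for t
  proof
    assume "\<forall>y\<in>hclass z. l y = t * y b"
    then have "l z = t * z b" using hclass_refl by blast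
    then show "t = l z / z b" using assms(2) by simp
  next
    assume "t = l z / z b"
    then show "\<forall>y\<in>hclass z. l y = t * y b"
      unfolding hclass_def using assms by (auto simp: cscale_apply)
  qed
  then show ?thesis
    unfolding hyperplane_coord_def by simp
qed

lemma restrict_taut_line [simp]:
  "restrict f (taut_line (hclass z)) (cscale c z) = f (cscale c z)"
  "restrict f (taut_line (hclass z)) z = f z"
proof -
  have "cscale c z \<in> taut_line (hclass z)" for c unfolding taut_line_hclass by blast
  from this[of c] this[of 1] show "restrict f (taut_line (hclass z)) (cscale c z) = f (cscale c z)"
    "restrict f (taut_line (hclass z)) z = f z" by simp_all
qed

lemma fibre_projectiveI:
  assumes "z \<in> punctured N" "\<And>c. f (cscale c z) = c * f z"
  shows "(hclass z, restrict f (taut_line (hclass z))) \<in> fibre (projective N) (hclass z)"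
    "z b \<noteq> 0 \<Longrightarrow> hyperplane_coord b (hclass z, restrict f (taut_line (hclass z))) = f z / z b"
proof -
  let ?l = "restrict f (taut_line (hclass z))"
  have l: "?l (cscale c z) = c * ?l z" for c
    unfolding restrict_taut_line by (rule assms(2))
  then show "(hclass z, ?l) \<in> fibre (projective N) (hclass z)"
    unfolding fibre_projective[OF assms(1)] by blast
  show "hyperplane_coord b (hclass z, ?l) = f z / z b" if "z b \<noteq> 0"
    using hyperplane_coord_hclass[of ?l, OF l that] unfolding restrict_taut_line .
qed

lemma fibre_coordinate_projective:
  assumes p: "p \<in> affine_part N b"
  shows "fibre_coordinate (projective N) (hyperplane_coord b) p"
proof -
  let ?P = "projective N" and ?\<tau> = "hyperplane_coord b"
  obtain z where z: "z \<in> punctured N" "p = hclass z"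
    using proj_spaceE[OF affine_part_proj_space[OF p]] by blast
  have zb: "z b \<noteq> 0" using p z hclass_affine_part by blast
  note F = fibre_projective[OF z(1)]
  have T: "?\<tau> (hclass z, l) = l z / z b" if "\<And>c. l (cscale c z) = c * l z" for l
    by (rule hyperplane_coord_hclass[OF that zb])
  have bij: "bij_betw ?\<tau> (fibre ?P p) UNIV"
  proof (rule bij_betwI')
    fix q r assume "q \<in> fibre ?P p" "r \<in> fibre ?P p"
    then obtain l l' where l: "q = (hclass z, l)" "l \<in> extensional (taut_line (hclass z))" "\<And>c. l (cscale c z) = c * l z"
      and l': "r = (hclass z, l')" "l' \<in> extensional (taut_line (hclass z))" "\<And>c. l' (cscale c z) = c * l' z"
      unfolding z(2) F by blast
    have "l = l'" if "l z = l' z"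
      by (rule extensionalityI[OF l(2) l'(2)]) (use l(3) l'(3) that in \<open>auto simp: taut_line_hclass\<close>)
    then show "?\<tau> q = ?\<tau> r \<longleftrightarrow> q = r"
      unfolding l(1) l'(1) T[OF l(3)] T[OF l'(3)] using zb by auto
  next
    fix t :: complex
    \<comment> \<open>Surjectivity: the multiple of Z_b by \<open>t\<close> has coordinate
      \<open>t\<close>.\<close>
    let ?l = "\<lambda>y\<in>taut_line (hclass z). t * y b"
    have "(hclass z, ?l) \<in> fibre ?P p" "?\<tau> (hclass z, ?l) = t"
      unfolding z(2) using fibre_projectiveI[OF z(1), of "\<lambda>y. t * y b"] zb
      by (auto simp: cscale_apply)
    then show "\<exists>q\<in>fibre ?P p. t = ?\<tau> q" by metis
  qed simp
  have zero: "lzero ?P p \<in> fibre ?P p \<and> ?\<tau> (lzero ?P p) = 0"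
    unfolding z(2) projective_simps using fibre_projectiveI[OF z(1), of "\<lambda>_. 0"] zb by simp
  have add: "ladd ?P q r \<in> fibre ?P p \<and> ?\<tau> (ladd ?P q r) = ?\<tau> q + ?\<tau> r"
    if q: "q \<in> fibre ?P p" and r: "r \<in> fibre ?P p" for q r
  proof -
    obtain l l' where l: "q = (hclass z, l)" "\<And>c. l (cscale c z) = c * l z"
      and l': "r = (hclass z, l')" "\<And>c. l' (cscale c z) = c * l' z"
      using q r unfolding z(2) F by blast
    have "l (cscale c z) + l' (cscale c z) = c * (l z + l' z)" for c
      unfolding l(2) l'(2) by (simp add: algebra_simps)
    note a = fibre_projectiveI[OF z(1), of "\<lambda>y. l y + l' y", OF this]
    show ?thesis
      unfolding l(1) l'(1) z(2) projective_simps prod.case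
      using a(1) a(2)[OF zb] by (simp only: T[OF l(2)] T[OF l'(2)] add_divide_distrib)
  qed
  have smul: "lsmul ?P c q \<in> fibre ?P p \<and> ?\<tau> (lsmul ?P c q) = c * ?\<tau> q"
    if q: "q \<in> fibre ?P p" for q c
  proof -
    obtain l where l: "q = (hclass z, l)" "\<And>c. l (cscale c z) = c * l z"
      using q unfolding z(2) F by blast
    have "c * l (cscale d z) = d * (c * l z)" for d
      unfolding l(2) by (simp add: algebra_simps)
    note a = fibre_projectiveI[OF z(1), of "\<lambda>y. c * l y", OF this]
    show ?thesis
      unfolding l(1) z(2) projective_simps prod.case
      using a(1) a(2)[OF zb] by (simp only: T[OF l(2)] times_divide_eq_right)
  qed
  show ?thesis
    unfolding fibre_coordinate_def using bij zero add smul by blast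
qed

lemma fibrewise_trivialized_projective: "fibrewise_trivialized (projective N)"
proof -
  have "ltriv (projective N) = (\<lambda>a. (affine_part N a, hyperplane_coord a)) ` {..N}" by auto
  then have "\<Union> (fst ` ltriv (projective N)) = (\<Union>a\<in>{..N}. affine_part N a)"
    by (simp only: image_image fst_conv)
  moreover have "fst ` hyperplane_total N \<subseteq> proj_space N"
    by (auto simp: hyperplane_total_def)
  ultimately show ?thesis
    unfolding fibrewise_trivialized_def
    by (auto simp: affine_parts_cover openin_affine_part fibre_coordinate_projective)
qed

lemma projective_chart_openin:
  assumes "c \<in> charts (projective N)" "(U, \<tau>) \<in> ltriv (projective N)"
  shows "openin (top_of_set (cspace (cdim (projective N)))) (snd c ` (fst c \<inter> U)) \<and> inj_on (snd c) (fst c)"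
  using assms by (auto simp: affine_coord_image openin_homogenize_nonzero inj_on_affine_coord)

definition coord_section :: "nat \<Rightarrow> nat \<Rightarrow> ppoint \<Rightarrow> hvector" where
  "coord_section N j = (\<lambda>p\<in>proj_space N. (p, \<lambda>z\<in>taut_line p. z j))"

text \<open>In a single coordinate every entry of \<open>homogenize a w\<close> is constant or the
  identity. The quotient is the coordinate section Z_j in the chart \<open>a\<close> and the
  trivialization over the affine part \<open>b\<close>.\<close>

lemma mv_holomorphic_on_homogenize_quotient:
  "mv_holomorphic_on N {w \<in> cspace N. homogenize a w b \<noteq> 0} (\<lambda>w. homogenize a w j / homogenize a w b)"
  unfolding mv_holomorphic_on_def
proof (intro conjI ballI allI impI)
  show "continuous_on {w \<in> cspace N. homogenize a w b \<noteq> 0} (\<lambda>w. homogenize a w j / homogenize a w b)"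
    by (intro continuous_on_divide continuous_on_homogenize) auto
  fix w i assume w: "w \<in> {w \<in> cspace N. homogenize a w b \<noteq> 0}"
  have d: "(\<lambda>z. homogenize a (w(i := z)) k) field_differentiable at (w i)" for k
    unfolding homogenize_def
    by (cases "k < a"; cases "k = a"; cases "k = i"; cases "k - 1 = i")
      (auto simp: fun_upd_def)
  show "(\<lambda>z. homogenize a (w(i := z)) j / homogenize a (w(i := z)) b) field_differentiable at (w i)"
    using w by (intro field_differentiable_divide d) simp
qed

lemma coord_section_hol:
  assumes "j \<le> N"
  shows "coord_section N j \<in> hol_sections (projective N)"
proof -
  have "coord_section N j \<in> Pi\<^sub>E (proj_space N) (fibre (projective N))"
  proof (rule PiE_I)
    fix p assume p: "p \<in> proj_space N"
    then obtain z where z: "z \<in> punctured N" "p = hclass z" by (rule proj_spaceE)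
    show "coord_section N j p \<in> fibre (projective N) p"
      using p fibre_projectiveI(1)[OF z(1), of "\<lambda>y. y j"]
      unfolding coord_section_def z(2) by (simp add: cscale_apply)
  qed (simp add: coord_section_def)
  moreover have "holomorphic_fun_on (projective N) (affine_part N b) (\<lambda>p. hyperplane_coord b (coord_section N j p))"
    if b: "b \<le> N" for b
    unfolding holomorphic_fun_on_def
  proof
    fix c assume "c \<in> charts (projective N)"
    then obtain a where a: "a \<le> N" "c = (affine_part N a, affine_coord N a)" by auto
    have "mv_holomorphic_on N {w \<in> cspace N. homogenize a w b \<noteq> 0}
        (\<lambda>w. hyperplane_coord b (coord_section N j (chart_inv c w)))"
    proof (rule mv_holomorphic_on_cong[OF openin_homogenize_nonzero mv_holomorphic_on_homogenize_quotient])
      fix w assume w: "w \<in> {w \<in> cspace N. homogenize a w b \<noteq> 0}"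
      let ?z = "homogenize a w"
      have z: "?z \<in> punctured N" using homogenize_punctured w a(1) by blast
      have "coord_section N j (chart_inv c w) = (hclass ?z, \<lambda>y\<in>taut_line (hclass ?z). y j)"
        using w a hclass_proj_space[OF z] by (simp add: chart_inv_affine coord_section_def)
      then show "hyperplane_coord b (coord_section N j (chart_inv c w)) = ?z j / ?z b"
        using w fibre_projectiveI(2)[OF z, of "\<lambda>y. y j" b, OF cscale_apply] by simp
    qed
    then show "mv_holomorphic_on (cdim (projective N)) (snd c ` (fst c \<inter> affine_part N b))
        (\<lambda>w. hyperplane_coord b (coord_section N j (chart_inv c w)))"
      using a by (simp add: affine_coord_image)
  qed
  ultimately show ?thesis
    unfolding hol_sections_def by auto
qed

lemma section_comb_projective:
  assumes "p \<in> proj_space N"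
  shows "section_comb (projective N) \<alpha> (coord_section N) k p = (p, \<lambda>z\<in>taut_line p. \<Sum>j<k. \<alpha> j * z j)"
  using assms by (induction k) (auto simp: coord_section_def intro!: restrict_ext)

section \<open>Holomorphic sections of the hyperplane bundle\<close>

text \<open>Rescaling \<open>z\<close> keeps its line and hence the linear form over it; only the
  argument changes. A section thus becomes a function of degree one on the nonzero vectors.\<close>

lemma hol_section_homogeneous:
  assumes s: "s \<in> hol_sections (projective N)" and z: "z \<in> punctured N" and c: "c \<noteq> 0"
  shows "snd (s (hclass (cscale c z))) (cscale c z) = c * snd (s (hclass z)) z"
proof -
  have "s (hclass z) \<in> fibre (projective N) (hclass z)"
    using hol_sections_fibre[OF s] hclass_proj_space[OF z] by simp
  then obtain l where "s (hclass z) = (hclass z, l)" "\<And>c. l (cscale c z) = c * l z"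
    unfolding fibre_projective[OF z] by blast
  then show ?thesis by (simp add: hclass_cscale[OF c])
qed

text \<open>The \<open>a\<close>-th entry of \<open>homogenize a w\<close> is 1, so the fibre
  coordinate over the chart \<open>a\<close> is the value of the form at this
  representative.\<close>

lemma hol_section_affine:
  assumes s: "s \<in> hol_sections (projective N)" and a: "a \<le> N"
  shows "mv_holomorphic_on N (cspace N) (\<lambda>w. snd (s (hclass (homogenize a w))) (homogenize a w))"
proof -
  have "holomorphic_fun_on (projective N) (affine_part N a) (\<lambda>p. hyperplane_coord a (s p))"
    using s a unfolding hol_sections_def by auto
  then have "mv_holomorphic_on N (affine_coord N a ` (affine_part N a \<inter> affine_part N a))
      (\<lambda>w. hyperplane_coord a (s (chart_inv (affine_part N a, affine_coord N a) w)))"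
    using a unfolding holomorphic_fun_on_def by fastforce
  then have "mv_holomorphic_on N (cspace N)
      (\<lambda>w. hyperplane_coord a (s (chart_inv (affine_part N a, affine_coord N a) w)))"
    by (simp add: affine_coord_image_self[OF a])
  then show ?thesis
  proof (rule mv_holomorphic_on_cong[rotated])
    fix w assume w: "w \<in> cspace N"
    let ?z = "homogenize a w"
    have z: "?z \<in> punctured N" using homogenize_punctured[OF w a] .
    have "s (hclass ?z) \<in> fibre (projective N) (hclass ?z)"
      using hol_sections_fibre[OF s] hclass_proj_space[OF z] by simp
    then obtain l where l: "s (hclass ?z) = (hclass ?z, l)" "\<And>c. l (cscale c ?z) = c * l ?z"
      unfolding fibre_projective[OF z] by blast
    show "snd (s (hclass ?z)) ?z = hyperplane_coord a (s (chart_inv (affine_part N a, affine_coord N a) w))"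
      unfolding chart_inv_affine[OF a w] l(1) using hyperplane_coord_hclass[of l ?z a, OF l(2)] by simp
  qed simp
qed

text \<open>After subtraction of \<open>L * \<zeta>\<close> the function is of smaller order than
  \<open>\<zeta>\<close>. Linear growth makes it a polynomial of degree at most one, and the limit
  removes its linear coefficient.\<close>

lemma entire_asymptotically_linear:
  assumes hol: "f holomorphic_on UNIV" and lim: "((\<lambda>\<zeta>. f \<zeta> / \<zeta>) \<longlongrightarrow> L) at_infinity"
  shows "f \<zeta> = f 0 + L * \<zeta>"
proof -
  define g where "g \<zeta> = f \<zeta> - L * \<zeta>" for \<zeta>
  have ghol: "g holomorphic_on UNIV"
    unfolding g_def using hol by (intro holomorphic_intros)
  have "((\<lambda>\<zeta>. f \<zeta> / \<zeta> - L) \<longlongrightarrow> 0) at_infinity"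
    using tendsto_diff[OF lim tendsto_const[of L]] by simp
  moreover have "\<forall>\<^sub>F \<zeta> in at_infinity. f \<zeta> / \<zeta> - L = g \<zeta> / \<zeta>"
    using eventually_not_equal_at_infinity[of 0]
    by eventually_elim (simp add: g_def field_simps)
  ultimately have g0: "((\<lambda>\<zeta>. g \<zeta> / \<zeta>) \<longlongrightarrow> 0) at_infinity"
    by (rule Lim_transform_eventually)
  then obtain B where B: "\<And>\<zeta>. B \<le> cmod \<zeta> \<Longrightarrow> cmod (g \<zeta> / \<zeta>) < 1"
    unfolding Lim_at_infinity by (metis dist_0_norm dist_commute zero_less_one)
  have "cmod (g \<zeta>) \<le> 1 * cmod \<zeta> ^ 1" if "max B 1 \<le> cmod \<zeta>" for \<zeta>
  proof -
    have "cmod \<zeta> > 0" "cmod (g \<zeta> / \<zeta>) < 1" using B that by auto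
    then show ?thesis by (simp add: norm_divide field_simps)
  qed
  then have lin: "g \<zeta> = (\<Sum>k\<le>1. (deriv ^^ k) g 0 / fact k * \<zeta> ^ k)" for \<zeta>
    by (rule Liouville_polynomial[OF ghol])
  define c d where "c = g 0" and "d = deriv g 0"
  have g: "g \<zeta> = c + d * \<zeta>" for \<zeta>
    using lin[of \<zeta>] by (simp add: c_def d_def)
  have "((\<lambda>\<zeta>. c * inverse \<zeta> + d) \<longlongrightarrow> c * 0 + d) at_infinity"
    by (intro tendsto_intros tendsto_inverse_0)
  moreover have "\<forall>\<^sub>F \<zeta> in at_infinity. c * inverse \<zeta> + d = g \<zeta> / \<zeta>"
    using eventually_not_equal_at_infinity[of 0]
    by eventually_elim (simp add: g field_simps)
  ultimately have "((\<lambda>\<zeta>. g \<zeta> / \<zeta>) \<longlongrightarrow> c * 0 + d) at_infinity"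
    by (rule Lim_transform_eventually)
  from tendsto_unique[OF trivial_limit_at_infinity this g0] have "d = 0"
    by simp
  then have "g \<zeta> = g 0" by (simp add: g)
  then show ?thesis by (simp add: g_def algebra_simps)
qed

text \<open>The \<open>j\<close>-th coordinate point is the origin of the chart \<open>j\<close>;
  letting the \<open>j\<close>-th entry of a vector tend to infinity leads to it.\<close>

lemma axis_vec_homogenize: "axis_vec j 1 = homogenize j (\<lambda>_. 0)"
  by (auto simp: axis_vec_def homogenize_def)

text \<open>
  Only one coordinate is moved at a time: then one affine coordinate varies in a suitable chart, so that
  separate holomorphy suffices, and the behaviour at infinity is continuity at the origin of the chart \<open>j\<close>.
\<close>

lemma hol_section_fun_upd:
  assumes s: "s \<in> hol_sections (projective N)" and z: "z \<in> punctured N" and j: "j \<le> N" "z j = 0"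
  shows "snd (s (hclass (z(j := c)))) (z(j := c)) =
    snd (s (hclass z)) z + c * snd (s (hclass (axis_vec j 1))) (axis_vec j 1)"
proof -
  define F where "F y = snd (s (hclass y)) y" for y
  have hom: "F (cscale d y) = d * F y" if "y \<in> punctured N" "d \<noteq> 0" for d y
    unfolding F_def by (rule hol_section_homogeneous[OF s that])
  have aff: "mv_holomorphic_on N (cspace N) (\<lambda>w. F (homogenize a w))" if "a \<le> N" for a
    unfolding F_def by (rule hol_section_affine[OF s that])
  obtain a where za: "z a \<noteq> 0" using z by (auto simp: fun_eq_iff)
  have a: "a \<le> N" using z za by (auto simp: cspace_def not_less_eq_eq)
  have aj: "a \<noteq> j" using za j by auto
  \<comment> \<open>The position of the coordinate \<open>j\<close> among the affine coordinates of
    the chart \<open>a\<close>.\<close>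
  define i where "i = (if j < a then j else j - 1)"
  have i: "i < N" "skip a i = j" using aj a j by (auto simp: i_def skip_def)
  define w where "w = affine_coord N a (hclass z)"
  have w: "w \<in> cspace N" unfolding w_def by (rule affine_coord_cspace)
  have hz: "homogenize a w = cscale (1 / z a) z"
    unfolding w_def by (rule homogenize_affine_coord[OF z za a])
  have upd: "z(j := \<zeta>) = cscale (z a) (homogenize a (w(i := \<zeta> / z a)))" for \<zeta>
    unfolding homogenize_fun_upd i(2) hz using za by (simp add: fun_eq_iff cscale_apply)
  have wu: "w(i := \<zeta>) \<in> cspace N" for \<zeta>
    using w i(1) by (auto simp: cspace_def)
  have "(\<lambda>\<zeta>. F (homogenize a (w(i := \<zeta>)))) field_differentiable at \<zeta>" for \<zeta>
  proof -
    have "(\<lambda>\<xi>. F (homogenize a ((w(i := \<zeta>))(i := \<xi>)))) field_differentiable at ((w(i := \<zeta>)) i)"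
      using aff[OF a] wu[of \<zeta>] i(1) unfolding mv_holomorphic_on_def by blast
    then show ?thesis by simp
  qed
  then have "(\<lambda>\<zeta>. F (homogenize a (w(i := \<zeta>)))) holomorphic_on UNIV"
    by (simp add: holomorphic_on_def)
  moreover have "(\<lambda>\<zeta>. \<zeta> / z a) holomorphic_on UNIV"
    using za by (intro holomorphic_intros) auto
  ultimately have "(\<lambda>\<zeta>. F (homogenize a (w(i := \<zeta> / z a)))) holomorphic_on UNIV"
    using holomorphic_on_compose_gen[of "\<lambda>\<zeta>. \<zeta> / z a" UNIV "\<lambda>\<zeta>. F (homogenize a (w(i := \<zeta>)))" UNIV]
    by (simp add: o_def)
  then have "(\<lambda>\<zeta>. z a * F (homogenize a (w(i := \<zeta> / z a)))) holomorphic_on UNIV"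
    by (intro holomorphic_intros)
  then have holo: "(\<lambda>\<zeta>. F (z(j := \<zeta>))) holomorphic_on UNIV"
    unfolding upd using hom[OF homogenize_punctured[OF wu a] za] by simp
  \<comment> \<open>Division by \<open>\<zeta>\<close> normalizes the \<open>j\<close>-th entry of
    \<open>z(j := \<zeta>)\<close> to 1; its coordinates in the chart \<open>j\<close> are then
    \<open>v\<close> divided by \<open>\<zeta>\<close>, which tend to the origin.\<close>
  define v where "v = (\<lambda>k. z (skip j k))"
  have v: "cscale d v \<in> cspace N" for d
    using z j(1) by (auto simp: v_def cspace_def cscale_def skip_def)
  have upd': "z(j := \<zeta>) = cscale \<zeta> (homogenize j (cscale (inverse \<zeta>) v))" if "\<zeta> \<noteq> 0" for \<zeta>
    using that by (auto simp: fun_eq_iff homogenize_def v_def cscale_apply skip_def)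
  have "((\<lambda>\<zeta>. F (homogenize j (cscale (inverse \<zeta>) v))) \<longlongrightarrow> F (homogenize j (cscale 0 v))) at_infinity"
  proof -
    have "continuous_on UNIV (\<lambda>d. cscale d v)"
      unfolding cscale_def by (intro continuous_intros continuous_on_coordinatewise_then_product)
    moreover have "continuous_on ((\<lambda>d. cscale d v) ` UNIV) (\<lambda>w. F (homogenize j w))"
      using aff[OF j(1)] v unfolding mv_holomorphic_on_def by (blast intro: continuous_on_subset)
    ultimately have "continuous_on UNIV (\<lambda>d. F (homogenize j (cscale d v)))"
      using continuous_on_compose[of UNIV "\<lambda>d. cscale d v" "\<lambda>w. F (homogenize j w)"] by (simp add: o_def)
    then have "isCont (\<lambda>d. F (homogenize j (cscale d v))) 0"
      by (simp add: continuous_on_eq_continuous_at)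
    then show ?thesis
      by (rule isCont_tendsto_compose[OF _ tendsto_inverse_0])
  qed
  moreover have "\<forall>\<^sub>F \<zeta> in at_infinity. F (homogenize j (cscale (inverse \<zeta>) v)) = F (z(j := \<zeta>)) / \<zeta>"
    using eventually_not_equal_at_infinity[of 0]
  proof eventually_elim
    case (elim \<zeta>)
    then show ?case
      unfolding upd'[OF elim] using hom[OF homogenize_punctured[OF v j(1)] elim] by simp
  qed
  ultimately have "((\<lambda>\<zeta>. F (z(j := \<zeta>)) / \<zeta>) \<longlongrightarrow> F (homogenize j (cscale 0 v))) at_infinity"
    by (rule Lim_transform_eventually)
  then have "((\<lambda>\<zeta>. F (z(j := \<zeta>)) / \<zeta>) \<longlongrightarrow> F (axis_vec j 1)) at_infinity"
    unfolding cscale_0 axis_vec_homogenize .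
  from entire_asymptotically_linear[OF holo this, of c]
  show ?thesis
    using j(2) unfolding F_def by (simp add: mult.commute fun_upd_idem)
qed

text \<open>The vector is built up from its truncations \<open>tr k\<close>, and
  \<open>hol_section_fun_upd\<close> accounts for one new entry at a time.\<close>

lemma hol_section_linear:
  assumes s: "s \<in> hol_sections (projective N)" and z: "z \<in> punctured N"
  shows "snd (s (hclass z)) z = (\<Sum>j<Suc N. z j * snd (s (hclass (axis_vec j 1))) (axis_vec j 1))"
proof -
  define F where "F y = snd (s (hclass y)) y" for y
  define tr where "tr k = (\<lambda>j. if j < k then z j else 0)" for k
  have trz: "tr k \<in> cspace (Suc N)" for k using z by (auto simp: tr_def cspace_def)
  have claim: "tr k \<noteq> (\<lambda>_. 0) \<longrightarrow> F (tr k) = (\<Sum>j<k. z j * F (axis_vec j 1))" if "k \<le> Suc N" for k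
    using that
  proof (induction k)
    case 0
    then show ?case by (simp add: tr_def)
  next
    case (Suc k)
    have up: "tr (Suc k) = (tr k)(k := z k)"
      by (auto simp: tr_def fun_eq_iff)
    show ?case
    proof (cases "tr k = (\<lambda>_. 0)")
      \<comment> \<open>The zero truncation represents no point of projective space. The next
        truncation is a multiple of a coordinate vector, so homogeneity replaces
        \<open>hol_section_fun_upd\<close>.\<close>
      case True
      then have zero: "z j = 0" if "j < k" for j
      proof -
        have "tr k j = 0" using True by simp
        then show ?thesis using that by (simp add: tr_def)
      qed
      have e: "tr (Suc k) = cscale (z k) (axis_vec k 1)"
        using zero by (auto simp: tr_def cscale_def axis_vec_def fun_eq_iff less_Suc_eq)
      have "axis_vec k 1 \<in> punctured N"
        unfolding axis_vec_homogenize using Suc.prems by (intro homogenize_punctured) (auto simp: cspace_def)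
      then have "F (tr (Suc k)) = z k * F (axis_vec k 1)" if "z k \<noteq> 0"
        unfolding e F_def using hol_section_homogeneous[OF s _ that] by blast
      then show ?thesis
        using zero e by (auto simp: cscale_eq_0_iff)
    next
      case False
      then have "tr k \<in> punctured N" using trz by simp
      then have "F (tr (Suc k)) = F (tr k) + z k * F (axis_vec k 1)"
        unfolding up F_def using Suc.prems by (intro hol_section_fun_upd[OF s]) (auto simp: tr_def)
      then show ?thesis
        using Suc False by simp
    qed
  qed
  have "tr (Suc N) = z"
    using z by (auto simp: tr_def cspace_def fun_eq_iff)
  then show ?thesis
    using claim[of "Suc N"] z unfolding F_def by simp
qed

lemma hol_sections_projective:
  assumes s: "s \<in> hol_sections (projective N)"
  obtains \<alpha> where "s = section_comb (projective N) \<alpha> (coord_section N) (Suc N)"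
proof -
  define \<alpha> where "\<alpha> j = snd (s (hclass (axis_vec j 1))) (axis_vec j 1)" for j
  have "s = section_comb (projective N) \<alpha> (coord_section N) (Suc N)"
  proof (rule extensionalityI[of _ "proj_space N"])
    show "s \<in> extensional (proj_space N)"
      using s by (auto simp: hol_sections_def PiE_iff)
    show "section_comb (projective N) \<alpha> (coord_section N) (Suc N) \<in> extensional (proj_space N)"
      using section_comb_extensional[of "projective N"] by simp
    fix p assume p: "p \<in> proj_space N"
    then obtain z where z: "z \<in> punctured N" "p = hclass z" by (rule proj_spaceE)
    have "s p \<in> fibre (projective N) p"
      using hol_sections_fibre[OF s] p by simp
    then obtain l where l: "s p = (p, l)" "l \<in> extensional (taut_line p)" "\<And>c. l (cscale c z) = c * l z"
      unfolding z(2) fibre_projective[OF z(1)] by blast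
    have "l = (\<lambda>y\<in>taut_line p. \<Sum>j<Suc N. \<alpha> j * y j)"
    proof (rule extensionalityI[OF l(2)])
      fix y assume y: "y \<in> taut_line p"
      then obtain c where c: "y = cscale c z"
        unfolding z(2) taut_line_hclass by blast
      have "l z = (\<Sum>j<Suc N. \<alpha> j * z j)"
        using hol_section_linear[OF s z(1)] l(1) z(2) by (simp add: \<alpha>_def mult.commute del: sum.lessThan_Suc)
      then have "l y = (\<Sum>j<Suc N. \<alpha> j * y j)"
        unfolding c l(3) cscale_apply by (simp add: sum_distrib_left mult_ac del: sum.lessThan_Suc)
      then show "l y = (\<lambda>y\<in>taut_line p. \<Sum>j<Suc N. \<alpha> j * y j) y"
        using y by (simp only: restrict_apply if_True)
    qed simp
    then show "s p = section_comb (projective N) \<alpha> (coord_section N) (Suc N) p"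
      unfolding section_comb_projective[OF p] l(1) by simp
  qed
  then show ?thesis by (rule that)
qed

lemma coord_section_comb_hol:
  "section_comb (projective N) \<alpha> (coord_section N) (Suc N) \<in> hol_sections (projective N)"
  by (rule section_comb_hol[OF fibrewise_trivialized_projective projective_chart_openin])
    (auto intro: coord_section_hol)

text \<open>The linear form with value 1 at \<open>z\<close> is taken as fibre vector; relative to
  it the section Z_j has the value \<open>z j\<close>, so this choice returns \<open>z\<close>
  itself.\<close>

lemma mem_homog_map_projective:
  assumes p: "p \<in> proj_space N" and z: "z \<in> p"
  shows "z \<in> homog_map (projective N) N (coord_section N) p"
proof -
  have z': "z \<in> punctured N" "p = hclass z"
    using proj_space_mem[OF p z] by auto
  then obtain b where zb: "z b \<noteq> 0" by (auto simp: fun_eq_iff)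
  have b: "b \<le> N" using z' zb by (auto simp: cspace_def not_less_eq_eq)
  have U: "(affine_part N b, hyperplane_coord b) \<in> ltriv (projective N)" "p \<in> affine_part N b"
    using b zb z' hclass_affine_part by auto
  define q where "q = (p, \<lambda>y\<in>taut_line p. y b / z b)"
  note f = fibre_projectiveI[OF z'(1), of "\<lambda>y. y b / z b"]
  have q: "q \<in> fibre (projective N) p" "hyperplane_coord b q = 1 / z b"
    using f zb unfolding q_def z'(2) by (simp_all add: cscale_apply)
  have nz: "q \<in> nonzero_vectors (projective N)"
    using nonzero_vectors_iff[OF fibrewise_trivialized_projective U q(1)] q(2) zb by simp
  have ev: "eval_form (projective N) q (coord_section N j) = z j" if "j \<le> N" for j
  proof -
    have "hyperplane_coord b (coord_section N j p) = z j / z b"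
      using p fibre_projectiveI(2)[OF z'(1), of "\<lambda>y. y j" b, OF cscale_apply zb]
      by (simp add: coord_section_def z'(2))
    moreover have "coord_section N j p \<in> fibre (projective N) p"
      using hol_sections_fibre[OF coord_section_hol[OF that]] p by simp
    moreover have "lproj (projective N) q = p" by (simp add: q_def)
    ultimately show ?thesis
      using eval_form_trivialization[OF fibrewise_trivialized_projective U(1), of q "coord_section N j"]
        U(2) nz q(2) zb by simp
  qed
  have "z = (\<lambda>j. if j \<le> N then eval_form (projective N) q (coord_section N j) else 0)"
    using ev z'(1) by (auto simp: fun_eq_iff cspace_def not_le Suc_le_eq)
  moreover have "lproj (projective N) q = p" by (simp add: q_def)
  ultimately show ?thesis
    unfolding homog_map_def using nz by blast
qed

section \<open>Scalar products of sections of the hyperplane bundle\<close>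

lemma cnorm2_pos: "z \<in> punctured N \<Longrightarrow> cnorm2 (Suc N) z > 0"
proof -
  assume z: "z \<in> punctured N"
  then obtain j where j: "z j \<noteq> 0" by (auto simp: fun_eq_iff)
  then have "j < Suc N" using z by (auto simp: cspace_def not_less)
  then show ?thesis
    unfolding cnorm2_def using j by (intro sum_pos2[where i = j]) auto
qed

lemma continuous_on_cnorm2: "continuous_on S (cnorm2 n)"
  unfolding cnorm2_def[abs_def]
  by (intro continuous_intros continuous_on_subset[OF continuous_on_product_coordinates]) simp

section \<open>A partition of unity on projective space\<close>

definition weight :: "nat \<Rightarrow> nat \<Rightarrow> ppoint \<Rightarrow> real" where
  "weight N a p = (let z = (SOME z. z \<in> p) in (cmod (z a))\<^sup>2 / cnorm2 (Suc N) z)"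

lemma weight_hclass: "weight N a (hclass z) = (cmod (z a))\<^sup>2 / cnorm2 (Suc N) z"
proof -
  have "(SOME y. y \<in> hclass z) \<in> hclass z"
    by (metis hclass_refl someI)
  then obtain c where c: "c \<noteq> 0" "(SOME y. y \<in> hclass z) = cscale c z"
    unfolding hclass_def by blast
  then show ?thesis
    by (simp add: weight_def c cnorm2_cscale cscale_apply norm_mult power_mult_distrib)
qed

lemma continuous_map_weight: "continuous_map (proj_topology N) euclideanreal (weight N a)"
proof (rule continuous_map_proj_topology)
  show "continuous_on (punctured N) (\<lambda>z. weight N a (hclass z))"
    unfolding weight_hclass
    by (intro continuous_intros continuous_on_cnorm2 continuous_on_subset[OF continuous_on_product_coordinates])
      (use cnorm2_pos in \<open>auto simp: less_le\<close>)
qed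

lemma weight_sum: "p \<in> proj_space N \<Longrightarrow> (\<Sum>a\<le>N. weight N a p) = 1"
proof -
  assume "p \<in> proj_space N"
  then obtain z where z: "z \<in> punctured N" "p = hclass z" by (rule proj_spaceE)
  have "(\<Sum>a\<le>N. weight N a p) = (\<Sum>a<Suc N. (cmod (z a))\<^sup>2) / cnorm2 (Suc N) z"
    unfolding z(2) weight_hclass by (simp add: sum_divide_distrib lessThan_Suc_atMost)
  then show ?thesis
    using cnorm2_pos[OF z(1)] by (simp add: cnorm2_def)
qed

text \<open>The \<open>a\<close>-th coordinate point lies in no other affine part. This makes it
  possible to recover the index from a chart, by which the partition is indexed.\<close>

lemma inj_on_affine_part: "inj_on (affine_part N) {..N}"
proof (rule inj_onI)
  fix a b assume ab: "a \<in> {..N}" "b \<in> {..N}" "affine_part N a = affine_part N b"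
  have "axis_vec a 1 \<in> punctured N"
    unfolding axis_vec_homogenize using ab(1) by (intro homogenize_punctured) (auto simp: cspace_def)
  then have "axis_vec a 1 b \<noteq> (0::complex)"
    using hclass_affine_part ab(3) by (metis axis_vec_homogenize homogenize_simps(1) zero_neq_one)
  then show "a = b" by (auto simp: axis_vec_def split: if_splits)
qed

text \<open>The weights add up to 1, but the closure of their supports in general leaves the affine
  part. Subtracting a threshold before truncation confines the support to a closed set of weight at
  least \<open>\<delta>\<close>; division by the sum restores the total 1.\<close>

lemma partition_of_unity_projective: "\<exists>F \<rho>. partition_of_unity (projective N) F \<rho>"
proof -
  \<comment> \<open>Subtracting \<open>\<delta>\<close> from all \<open>Suc N\<close> weights costs
    1/2 of the total weight 1, so the truncated sum stays at least 1/2.\<close>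
  define \<delta> :: real where "\<delta> = 1 / (2 * real (Suc N))"
  define \<eta> where "\<eta> a p = max 0 (weight N a p - \<delta>)" for a p
  define t where "t p = (\<Sum>a\<le>N. \<eta> a p)" for p
  have t: "t p > 0" if "p \<in> proj_space N" for p
  proof -
    have "(\<Sum>a\<le>N. weight N a p - \<delta>) \<le> t p"
      unfolding t_def \<eta>_def by (intro sum_mono) simp
    moreover have "(\<Sum>a\<le>N. weight N a p - \<delta>) = 1 / 2"
      unfolding sum_subtractf weight_sum[OF that] by (simp add: \<delta>_def field_simps)
    ultimately show ?thesis by linarith
  qed
  have \<eta>_cont: "continuous_map (proj_topology N) euclideanreal (\<eta> a)" for a
    unfolding \<eta>_def by (intro continuous_map_real_max continuous_map_diff continuous_map_weight) simp_all
  let ?c = "\<lambda>a. (affine_part N a, affine_coord N a)"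
  define idx where "idx c = inv_into {..N} (affine_part N) (fst c)" for c :: "ppoint chart"
  have idx: "idx (?c a) = a" if "a \<le> N" for a
    using that inj_on_affine_part by (simp add: idx_def)
  define \<rho> where "\<rho> c p = \<eta> (idx c) p / t p" for c p
  have inj: "inj_on ?c {..N}"
    using inj_on_affine_part by (auto simp: inj_on_def)
  have "partition_of_unity (projective N) (?c ` {..N}) \<rho>"
    unfolding partition_of_unity_def
  proof (intro conjI ballI)
    fix c assume "c \<in> ?c ` {..N}"
    then obtain a where a: "a \<le> N" "c = ?c a" by auto
    have \<rho>c: "\<rho> c p = \<eta> a p / t p" for p unfolding \<rho>_def a(2) idx[OF a(1)] ..
    have "continuous_map (proj_topology N) euclideanreal t"
      unfolding t_def by (intro continuous_map_sum \<eta>_cont) simp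
    then show "continuous_map (mtop (projective N)) euclideanreal (\<rho> c)"
      unfolding \<rho>c using t by (simp, intro continuous_map_real_divide \<eta>_cont) (auto simp: less_le)
    show "0 \<le> \<rho> c p" if "p \<in> points (projective N)" for p
      unfolding \<rho>c using t[of p] that by (intro divide_nonneg_pos) (auto simp: \<eta>_def)
    let ?S = "{p \<in> topspace (proj_topology N). weight N a p \<in> {\<delta>..}}"
    have "closedin (proj_topology N) ?S"
      by (intro closedin_continuous_map_preimage[OF continuous_map_weight]) simp
    moreover have "{p \<in> topspace (proj_topology N). \<rho> c p \<noteq> 0} \<subseteq> ?S"
      unfolding \<rho>c \<eta>_def by (auto simp: max_def split: if_splits)
    ultimately have "proj_topology N closure_of {p \<in> topspace (proj_topology N). \<rho> c p \<noteq> 0} \<subseteq> ?S"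
      by (simp only: closure_of_minimal)
    also have "?S \<subseteq> fst c"
    proof
      fix p assume p: "p \<in> ?S"
      then obtain z where z: "z \<in> punctured N" "p = hclass z" using proj_spaceE by auto
      have "\<delta> > 0" by (simp add: \<delta>_def)
      then have "z a \<noteq> 0" using p by (auto simp: z(2) weight_hclass)
      then show "p \<in> fst c" using z hclass_affine_part a(2) by simp
    qed
    finally show "mtop (projective N) closure_of {x \<in> points (projective N). \<rho> c x \<noteq> 0} \<subseteq> fst c" by simp
  next
    fix p assume "p \<in> points (projective N)"
    then have p: "p \<in> proj_space N" by simp
    have "(\<Sum>c\<in>?c ` {..N}. \<rho> c p) = (\<Sum>a\<le>N. \<rho> (?c a) p)"
      by (rule sum.reindex_cong[OF inj]) auto
    also have "\<dots> = (\<Sum>a\<le>N. \<eta> a p / t p)"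
      by (intro sum.cong refl) (simp add: \<rho>_def idx)
    also have "\<dots> = 1"
      using t[OF p] by (simp add: t_def flip: sum_divide_distrib)
    finally show "(\<Sum>c\<in>?c ` {..N}. \<rho> c p) = 1" .
  qed auto
  then show ?thesis by blast
qed

section \<open>The Gram matrix of the coordinate sections\<close>

lemma hyperplane_metric_hclass:
  assumes "\<And>c. l (cscale c z) = c * l z" "\<And>c. l' (cscale c z) = c * l' z"
  shows "hyperplane_metric N (hclass z, l) (hclass z, l') = cnj (l z) * l' z / of_real (cnorm2 (Suc N) z)"
proof -
  have e: "cnj (l y) * l' y / of_real (cnorm2 (Suc N) y) = cnj (l z) * l' z / of_real (cnorm2 (Suc N) z)"
    if y: "y \<in> hclass z" for y
  proof -
    obtain d where d: "d \<noteq> 0" "y = cscale d z" using y unfolding hclass_def by blast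
    have "complex_of_real ((cmod d)\<^sup>2) = d * cnj d" by (metis complex_norm_square of_real_power)
    then show ?thesis
      unfolding d(2) assms cnorm2_cscale of_real_mult using d(1) by simp
  qed
  have "(\<forall>y\<in>hclass z. c = cnj (l y) * l' y / of_real (cnorm2 (Suc N) y)) \<longleftrightarrow>
      c = cnj (l z) * l' z / of_real (cnorm2 (Suc N) z)" for c
  proof
    assume "\<forall>y\<in>hclass z. c = cnj (l y) * l' y / of_real (cnorm2 (Suc N) y)"
    then show "c = cnj (l z) * l' z / of_real (cnorm2 (Suc N) z)"
      by (rule bspec[OF _ hclass_refl])
  next
    assume "c = cnj (l z) * l' z / of_real (cnorm2 (Suc N) z)"
    then show "\<forall>y\<in>hclass z. c = cnj (l y) * l' y / of_real (cnorm2 (Suc N) y)"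
      using trans[OF _ e[symmetric]] by blast
  qed
  then show ?thesis
    unfolding hyperplane_metric_def by simp
qed

lemma lmetric_section_comb_projective:
  assumes z: "z \<in> punctured N"
  shows "lmetric (projective N) (section_comb (projective N) \<alpha> (coord_section N) n (hclass z))
      (section_comb (projective N) \<beta> (coord_section N) n (hclass z)) =
    (\<Sum>j<n. \<Sum>k<n. cnj (\<alpha> j) * \<beta> k * (cnj (z j) * z k / of_real (cnorm2 (Suc N) z)))"
proof -
  let ?l = "\<lambda>\<alpha>. \<lambda>y\<in>taut_line (hclass z). \<Sum>j<n. \<alpha> j * y j"
  have lin: "?l \<alpha> (cscale c z) = c * ?l \<alpha> z" for \<alpha> c
    unfolding restrict_taut_line by (simp add: cscale_apply sum_distrib_left mult.left_commute)
  have "lmetric (projective N) (section_comb (projective N) \<alpha> (coord_section N) n (hclass z))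
      (section_comb (projective N) \<beta> (coord_section N) n (hclass z)) =
      cnj (?l \<alpha> z) * ?l \<beta> z / of_real (cnorm2 (Suc N) z)"
    unfolding section_comb_projective[OF hclass_proj_space[OF z]] projective_simps
    by (rule hyperplane_metric_hclass) (rule lin)+
  also have "\<dots> = (\<Sum>j<n. \<Sum>k<n. cnj (\<alpha> j) * \<beta> k * (cnj (z j) * z k / of_real (cnorm2 (Suc N) z)))"
    unfolding restrict_taut_line cnj_sum sum_product sum_divide_distrib
    by (intro sum.cong refl) simp
  finally show ?thesis .
qed

text \<open>Mediates between two conventions: vectors of the finite product are undefined outside
  the index set, those of \<open>cspace n\<close> are zero there.\<close>

definition zero_ext :: "nat \<Rightarrow> cvec \<Rightarrow> cvec" where
  "zero_ext n w = (\<lambda>j. if j < n then w j else 0)"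

lemma zero_ext_cspace: "zero_ext n w \<in> cspace n"
  by (simp add: zero_ext_def cspace_def)

lemma cnorm2_zero_ext [simp]: "cnorm2 n (zero_ext n w) = cnorm2 n w"
  by (simp add: cnorm2_def zero_ext_def)

lemma zero_ext_affine_vec:
  "a \<le> n \<Longrightarrow> zero_ext n (affine_vec n a z) = affine_coord n a (hclass (zero_ext (Suc n) z))"
  unfolding affine_coord_hclass by (auto simp: zero_ext_def affine_vec_def skip_def fun_eq_iff)

lemma zero_ext_punctured: "zero_ext (Suc n) z \<in> punctured n \<longleftrightarrow> cnorm2 (Suc n) z \<noteq> 0"
proof
  assume "zero_ext (Suc n) z \<in> punctured n"
  from cnorm2_pos[OF this] show "cnorm2 (Suc n) z \<noteq> 0" by simp
next
  assume "cnorm2 (Suc n) z \<noteq> 0"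
  then have "zero_ext (Suc n) z \<noteq> (\<lambda>_. 0)"
    using cnorm2_zero_ext[of "Suc n" z] by (auto simp: cnorm2_def)
  then show "zero_ext (Suc n) z \<in> punctured n" using zero_ext_cspace by simp
qed

lemma measurable_zero_ext [measurable]: "zero_ext n \<in> lborel_vec {..<n} \<rightarrow>\<^sub>M borel"
  unfolding zero_ext_def[abs_def] by (rule measurable_zero_extension)

lemma clebesgue_zero_ext: "clebesgue n = distr (lborel_vec {..<n}) borel (zero_ext n)"
  by (simp add: clebesgue_def zero_ext_def[abs_def])

definition ball_lift :: "nat \<Rightarrow> (ppoint \<Rightarrow> complex) \<Rightarrow> cvec \<Rightarrow> complex" where
  "ball_lift N f z = indicator {z. cnorm2 (Suc N) z \<le> 1 \<and> cnorm2 (Suc N) z \<noteq> 0} z *\<^sub>R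
     f (hclass (zero_ext (Suc N) z))"

text \<open>
  Every chart contributes the integral over the unit ball of the integrand cut off by its member of the
  partition of unity; hence the partition disappears in the sum.
\<close>

lemma chart_integral_projective:
  "\<exists>L>0. \<forall>F \<rho> c G. partition_of_unity (projective N) F \<rho> \<longrightarrow> c \<in> F \<longrightarrow>
      continuous_on (punctured N) (\<lambda>z. G (hclass z)) \<longrightarrow>
      ball_lift N (\<lambda>p. \<rho> c p *\<^sub>R G p) \<in> borel_measurable (lborel_vec {..<Suc N}) \<and>
      (LINT w : snd c ` fst c | clebesgue N.
         (\<rho> c (chart_inv c w) * liouville_density N (fubini_study N c w)) *\<^sub>R G (chart_inv c w)) =
      L *\<^sub>R (\<integral>z. ball_lift N (\<lambda>p. \<rho> c p *\<^sub>R G p) z \<partial>lborel_vec {..<Suc N})"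
proof -
  obtain K where K: "K > 0" "\<And>c w. liouville_density N (fubini_study N c w) = K / (1 + cnorm2 N w) ^ Suc N"
    using liouville_density_fubini_study[of N] by metis
  obtain C where C: "C > 0" "\<And>a f. a \<le> N \<Longrightarrow> (f :: cvec \<Rightarrow> complex) \<in> borel_measurable (lborel_vec {..<N}) \<Longrightarrow>
      (\<integral>z. indicator {z. cnorm2 (Suc N) z \<le> 1 \<and> z a \<noteq> 0} z *\<^sub>R f (affine_vec N a z) \<partial>lborel_vec {..<Suc N}) =
      C *\<^sub>R (\<integral>w. (1 / (1 + cnorm2 N w) ^ Suc N) *\<^sub>R f w \<partial>lborel_vec {..<N})"
    using integral_ball_affine[of N] by blast
  \<comment> \<open>\<open>K\<close> belongs to the Liouville density and \<open>C\<close> to the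
    ball. Neither depends on the chart, so one factor serves all charts.\<close>
  show ?thesis
  proof (intro exI[of _ "K / C"] conjI[of "K / C > 0"] allI impI, goal_cases)
    case 1
    then show ?case using K C by simp
  next
    case (2 F \<rho> c G)
    obtain a where a: "a \<le> N" "c = (affine_part N a, affine_coord N a)"
      using 2(1,2) unfolding partition_of_unity_def by auto
    have D: "snd c ` fst c = cspace N"
      using a by (simp add: affine_coord_image_self)
    have inv: "chart_inv c w = hclass (homogenize a w)" if "w \<in> cspace N" for w
      using chart_inv_affine[OF a(1) that] a(2) by simp
    have \<rho>cont: "continuous_map (proj_topology N) euclideanreal (\<rho> c)"
      and \<rho>supp: "proj_topology N closure_of {p \<in> proj_space N. \<rho> c p \<noteq> 0} \<subseteq> fst c"
      using 2(1)[unfolded partition_of_unity_def, THEN conjunct2, THEN conjunct2, THEN conjunct1,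
          THEN bspec, OF 2(2)] by simp_all
    define H where "H w = \<rho> c (hclass (homogenize a w)) *\<^sub>R G (hclass (homogenize a w))" for w
    have homc: "continuous_on (cspace N) (homogenize a)"
      by (intro continuous_on_coordinatewise_then_product continuous_on_homogenize)
    have hom_in: "homogenize a ` cspace N \<subseteq> punctured N"
      by (intro image_subsetI homogenize_punctured a(1))
    have "continuous_map (top_of_set (punctured N)) euclideanreal (\<rho> c \<circ> hclass)"
      by (rule continuous_map_compose[OF continuous_map_hclass \<rho>cont])
    then have "continuous_on (punctured N) (\<lambda>z. \<rho> c (hclass z))"
      by (simp add: continuous_map_iff_continuous o_def)
    then have "continuous_on (punctured N) (\<lambda>z. \<rho> c (hclass z) *\<^sub>R G (hclass z))"
      using 2(3) by (intro continuous_intros)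
    then have Hc: "continuous_on (cspace N) H"
      using continuous_on_compose2[OF _ homc hom_in] unfolding H_def by blast
    \<comment> \<open>Continuity of \<open>H\<close> is known on \<open>cspace N\<close>; the
      indicator extends it to a Borel function of all sequences, and \<open>zero_ext\<close> takes
      values where the indicator is 1.\<close>
    have Hm: "(\<lambda>w. indicator (cspace N) w *\<^sub>R H w) \<in> borel_measurable borel"
      by (rule borel_measurable_continuous_on_indicator[OF _ Hc]) (simp add: closed_cspace)
    have f: "(\<lambda>w. H (zero_ext N w)) \<in> borel_measurable (lborel_vec {..<N})"
      using measurable_compose[OF measurable_zero_ext[of N] Hm] by (simp add: zero_ext_cspace)
    let ?E = "\<lambda>z. indicator {z. cnorm2 (Suc N) z \<le> 1 \<and> cnorm2 (Suc N) z \<noteq> 0} z *\<^sub>R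
         (\<rho> c (hclass (zero_ext (Suc N) z)) *\<^sub>R (G (hclass (zero_ext (Suc N) z)) :: complex))"
    \<comment> \<open>Where \<open>z a = 0\<close> the member of the partition vanishes, its support
      being contained in the affine part \<open>a\<close>. The condition
      \<open>z a \<noteq> 0\<close> can thus be traded for a nonzero norm, which does not mention
      the chart.\<close>
    have E: "?E z = indicator {z. cnorm2 (Suc N) z \<le> 1 \<and> z a \<noteq> 0} z *\<^sub>R H (zero_ext N (affine_vec N a z))" for z
    proof (cases "z a = 0")
      case True
      have "?E z = 0"
      proof (cases "cnorm2 (Suc N) z = 0")
        case False
        let ?z = "zero_ext (Suc N) z"
        have z: "?z \<in> punctured N" using False zero_ext_punctured by blast
        have "hclass ?z \<notin> affine_part N a"
          using True hclass_affine_part[OF z] by (simp add: zero_ext_def)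
        moreover have "{p \<in> proj_space N. \<rho> c p \<noteq> 0} \<subseteq> proj_topology N closure_of {p \<in> proj_space N. \<rho> c p \<noteq> 0}"
          by (rule closure_of_subset) auto
        ultimately have "\<rho> c (hclass ?z) = 0"
          using \<rho>supp hclass_proj_space[OF z] a(2) by auto
        then show ?thesis by simp
      qed simp
      then show ?thesis using True by simp
    next
      case False
      let ?z = "zero_ext (Suc N) z"
      have za: "?z a \<noteq> 0" using False a(1) by (simp add: zero_ext_def)
      then have "?z \<noteq> (\<lambda>_. 0)" by auto
      then have z: "?z \<in> punctured N" using zero_ext_cspace by simp
      have "hclass ?z \<in> affine_part N a" using z za hclass_affine_part by blast
      then have "H (zero_ext N (affine_vec N a z)) = \<rho> c (hclass ?z) *\<^sub>R G (hclass ?z)"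
        unfolding H_def zero_ext_affine_vec[OF a(1)] by (simp add: hclass_homogenize_affine_coord[OF _ a(1)])
      then show ?thesis
        using False z zero_ext_punctured by (simp add: indicator_def)
    qed
    have m: "?E \<in> borel_measurable (lborel_vec {..<Suc N})"
    proof -
      have [measurable]: "(\<lambda>z. H (zero_ext N (affine_vec N a z))) \<in> borel_measurable (lborel_vec {..<Suc N})"
        using measurable_compose[OF measurable_affine_vec[OF a(1)] f] .
      have [measurable]: "a \<in> {..<Suc N}" using a(1) by simp
      show ?thesis unfolding E by measurable
    qed
    have "(LINT w : snd c ` fst c | clebesgue N.
         (\<rho> c (chart_inv c w) * liouville_density N (fubini_study N c w)) *\<^sub>R G (chart_inv c w)) =
      (LINT w | clebesgue N. (K / (1 + cnorm2 N w) ^ Suc N) *\<^sub>R (indicator (cspace N) w *\<^sub>R H w))"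
      unfolding set_lebesgue_integral_def D K(2)
      by (intro Bochner_Integration.integral_cong refl) (auto simp: indicator_def inv H_def)
    also have "\<dots> = (\<integral>w. (K / (1 + cnorm2 N w) ^ Suc N) *\<^sub>R H (zero_ext N w) \<partial>lborel_vec {..<N})"
    proof -
      have "cnorm2 N \<in> borel_measurable borel"
        by (intro borel_measurable_continuous_onI continuous_on_cnorm2)
      then have "(\<lambda>w. (K / (1 + cnorm2 N w) ^ Suc N) *\<^sub>R (indicator (cspace N) w *\<^sub>R H w)) \<in> borel_measurable borel"
        using Hm by measurable
      from integral_distr[OF measurable_zero_ext[of N] this] show ?thesis
        unfolding clebesgue_zero_ext by (simp add: zero_ext_cspace)
    qed
    also have "\<dots> = K *\<^sub>R (\<integral>w. (1 / (1 + cnorm2 N w) ^ Suc N) *\<^sub>R H (zero_ext N w) \<partial>lborel_vec {..<N})"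
      by (simp flip: integral_scaleR_right)
    also have "\<dots> = (K / C) *\<^sub>R (\<integral>z. ?E z \<partial>lborel_vec {..<Suc N})"
      unfolding E C(2)[OF a(1) f] using C(1) by simp
    finally show ?case
      unfolding ball_lift_def using m by blast
  qed
qed

text \<open>\<open>\<kappa>\<close> is the product of the chart normalization \<open>L\<close> and
  the diagonal Gram integral \<open>I\<close> over the ball; the off-diagonal integrals
  vanish.\<close>

lemma section_inner_projective:
  "\<exists>\<kappa>>0. \<forall>\<alpha> \<beta>. section_inner (projective N) (section_comb (projective N) \<alpha> (coord_section N) (Suc N))
      (section_comb (projective N) \<beta> (coord_section N) (Suc N)) = of_real \<kappa> * cinner (Suc N) \<alpha> \<beta>"
proof -
  let ?Q = "projective N"
  let ?comb = "\<lambda>\<alpha>. section_comb ?Q \<alpha> (coord_section N) (Suc N)"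
  let ?M = "lborel_vec {..<Suc N}"
  obtain F \<rho> where F: "(SOME (F, \<rho>). partition_of_unity ?Q F \<rho>) = (F, \<rho>)"
    by fastforce
  obtain F0 \<rho>0 where "partition_of_unity ?Q F0 \<rho>0"
    using partition_of_unity_projective by blast
  then have P: "partition_of_unity ?Q F \<rho>"
    using someI[of "\<lambda>(F, \<rho>). partition_of_unity ?Q F \<rho>" "(F0, \<rho>0)"] F by simp
  have finF: "finite F" and \<rho>sum: "\<And>p. p \<in> proj_space N \<Longrightarrow> (\<Sum>c\<in>F. \<rho> c p) = 1"
    and \<rho>nn: "\<And>c p. c \<in> F \<Longrightarrow> p \<in> proj_space N \<Longrightarrow> 0 \<le> \<rho> c p"
    using P unfolding partition_of_unity_def by simp_all
  obtain I where I: "I > 0" "(\<integral>z. ball_gram (Suc N) 0 0 z \<partial>?M) = of_real I"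
    using ball_gram_pos[of "Suc N"] by auto
  obtain L where "L > 0" and L: "\<forall>F \<rho> c G. partition_of_unity (projective N) F \<rho> \<longrightarrow> c \<in> F \<longrightarrow>
      continuous_on (punctured N) (\<lambda>z. G (hclass z)) \<longrightarrow>
      ball_lift N (\<lambda>p. \<rho> c p *\<^sub>R G p) \<in> borel_measurable (lborel_vec {..<Suc N}) \<and>
      (LINT w : snd c ` fst c | clebesgue N.
         (\<rho> c (chart_inv c w) * liouville_density N (fubini_study N c w)) *\<^sub>R G (chart_inv c w)) =
      L *\<^sub>R (\<integral>z. ball_lift N (\<lambda>p. \<rho> c p *\<^sub>R G p) z \<partial>lborel_vec {..<Suc N})"
    using chart_integral_projective[of N] by blast
  have "section_inner ?Q (?comb \<alpha>) (?comb \<beta>) = of_real (L * I) * cinner (Suc N) \<alpha> \<beta>" for \<alpha> \<beta>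
  proof -
    define G where "G p = lmetric ?Q (?comb \<alpha> p) (?comb \<beta> p)" for p
    have G: "G (hclass z) = (\<Sum>j<Suc N. \<Sum>k<Suc N. cnj (\<alpha> j) * \<beta> k * (cnj (z j) * z k / of_real (cnorm2 (Suc N) z)))"
      if "z \<in> punctured N" for z
      unfolding G_def by (rule lmetric_section_comb_projective[OF that])
    have Gc: "continuous_on (punctured N) (\<lambda>z. G (hclass z))"
    proof (rule iffD2[OF continuous_on_cong[OF refl G]])
      show "continuous_on (punctured N)
          (\<lambda>z. \<Sum>j<Suc N. \<Sum>k<Suc N. cnj (\<alpha> j) * \<beta> k * (cnj (z j) * z k / of_real (cnorm2 (Suc N) z)))"
        by (intro continuous_intros continuous_on_cnorm2 continuous_on_subset[OF continuous_on_product_coordinates])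
          (use cnorm2_pos in \<open>auto simp: less_le\<close>)
    qed simp
    let ?i = "\<lambda>z. indicator {z. cnorm2 (Suc N) z \<le> 1 \<and> cnorm2 (Suc N) z \<noteq> 0} z :: real"
    let ?E = "\<lambda>c z. ?i z *\<^sub>R (\<rho> c (hclass (zero_ext (Suc N) z)) *\<^sub>R G (hclass (zero_ext (Suc N) z)))"
    have "?E c \<in> borel_measurable ?M \<and>
        (LINT w : snd c ` fst c | clebesgue N.
         (\<rho> c (chart_inv c w) * liouville_density N (fubini_study N c w)) *\<^sub>R G (chart_inv c w)) =
         L *\<^sub>R (\<integral>z. ?E c z \<partial>?M)" if "c \<in> F" for c
      by (rule L[rule_format, OF P that, of G, OF Gc, unfolded ball_lift_def[abs_def]])
    note E = this[THEN conjunct1] this[THEN conjunct2]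
    have gram: "?i z *\<^sub>R G (hclass (zero_ext (Suc N) z)) =
        (\<Sum>j<Suc N. \<Sum>k<Suc N. cnj (\<alpha> j) * \<beta> k * ball_gram (Suc N) j k z)" for z
    proof (cases "cnorm2 (Suc N) z = 0")
      case False
      have "G (hclass (zero_ext (Suc N) z)) =
          (\<Sum>j<Suc N. \<Sum>k<Suc N. cnj (\<alpha> j) * \<beta> k * (cnj (z j) * z k / of_real (cnorm2 (Suc N) z)))"
        using False G[of "zero_ext (Suc N) z"] zero_ext_punctured[of N z]
        by (simp add: zero_ext_def[of _ z] cong: sum.cong_simp) (simp add: zero_ext_def[symmetric])
      then show ?thesis
        using False by (simp add: ball_gram_def indicator_def)
    qed (simp add: ball_gram_def)
    have int: "integrable ?M (\<lambda>z. ?i z *\<^sub>R G (hclass (zero_ext (Suc N) z)))"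
      unfolding gram by (intro Bochner_Integration.integrable_sum integrable_mult_right integrable_ball_gram) auto
    \<comment> \<open>The members of the partition lie between 0 and 1, so the integrand without the
      partition, a combination of Gram integrands, dominates each chart contribution.\<close>
    have Eint: "integrable ?M (?E c)" if c: "c \<in> F" for c
    proof (rule Bochner_Integration.integrable_bound[OF int E(1)[OF c]], intro AE_I2)
      fix z
      show "norm (?E c z) \<le> norm (?i z *\<^sub>R G (hclass (zero_ext (Suc N) z)))"
      proof (cases "cnorm2 (Suc N) z = 0")
        case False
        then have p: "hclass (zero_ext (Suc N) z) \<in> proj_space N"
          using zero_ext_punctured hclass_proj_space by blast
        then have "\<rho> c (hclass (zero_ext (Suc N) z)) \<le> (\<Sum>c\<in>F. \<rho> c (hclass (zero_ext (Suc N) z)))"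
          using c finF \<rho>nn by (intro member_le_sum) auto
        then have "\<bar>\<rho> c (hclass (zero_ext (Suc N) z))\<bar> \<le> 1"
          using \<rho>sum[OF p] \<rho>nn[OF c p] by simp
        then show ?thesis
          by (auto simp: indicator_def intro: mult_left_le_one_le)
      qed simp
    qed
    have "section_inner ?Q (?comb \<alpha>) (?comb \<beta>) = (\<Sum>c\<in>F. L *\<^sub>R (\<integral>z. ?E c z \<partial>?M))"
      unfolding section_inner_def volume_integral_def F using E(2) by (simp add: G_def)
    also have "\<dots> = L *\<^sub>R (\<integral>z. (\<Sum>c\<in>F. ?E c z) \<partial>?M)"
      using Eint by (simp only: Bochner_Integration.integral_sum scaleR_sum_right)
    also have "(\<lambda>z. \<Sum>c\<in>F. ?E c z) = (\<lambda>z. ?i z *\<^sub>R G (hclass (zero_ext (Suc N) z)))"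
    proof
      fix z
      show "(\<Sum>c\<in>F. ?E c z) = ?i z *\<^sub>R G (hclass (zero_ext (Suc N) z))"
      proof (cases "cnorm2 (Suc N) z = 0")
        case False
        then have "hclass (zero_ext (Suc N) z) \<in> proj_space N"
          using zero_ext_punctured hclass_proj_space by blast
        from \<rho>sum[OF this] show ?thesis
          by (simp only: scaleR_sum_right[symmetric] scaleR_sum_left[symmetric] scaleR_one)
      qed simp
    qed
    also have "(\<integral>z. ?i z *\<^sub>R G (hclass (zero_ext (Suc N) z)) \<partial>?M) =
        (\<Sum>j<Suc N. \<integral>z. (\<Sum>k<Suc N. cnj (\<alpha> j) * \<beta> k * ball_gram (Suc N) j k z) \<partial>?M)"
      unfolding gram
      by (intro Bochner_Integration.integral_sum Bochner_Integration.integrable_sum integrable_mult_right integrable_ball_gram) auto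
    also have "\<dots> = (\<Sum>j<Suc N. \<Sum>k<Suc N. \<integral>z. cnj (\<alpha> j) * \<beta> k * ball_gram (Suc N) j k z \<partial>?M)"
      by (intro sum.cong refl Bochner_Integration.integral_sum integrable_mult_right integrable_ball_gram) auto
    also have "\<dots> = (\<Sum>j<Suc N. \<Sum>k<Suc N. if k = j then cnj (\<alpha> j) * \<beta> j * of_real I else 0)"
    proof (intro sum.cong refl)
      fix j k assume "j \<in> {..<Suc N}" "k \<in> {..<Suc N}"
      then have jk: "j < Suc N" "k < Suc N" by auto
      have "(\<integral>z. ball_gram (Suc N) j k z \<partial>?M) = (if k = j then of_real I else 0)"
        using ball_gram_orthogonal[OF jk] ball_gram_diagonal[OF jk(1)] I(2) by auto
      then show "(\<integral>z. cnj (\<alpha> j) * \<beta> k * ball_gram (Suc N) j k z \<partial>?M) =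
          (if k = j then cnj (\<alpha> j) * \<beta> j * of_real I else 0)"
        by simp
    qed
    also have "\<dots> = of_real I * cinner (Suc N) \<alpha> \<beta>"
      unfolding cinner_def sum_distrib_left by (intro sum.cong refl) (simp add: sum.delta mult_ac)
    finally show ?thesis
      by (simp only: scaleR_conv_of_real of_real_mult mult.assoc)
  qed
  moreover have "L * I > 0" using \<open>L > 0\<close> I(1) by simp
  ultimately show ?thesis by blast
qed

text \<open>Conversely to \<open>homog_map_cscale\<close>, dividing the fibre vector
  \<open>q\<close> by \<open>c\<close> multiplies all values of the form by \<open>c\<close>, so
  every multiple occurs.\<close>

lemma homog_map_eq_hclass:
  assumes triv: "fibrewise_trivialized Q" and s: "\<And>j. j \<le> N \<Longrightarrow> s j \<in> hol_sections Q"
    and u: "u \<in> homog_map Q N s x"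
  shows "homog_map Q N s x = hclass u"
proof (intro subset_antisym subsetI)
  fix v assume "v \<in> homog_map Q N s x"
  then obtain c where "c \<noteq> 0" "v = cscale c u"
    using homog_map_cscale[where Q = Q and N = N and s = s, OF triv s u] by blast
  then show "v \<in> hclass u" unfolding hclass_def by blast
next
  fix v assume "v \<in> hclass u"
  then obtain c where c: "c \<noteq> 0" "v = cscale c u" unfolding hclass_def by blast
  obtain q where q: "q \<in> nonzero_vectors Q" "lproj Q q = x"
      "u = (\<lambda>j. if j \<le> N then eval_form Q q (s j) else 0)"
    using u unfolding homog_map_def by blast
  have x: "x \<in> points Q"
    using triv q by (auto simp: fibrewise_trivialized_def nonzero_vectors_def)
  obtain U \<tau> where U: "(U, \<tau>) \<in> ltriv Q" "x \<in> U"
    using trivialization_at[OF triv x] .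
  note t = fibre_trivialization[OF triv U]
  have qf: "q \<in> fibre Q x" using q by (auto simp: fibre_def nonzero_vectors_def)
  define q' where "q' = lsmul Q (1 / c) q"
  have q'f: "q' \<in> fibre Q x" and \<tau>q': "\<tau> q' = \<tau> q / c"
    using t(7,8)[OF qf] by (auto simp: q'_def)
  have q'x: "lproj Q q' = x" using q'f by (simp add: fibre_def)
  have q'n: "q' \<in> nonzero_vectors Q"
    using nonzero_vectors_iff[OF triv U qf] nonzero_vectors_iff[OF triv U q'f] q(1) \<tau>q' c(1) by simp
  have "eval_form Q q' (s j) = c * eval_form Q q (s j)" if "j \<le> N" for j
    using eval_form_trivialization[OF triv U(1), of q "s j"] eval_form_trivialization[OF triv U(1), of q' "s j"]
      U(2) q(1,2) q'n q'x \<tau>q' hol_sections_fibre[OF s[OF that] x] by simp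
  then have "v = (\<lambda>j. if j \<le> N then eval_form Q q' (s j) else 0)"
    unfolding c(2) q(3) cscale_def by auto
  then show "v \<in> homog_map Q N s x"
    unfolding homog_map_def using q'n q'x by blast
qed

text \<open>If all \<open>s j\<close> vanished at \<open>x\<close>, so would every combination of
  them.\<close>

lemma homog_map_punctured:
  assumes triv: "fibrewise_trivialized Q" and s: "\<And>j. j \<le> N \<Longrightarrow> s j \<in> hol_sections Q"
    and span: "t = section_comb Q a s (Suc N)" and tx: "t x \<noteq> lzero Q x"
    and u: "u \<in> homog_map Q N s x"
  shows "u \<in> punctured N"
proof -
  obtain q where q: "q \<in> nonzero_vectors Q" "lproj Q q = x"
      "u = (\<lambda>j. if j \<le> N then eval_form Q q (s j) else 0)"
    using u unfolding homog_map_def by blast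
  have x: "x \<in> points Q"
    using triv q by (auto simp: fibrewise_trivialized_def nonzero_vectors_def)
  obtain U \<tau> where U: "(U, \<tau>) \<in> ltriv Q" "x \<in> U"
    using trivialization_at[OF triv x] .
  note f = fibre_trivialization[OF triv U]
  have sf: "s j x \<in> fibre Q x" if "j < Suc N" for j
    using hol_sections_fibre[OF s x] that by simp
  note c = section_comb_trivialization[where b = s and a = a and k = "Suc N", OF triv U sf]
  have "\<tau> (t x) \<noteq> 0"
    using inj_onD[OF f(1), of "t x" "lzero Q x"] c(1) f(3,4) tx span by auto
  then obtain j where j: "j < Suc N" "\<tau> (s j x) \<noteq> 0"
    using c(2) span by (metis (no_types, lifting) lessThan_iff mult_zero_right sum.neutral)
  have qf: "q \<in> fibre Q x" using q by (auto simp: fibre_def nonzero_vectors_def)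
  have "\<tau> q \<noteq> 0" using nonzero_vectors_iff[OF triv U qf] q(1) by simp
  then have "eval_form Q q (s j) \<noteq> 0"
    using eval_form_trivialization[OF triv U(1), of q "s j"] U(2) q(1,2) sf[OF j(1)] j(2) by simp
  then have "u j \<noteq> 0" using j(1) q(3) by simp
  then have "u \<noteq> (\<lambda>_. 0)" by auto
  moreover have "u \<in> cspace (Suc N)" unfolding q(3) by (simp add: cspace_def)
  ultimately show ?thesis by simp
qed

theorem proposition4p7:
  fixes Q :: "('p, 'l) quantized" and N m :: nat
    and s :: "nat \<Rightarrow> 'p \<Rightarrow> 'l" and r :: "'p \<Rightarrow> cvec"
  assumes "complex_manifold Q" and "compact_space (mtop Q)" and "connected_space (mtop Q)"
    and "kaehler_form Q (kform Q)"
    and "quantum_line_bundle Q"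
    and "very_ample Q"
    and "orthonormal_section_basis Q N s"
    and "\<And>x. x \<in> points Q \<Longrightarrow> r x \<in> homog_map Q N s x"
    and "m \<ge> 2"
  shows "(\<forall>x. (\<forall>k<m. x k \<in> points Q) \<longrightarrow>
      cyclic_fun Q m x = pullback (homog_map Q N s) (cyclic_fun (projective N) m) x \<and>
      pullback (homog_map Q N s) (cyclic_fun (projective N) m) x =
        cyclic_fun (projective N) m (\<lambda>k. homog_map Q N s (x k)) \<and>
      cyclic_fun (projective N) m (\<lambda>k. homog_map Q N s (x k)) =
        (\<Prod>k<m. cinner (Suc N) (r (x (Suc k mod m))) (r (x k))) /
        of_real (\<Prod>k<m. cnorm2 (Suc N) (r (x k)))) \<and>
    (\<forall>x d. (\<forall>k<m. x k \<in> points Q) \<longrightarrow>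
      cyclic_fun Q m (\<lambda>k. x ((k + d) mod m)) = cyclic_fun Q m x)"
proof -
  have hol_bundle: "holomorphic_line_bundle Q" and herm: "hermitian_metric Q"
    using assms(5) unfolding quantum_line_bundle_def by auto
  note triv = holomorphic_line_bundle_fibrewise[OF hol_bundle]
  have form: "two_form_on Q (kform Q)"
    using assms(4) unfolding kaehler_form_def by blast
  have basis: "section_basis Q N s" and
    ortho: "\<And>j k. j \<le> N \<Longrightarrow> k \<le> N \<Longrightarrow> section_inner Q (s j) (s k) = (if j = k then 1 else 0)"
    using assms(7) unfolding orthonormal_section_basis_def by auto
  have hol: "s j \<in> hol_sections Q" if "j \<le> N" for j
    using basis that unfolding section_basis_def by blast
  have span: "\<exists>a. t = section_comb Q a s (Suc N)" if "t \<in> hol_sections Q" for t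
    using basis that unfolding section_basis_def by blast
  have M: "orthogonal_sections Q N s 1"
  proof
    show "section_comb Q a s (Suc N) \<in> hol_sections Q" for a
    proof (rule section_comb_hol[OF triv])
      fix c U \<tau> assume c: "c \<in> charts Q" and U: "(U, \<tau>) \<in> ltriv Q"
      have "openin (mtop Q) U"
        by (rule fibrewise_trivializedD(1)[OF triv U])
      then show "openin (top_of_set (cspace (cdim Q))) (snd c ` (fst c \<inter> U)) \<and> inj_on (snd c) (fst c)"
        using chart_image_openin(1)[OF assms(1) c] complex_manifold_chart(4)[OF assms(1) c] by blast
    qed (simp add: hol)
    show "section_inner Q (section_comb Q a s (Suc N)) (section_comb Q b s (Suc N)) =
        of_real 1 * cinner (Suc N) a b" for a b
    proof -
      have "section_inner Q (section_comb Q a s (Suc N)) (section_comb Q b s (Suc N)) =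
          (\<Sum>i<Suc N. \<Sum>j<Suc N. cnj (a i) * b j * section_inner Q (s i) (s j))"
        by (rule section_inner_comb[OF assms(1,2) form triv herm]) (simp add: hol)
      also have "\<dots> = (\<Sum>i<Suc N. \<Sum>j<Suc N. if j = i then cnj (a i) * b i else 0)"
        by (intro sum.cong refl) (auto simp: ortho)
      also have "\<dots> = cinner (Suc N) a b"
        unfolding cinner_def by (intro sum.cong refl) (simp add: sum.delta)
      finally show ?thesis by simp
    qed
  qed (use triv hol span in auto)
  obtain \<kappa> where \<kappa>: "\<kappa> > 0" "\<And>\<alpha> \<beta>. section_inner (projective N)
      (section_comb (projective N) \<alpha> (coord_section N) (Suc N))
      (section_comb (projective N) \<beta> (coord_section N) (Suc N)) = of_real \<kappa> * cinner (Suc N) \<alpha> \<beta>"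
    using section_inner_projective[of N] by blast
  have P: "orthogonal_sections (projective N) N (coord_section N) \<kappa>"
  proof
    show "\<exists>a. t = section_comb (projective N) a (coord_section N) (Suc N)"
      if "t \<in> hol_sections (projective N)" for t
      using hol_sections_projective[OF that] by blast
  qed (use \<kappa> fibrewise_trivialized_projective coord_section_hol coord_section_comb_hol in auto)
  \<comment> \<open>The same vector \<open>r x\<close> represents \<open>i(x)\<close> for the
    sections of \<open>Q\<close> and for the coordinate sections of projective space. Hence
    \<open>cyclic_fun_eq\<close> evaluates both cyclic functions to one
    \<open>cyclic_ratio\<close>.\<close>
  have rp: "r x \<in> homog_map (projective N) N (coord_section N) (homog_map Q N s x)"
    if x: "x \<in> points Q" for x
  proof -
    \<comment> \<open>The basis provided by \<open>very_ample\<close> may differ from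
      \<open>s\<close>. It yields a section that does not vanish at \<open>x\<close>, which is then
      expanded in \<open>s\<close>.\<close>
    obtain N' b where b: "section_basis Q N' b" "\<exists>j\<le>N'. b j x \<noteq> lzero Q x"
      using assms(6) x unfolding very_ample_def by blast
    then obtain t where t: "t \<in> hol_sections Q" "t x \<noteq> lzero Q x"
      unfolding section_basis_def by blast
    obtain a where "t = section_comb Q a s (Suc N)"
      using span[OF t(1)] by blast
    then have "r x \<in> punctured N"
      using homog_map_punctured[where s = s and N = N and t = t and x = x, OF triv hol _ t(2) assms(8)[OF x]] by blast
    moreover have "homog_map Q N s x = hclass (r x)"
      using triv hol assms(8)[OF x] by (rule homog_map_eq_hclass)
    ultimately show ?thesis
      by (simp only:) (intro mem_homog_map_projective hclass_proj_space hclass_refl)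
  qed
  have Mval: "cyclic_fun Q m x = cyclic_ratio (Suc N) m (\<lambda>k. r (x k))"
    if "\<forall>k<m. x k \<in> points Q" for x
    using that assms(8) by (intro orthogonal_sections.cyclic_fun_eq[OF M]) blast
  have Pval: "cyclic_fun (projective N) m (\<lambda>k. homog_map Q N s (x k)) = cyclic_ratio (Suc N) m (\<lambda>k. r (x k))"
    if "\<forall>k<m. x k \<in> points Q" for x
    using that rp by (intro orthogonal_sections.cyclic_fun_eq[OF P]) blast
  show ?thesis
  proof (intro conjI allI impI)
    fix x assume x: "\<forall>k<m. x k \<in> points Q"
    show "cyclic_fun Q m x = pullback (homog_map Q N s) (cyclic_fun (projective N) m) x"
      unfolding pullback_def Mval[OF x] Pval[OF x] ..
    show "pullback (homog_map Q N s) (cyclic_fun (projective N) m) x =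
        cyclic_fun (projective N) m (\<lambda>k. homog_map Q N s (x k))"
      unfolding pullback_def ..
    show "cyclic_fun (projective N) m (\<lambda>k. homog_map Q N s (x k)) =
        (\<Prod>k<m. cinner (Suc N) (r (x (Suc k mod m))) (r (x k))) /
        of_real (\<Prod>k<m. cnorm2 (Suc N) (r (x k)))"
      unfolding Pval[OF x] cyclic_ratio_def ..
  next
    fix x and d :: nat assume x: "\<forall>k<m. x k \<in> points Q"
    then have "\<forall>k<m. x ((k + d) mod m) \<in> points Q"
      by simp
    from Mval[OF this] show "cyclic_fun Q m (\<lambda>k. x ((k + d) mod m)) = cyclic_fun Q m x"
      unfolding Mval[OF x] using cyclic_ratio_rotate[of "Suc N" m "\<lambda>k. r (x k)" d] by simp
  qed
qed

end
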